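(* Let $K$ be an infinite field, let $r\ge1$, $t=n+r$, and let $$\mathcal{F}=\{F_1,\ldots,F_t\}=\{x_1,\ldots,x_n,L_1,\ldots,L_r\}\subseteq R=K[x_1,\ldots,x_n],\qquad L_i=\sum_{j=1}^n u_{ij}x_j,\ u_{ij}\in K,$$ be such that any three elements of $\mathcal{F}$ form a regular sequence, so that $I=I_{2,\mathcal{F}}=\bigcap_{i<j}(F_i,F_j)$ is the ideal of a linear star configuration of height two. Let $\mathcal{L}$, $\mathcal{P}$, $B$ and the polynomials $m_\Theta$ be as defined in the context. Then: (a) the defining ideal of the Rees algebra $\mathcal{R}(I)$ is $\mathcal{J}=\mathcal{L}+\mathcal{P}S$; (b) if $m_\Theta\ne0$ for every $\Theta\subseteq\{1,\ldots,t\}$ with $|\Theta|=r-1$, then $\mathcal{P}$ is the only associated prime of the ideal $I_n(B)$ of maximal minors of the Jacobian dual matrix $B$ that is not generated by monomials.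
   Context: The ideal $I$ is minimally generated by $g_i=\prod_{j\neq i}F_j$, $1\le i\le t$. Let $S=R[T_1,\ldots,T_t]$. The Rees algebra is $\mathcal{R}(I)=R[g_1\tau,\ldots,g_t\tau]\subseteq R[\tau]$, and its defining ideal $\mathcal{J}$ is the kernel of the $R$-algebra map $S\to\mathcal{R}(I)$, $T_i\mapsto g_i\tau$. $\mathcal{L}$ is the ideal of $S$ generated by the elements of $\mathcal{J}$ that are linear in the $T$-variables, i.e. by $F_iT_i-F_{i+1}T_{i+1}$, $1\le i\le t-1$. Jacobian dual: $B$ is the $n\times(t-1)$ matrix over $K[T_1,\ldots,T_t]$ with columns $A_1,\ldots,A_{n-1},C_1,\ldots,C_r$, where $A_j$ has entry $T_j$ in row $j$, $-T_{j+1}$ in row $j+1$ and $0$ elsewhere, and $C_i$ has entry $u_{ik}T_{n+i}$ in row $k$ for $k<n$ and entry $u_{in}T_{n+i}-T_n$ in row $n$. It satisfies $[x_1,\ldots,x_n]\cdot B=[T_1,\ldots,T_t]\cdot M$ for a Hilbert–Burch presentation matrix $M$ of $I$. $I_n(B)\subseteq K[T_1,\ldots,T_t]$ is the ideal of its $n\times n$ minors. $U$ is the $n\times r$ matrix whose entry in row $k$ and column $i$ is $u_{ik}$. For $\chi\subseteq\{1,\ldots,t\}$ with $|\chi|=r$, $U_\chi$ is the minor of $U$ with rows the elements of $\chi\cap\{1,\ldots,n\}$ and columns those $i\in\{1,\ldots,r\}$ with $n+i\notin\chi$ ($U_\chi=1$ if $\chi\cap\{1,\ldots,n\}=\emptyset$).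 For $\Theta\subseteq\{1,\ldots,t\}$ with $|\Theta|=r-1$, write $\{1,\ldots,t\}\setminus\Theta=\{k_1<\cdots<k_{n+1}\}$, let $h$ be the number of $i$ with $k_i\le n$, and set $$m_\Theta=\sum_{i=1}^{n+1}(-1)^{\alpha(\Theta,k_i)}\,\frac{T_{k_1}\cdots T_{k_{n+1}}}{T_{k_i}}\;U_{\Theta\cup\{k_i\}},\qquad \alpha(\Theta,k_i)=\begin{cases}n-h+i-k_i & i\le h,\\ n+i & i>h.\end{cases}$$ If $m_\Theta\neq0$, let $h_\Theta$ be the quotient of $m_\Theta$ by the product of all variables $T_k$ with $k\notin\Theta$ and $U_{\Theta\cup\{k\}}=0$; if $m_\Theta=0$ let $h_\Theta=0$. $\mathcal{P}\subseteq K[T_1,\ldots,T_t]$ is the ideal generated by all $h_\Theta$, $|\Theta|=r-1$. *)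

theory Defs
  imports
    "HOL-Algebra.Generated_Rings"
    "HOL-Algebra.QuotRing"
    "HOL-Library.Poly_Mapping"
    "Jordan_Normal_Form.Determinant"
begin

section \<open>Polynomial rings as carriers\<close>

text \<open>
  A polynomial in variables indexed by natural numbers is a finitely supported map from exponent
  vectors to coefficients. The type has infinitely many variables; \<open>mpoly_ring A m\<close> cuts out the
  polynomials in the variables \<open>1, \<dots>, m\<close> with coefficients in \<open>A\<close>.
\<close>

type_synonym 'a mpoly = "(nat \<Rightarrow>\<^sub>0 nat) \<Rightarrow>\<^sub>0 'a"

definition mvar :: "nat \<Rightarrow> 'a::comm_ring_1 mpoly" where
  "mvar i = Poly_Mapping.single (Poly_Mapping.single i 1) 1"

definition mconst :: "'a::comm_ring_1 \<Rightarrow> 'a mpoly" where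
  "mconst c = Poly_Mapping.single 0 c"

definition mpoly_ring :: "'a::comm_ring_1 set \<Rightarrow> nat \<Rightarrow> 'a mpoly ring" where
  "mpoly_ring A m =
    \<lparr>carrier = {p. (\<forall>e. Poly_Mapping.lookup p e \<in> A) \<and>
                   (\<forall>e\<in>Poly_Mapping.keys p. Poly_Mapping.keys e \<subseteq> {1..m})},
     monoid.mult = (*), one = 1, zero = 0, add = (+)\<rparr>"

definition upoly_ring :: "'a::comm_ring_1 set \<Rightarrow> 'a poly ring" where
  "upoly_ring A =
    \<lparr>carrier = {q. \<forall>k. Polynomial.coeff q k \<in> A},
     monoid.mult = (*), one = 1, zero = 0, add = (+)\<rparr>"

text \<open>
  \<open>R = K[x\<^sub>1,\<dots>,x\<^sub>n]\<close>, \<open>R[\<tau>]\<close>, \<open>S = R[T\<^sub>1,\<dots>,T\<^sub>t]\<close> and \<open>K[T\<^sub>1,\<dots>,T\<^sub>t]\<close>; the field \<open>K\<close> is the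
  whole type \<open>'k\<close>.
\<close>

definition ring_R :: "nat \<Rightarrow> 'k::field mpoly ring" where
  "ring_R n = mpoly_ring UNIV n"

definition ring_Rtau :: "nat \<Rightarrow> 'k::field mpoly poly ring" where
  "ring_Rtau n = upoly_ring (carrier (ring_R n))"

definition ring_S :: "nat \<Rightarrow> nat \<Rightarrow> 'k::field mpoly mpoly ring" where
  "ring_S n t = mpoly_ring (carrier (ring_R n)) t"

definition ring_KT :: "nat \<Rightarrow> 'k::field mpoly ring" where
  "ring_KT t = mpoly_ring UNIV t"

text \<open>The inclusion \<open>K[T\<^sub>1,\<dots>,T\<^sub>t] \<subseteq> S\<close>: coefficients become constants of \<open>R\<close>.\<close>

definition KT_to_S :: "'k::field mpoly \<Rightarrow> 'k mpoly mpoly" where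
  "KT_to_S p = Poly_Mapping.map mconst p"


section \<open>Commutative algebra\<close>

definition regular_sequence :: "('a, 'b) ring_scheme \<Rightarrow> 'a list \<Rightarrow> bool" where
  "regular_sequence A fs \<longleftrightarrow>
    set fs \<subseteq> carrier A \<and>
    (\<forall>i<length fs. \<forall>a\<in>carrier A.
       a \<otimes>\<^bsub>A\<^esub> fs ! i \<in> Idl\<^bsub>A\<^esub> (set (take i fs)) \<longrightarrow> a \<in> Idl\<^bsub>A\<^esub> (set (take i fs))) \<and>
    Idl\<^bsub>A\<^esub> (set fs) \<noteq> carrier A"

text \<open>\<open>Q\<close> is an associated prime of the ideal \<open>J\<close>, i.e. of the module \<open>A/J\<close>.\<close>

definition associated_prime :: "('a, 'b) ring_scheme \<Rightarrow> 'a set \<Rightarrow> 'a set \<Rightarrow> bool" where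
  "associated_prime A J Q \<longleftrightarrow>
    primeideal Q A \<and> (\<exists>a\<in>carrier A. Q = {b \<in> carrier A. b \<otimes>\<^bsub>A\<^esub> a \<in> J})"

definition monomial_ideal :: "nat \<Rightarrow> 'k::field mpoly set \<Rightarrow> bool" where
  "monomial_ideal t Q \<longleftrightarrow>
    (\<exists>M \<subseteq> {Poly_Mapping.single e 1 | e. Poly_Mapping.keys e \<subseteq> {1..t}}. Q = Idl\<^bsub>ring_KT t\<^esub> M)"

text \<open>
  Minors of a matrix given by an entry function with rows and columns numbered from 1. Rows and
  columns are taken in increasing order; the empty minor is 1.
\<close>

definition minor :: "(nat \<Rightarrow> nat \<Rightarrow> 'a::comm_ring_1) \<Rightarrow> nat set \<Rightarrow> nat set \<Rightarrow> 'a" where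
  "minor M X Y =
    det (mat (card X) (card Y)
      (\<lambda>(a, b). M (sorted_list_of_set X ! a) (sorted_list_of_set Y ! b)))"


section \<open>The star configuration and its Rees algebra\<close>

text \<open>
  Throughout, \<open>t = n + r\<close>, and \<open>u i j\<close> (\<open>1 \<le> i \<le> r\<close>, \<open>1 \<le> j \<le> n\<close>) are the coefficients of
  \<open>L\<^sub>i = (\<Sum>j. u\<^sub>i\<^sub>j x\<^sub>j)\<close>; \<open>F n u i\<close> is \<open>x\<^sub>i\<close> for \<open>i \<le> n\<close> and \<open>L\<^sub>i\<^sub>-\<^sub>n\<close> for \<open>i > n\<close>.
\<close>

definition F :: "nat \<Rightarrow> (nat \<Rightarrow> nat \<Rightarrow> 'k::field) \<Rightarrow> nat \<Rightarrow> 'k mpoly" where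
  "F n u i = (if i \<le> n then mvar i else (\<Sum>j=1..n. mconst (u (i - n) j) * mvar j))"

definition star_ideal :: "nat \<Rightarrow> nat \<Rightarrow> (nat \<Rightarrow> nat \<Rightarrow> 'k::field) \<Rightarrow> 'k mpoly set" where
  "star_ideal n r u =
    \<Inter> {Idl\<^bsub>ring_R n\<^esub> {F n u i, F n u j} | i j. 1 \<le> i \<and> i < j \<and> j \<le> n + r}"

definition g :: "nat \<Rightarrow> nat \<Rightarrow> (nat \<Rightarrow> nat \<Rightarrow> 'k::field) \<Rightarrow> nat \<Rightarrow> 'k mpoly" where
  "g n r u i = (\<Prod>j\<in>{1..n + r} - {i}. F n u j)"

text \<open>
  \<open>R(I) = R[I\<tau>] \<subseteq> R[\<tau>]\<close> for an ideal \<open>I\<close> of \<open>R\<close>. For the star ideal, which is generated by the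
  \<open>g\<^sub>i\<close>, this is \<open>R[g\<^sub>1\<tau>,\<dots>,g\<^sub>t\<tau>]\<close>.
\<close>

definition rees_algebra :: "nat \<Rightarrow> 'k::field mpoly set \<Rightarrow> 'k mpoly poly ring" where
  "rees_algebra n I =
    (ring_Rtau n)\<lparr>carrier := generate_ring (ring_Rtau n)
      ({[:a:] | a. a \<in> carrier (ring_R n)} \<union> {Polynomial.monom f 1 | f. f \<in> I})\<rparr>"

text \<open>The \<open>R\<close>-algebra map with \<open>T\<^sub>i \<mapsto> g\<^sub>i\<tau>\<close>.\<close>

definition rees_map ::
  "nat \<Rightarrow> nat \<Rightarrow> (nat \<Rightarrow> nat \<Rightarrow> 'k::field) \<Rightarrow> 'k mpoly mpoly \<Rightarrow> 'k mpoly poly" where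
  "rees_map n r u p =
    (\<Sum>e\<in>Poly_Mapping.keys p. [:Poly_Mapping.lookup p e:] *
      (\<Prod>i\<in>Poly_Mapping.keys e. Polynomial.monom (g n r u i) 1 ^ Poly_Mapping.lookup e i))"

definition rees_defining_ideal ::
  "nat \<Rightarrow> nat \<Rightarrow> (nat \<Rightarrow> nat \<Rightarrow> 'k::field) \<Rightarrow> 'k mpoly mpoly set" where
  "rees_defining_ideal n r u =
    a_kernel (ring_S n (n + r)) (rees_algebra n (star_ideal n r u)) (rees_map n r u)"

definition linear_ideal ::
  "nat \<Rightarrow> nat \<Rightarrow> (nat \<Rightarrow> nat \<Rightarrow> 'k::field) \<Rightarrow> 'k mpoly mpoly set" where
  "linear_ideal n r u = Idl\<^bsub>ring_S n (n + r)\<^esub>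
    {mconst (F n u i) * mvar i - mconst (F n u (i + 1)) * mvar (i + 1) | i.
      1 \<le> i \<and> i \<le> n + r - 1}"


section \<open>The Jacobian dual\<close>

text \<open>
  Columns \<open>j < n\<close> are the \<open>A\<^sub>j\<close>, and column \<open>n - 1 + i\<close> is \<open>C\<^sub>i\<close>, which involves \<open>T\<^sub>n\<^sub>+\<^sub>i\<close>.
\<close>

definition jacobian_dual :: "nat \<Rightarrow> (nat \<Rightarrow> nat \<Rightarrow> 'k::field) \<Rightarrow> nat \<Rightarrow> nat \<Rightarrow> 'k mpoly" where
  "jacobian_dual n u k j =
    (if j < n then
       (if k = j then mvar j else if k = j + 1 then - mvar (j + 1) else 0)
     else
       (let i = j - (n - 1) in
         if k < n then mconst (u i k) * mvar (n + i)
         else mconst (u i n) * mvar (n + i) - mvar n))"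

definition jacobian_minors_ideal ::
  "nat \<Rightarrow> nat \<Rightarrow> (nat \<Rightarrow> nat \<Rightarrow> 'k::field) \<Rightarrow> 'k mpoly set" where
  "jacobian_minors_ideal n r u = Idl\<^bsub>ring_KT (n + r)\<^esub>
    {minor (jacobian_dual n u) {1..n} C | C. C \<subseteq> {1..n + r - 1} \<and> card C = n}"


section \<open>The ideal P\<close>

text \<open>The matrix \<open>U\<close> has entry \<open>u\<^sub>i\<^sub>k\<close> in row \<open>k\<close> and column \<open>i\<close>.\<close>

definition U_minor :: "nat \<Rightarrow> nat \<Rightarrow> (nat \<Rightarrow> nat \<Rightarrow> 'k::field) \<Rightarrow> nat set \<Rightarrow> 'k" where
  "U_minor n r u \<chi> = minor (\<lambda>k i. u i k) (\<chi> \<inter> {1..n}) {i\<in>{1..r}. n + i \<notin> \<chi>}"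

text \<open>
  \<open>kth n r \<Theta> i\<close> is \<open>k\<^sub>i\<close>. The subtraction in \<open>\<alpha>\<close> does not truncate: \<open>k\<^sub>i - i\<close> counts the elements
  of \<open>\<Theta>\<close> below \<open>k\<^sub>i\<close>, and for \<open>i \<le> h\<close> this is at most \<open>n - h\<close>.
\<close>

definition kth :: "nat \<Rightarrow> nat \<Rightarrow> nat set \<Rightarrow> nat \<Rightarrow> nat" where
  "kth n r \<Theta> i = sorted_list_of_set ({1..n + r} - \<Theta>) ! (i - 1)"

definition alpha :: "nat \<Rightarrow> nat \<Rightarrow> nat set \<Rightarrow> nat \<Rightarrow> nat" where
  "alpha n r \<Theta> i =
    (let h = card {j\<in>{1..n + 1}. kth n r \<Theta> j \<le> n} in
      if i \<le> h then n - h + i - kth n r \<Theta> i else n + i)"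

definition m_poly ::
  "nat \<Rightarrow> nat \<Rightarrow> (nat \<Rightarrow> nat \<Rightarrow> 'k::field) \<Rightarrow> nat set \<Rightarrow> 'k mpoly" where
  "m_poly n r u \<Theta> =
    (\<Sum>i=1..n + 1. (-1) ^ alpha n r \<Theta> i *
      (\<Prod>j\<in>{1..n + 1} - {i}. mvar (kth n r \<Theta> j)) *
      mconst (U_minor n r u (\<Theta> \<union> {kth n r \<Theta> i})))"

text \<open>
  The quotient in the second case exists, since each nonzero term of \<open>m\<^sub>\<Theta>\<close> is divisible by the
  product, and it is unique, since polynomials over a field form a domain.
\<close>

definition h_poly ::
  "nat \<Rightarrow> nat \<Rightarrow> (nat \<Rightarrow> nat \<Rightarrow> 'k::field) \<Rightarrow> nat set \<Rightarrow> 'k mpoly" where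
  "h_poly n r u \<Theta> =
    (if m_poly n r u \<Theta> = 0 then 0
     else (THE q. q * (\<Prod>k\<in>{k\<in>{1..n + r} - \<Theta>. U_minor n r u (\<Theta> \<union> {k}) = 0}. mvar k)
                  = m_poly n r u \<Theta>))"

definition P_ideal :: "nat \<Rightarrow> nat \<Rightarrow> (nat \<Rightarrow> nat \<Rightarrow> 'k::field) \<Rightarrow> 'k mpoly set" where
  "P_ideal n r u = Idl\<^bsub>ring_KT (n + r)\<^esub>
    {h_poly n r u \<Theta> | \<Theta>. \<Theta> \<subseteq> {1..n + r} \<and> card \<Theta> = r - 1}"

end

theory Submission
  imports Defs
begin

text \<open>
  The Rees algebra is \<open>K[x, W/F\<^sub>1, \<dots>, W/F\<^sub>t]\<close> with \<open>W = F\<^sub>1 \<cdots> F\<^sub>t \<tau>\<close>, which gives the relations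
  \<open>F\<^sub>i T\<^sub>i = W\<close> (with \<open>W\<close> as an additional variable). Every linear dependency \<open>\<Sum>\<^sub>i a\<^sub>i F\<^sub>i = 0\<close> with support \<open>C\<close> gives a relation \<open>\<Sum>\<^sub>i a\<^sub>i \<Prod>\<^sub>j\<^sub>\<noteq>\<^sub>i T\<^sub>j = 0\<close> over \<open>C\<close>. These
  relations generate the kernel for any family of nonzero linear forms, by induction on \<open>t\<close>: in a
  relation of degree \<open>M\<close> in \<open>T\<^sub>t\<close>, the coefficient of the top power of \<open>T\<^sub>t\<close>, restricted to the
  hyperplane \<open>F\<^sub>t = 0\<close>, is a relation of the restricted forms, and \<open>T\<^sub>t\<close> times a generator for the
  restricted forms is a relation of the original ones up to lower order in \<open>T\<^sub>t\<close>. Dependencies of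
  minimal support come from Cramer's rule, so their relations are scalar multiples of the \<open>h\<^sub>\<Theta>\<close>.

  For the second part let \<open>I = I\<^sub>n(B)\<close>. If all \<open>m\<^sub>\<Theta>\<close> are nonzero, then \<open>I\<close> is the intersection of \<open>P\<close>
  with the primes \<open>(T\<^sub>k : k \<notin> X)\<close>, where \<open>X\<close> runs over the \<open>n\<close>-subsets indexing dependent forms. For
  the inclusion of \<open>I\<close>, exhibit a left kernel vector of \<open>B\<close> modulo each of these primes. Conversely
  \<open>m\<^sub>\<Theta> \<in> I\<close>; write an element of \<open>P\<close> as a combination of monomial multiples of the \<open>h\<^sub>\<Theta>\<close>. A multiple
  involving more than \<open>n\<close> variables is a multiple of some \<open>m\<^sub>\<Theta>\<close>, and all monomials of the other
  multiples lie outside the intersection of the monomial primes, so their sum has to vanish.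
\<close>

section \<open>Evaluation of polynomials\<close>

text \<open>Restriction to the hyperplane of one form can make other forms proportional or zero, so
  the induction on \<open>t\<close> cannot stay within star configurations; hence the generality of
  the kernel theorem. A form vanishing on the hyperplane of \<open>f\<^sub>t\<close> is a scalar
  multiple of \<open>f\<^sub>t\<close>, and then \<open>T\<^sub>t\<close> is a scalar multiple of
  another variable modulo the relations. The variable for \<open>W\<close> makes all linear
  relations alike: lifting a restricted relation produces \<open>f\<^sub>t T\<^sub>t\<close>, which
  is replaced by \<open>W\<close> and so becomes free of \<open>T\<^sub>t\<close>. It also lets the
  induction start at \<open>t = 0\<close>, where \<open>W\<close> maps to \<tau>. In the end
  \<open>W\<close> is specialised to \<open>F\<^sub>1 T\<^sub>1\<close>. \<open>P\<close> is the
  part of the kernel in \<open>K[T]\<close> and therefore prime, as \<open>R[\<tau>]\<close> is a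
  domain. If \<open>m\<^sub>\<Theta> \<noteq> 0\<close>, the \<open>n + 1\<close> forms outside
  \<Theta> have rank \<open>n\<close>, so their dependency is unique up to a scalar; this is what
  ties the monomial multiples of the \<open>h\<^sub>\<Theta>\<close> to the
  \<open>m\<^sub>\<Theta>\<close>.\<close>

abbreviation "keys \<equiv> Poly_Mapping.keys"
abbreviation "lookup \<equiv> Poly_Mapping.lookup"

definition mon_eval :: "(nat \<Rightarrow> 'b::comm_ring_1) \<Rightarrow> (nat \<Rightarrow>\<^sub>0 nat) \<Rightarrow> 'b" where
  "mon_eval v e = (\<Prod>i\<in>keys e. v i ^ lookup e i)"

text \<open>The coefficient map \<open>h\<close> is a parameter because the Rees map, the
  restriction to a hyperplane, the inclusion of \<open>K[T]\<close> into \<open>S\<close> and the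
  setting of variables to 0 all arise as instances, with different \<open>h\<close>.\<close>

definition mpoly_eval :: "('a::comm_ring_1 \<Rightarrow> 'b::comm_ring_1) \<Rightarrow> (nat \<Rightarrow> 'b) \<Rightarrow> 'a mpoly \<Rightarrow> 'b" where
  "mpoly_eval h v p = (\<Sum>e\<in>keys p. h (lookup p e) * mon_eval v e)"

lemma mon_eval_superset:
  assumes "finite A" "keys e \<subseteq> A"
  shows "mon_eval v e = (\<Prod>i\<in>A. v i ^ lookup e i)"
  unfolding mon_eval_def
  by (rule prod.mono_neutral_left[OF assms]) (auto simp: in_keys_iff)

lemma mon_eval_add: "mon_eval v (e + e') = mon_eval v e * mon_eval v e'"
proof -
  let ?A = "keys e \<union> keys e'"
  have A: "finite ?A" by simp
  have "mon_eval v (e + e') = (\<Prod>i\<in>?A. v i ^ lookup (e + e') i)"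
    by (rule mon_eval_superset[OF A keys_add])
  also have "\<dots> = (\<Prod>i\<in>?A. v i ^ lookup e i) * (\<Prod>i\<in>?A. v i ^ lookup e' i)"
    by (simp add: lookup_add power_add prod.distrib)
  also have "\<dots> = mon_eval v e * mon_eval v e'"
    by (simp add: mon_eval_superset[OF A])
  finally show ?thesis .
qed

lemma mon_eval_zero [simp]: "mon_eval v 0 = 1"
  by (simp add: mon_eval_def)

lemma mon_eval_single [simp]: "mon_eval v (Poly_Mapping.single i k) = v i ^ k"
  by (cases "k = 0") (simp_all add: mon_eval_def)

lemma single_eq_sum_keys:
  "(p :: 'a::comm_ring_1 mpoly) = (\<Sum>e\<in>keys p. Poly_Mapping.single e (lookup p e))"
  by (rule poly_mapping_eqI)
     (simp add: lookup_sum lookup_single when_def in_keys_iff)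

context comm_ring_hom
begin

lemma mpoly_eval_superset:
  assumes "finite A" "keys p \<subseteq> A"
  shows "mpoly_eval hom v p = (\<Sum>e\<in>A. hom (lookup p e) * mon_eval v e)"
  unfolding mpoly_eval_def
  by (rule sum.mono_neutral_left[OF assms]) (auto simp: in_keys_iff)

lemma mpoly_eval_add: "mpoly_eval hom v (p + q) = mpoly_eval hom v p + mpoly_eval hom v q"
proof -
  let ?A = "keys p \<union> keys q"
  have A: "finite ?A" by simp
  show ?thesis
    using keys_add[of p q]
    by (simp add: mpoly_eval_superset[OF A] lookup_add hom_add sum.distrib ring_distribs)
qed

lemma mpoly_eval_single:
  "mpoly_eval hom v (Poly_Mapping.single e c) = hom c * mon_eval v e"
  by (cases "c = 0") (simp_all add: mpoly_eval_def)

lemma mpoly_eval_zero: "mpoly_eval hom v 0 = 0"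
  by (simp add: mpoly_eval_def)

lemma mpoly_eval_sum: "mpoly_eval hom v (sum f A) = (\<Sum>x\<in>A. mpoly_eval hom v (f x))"
  by (induction A rule: infinite_finite_induct) (simp_all add: mpoly_eval_add mpoly_eval_zero)

lemma mpoly_eval_mult: "mpoly_eval hom v (p * q) = mpoly_eval hom v p * mpoly_eval hom v q"
proof -
  have "mpoly_eval hom v (p * q) = mpoly_eval hom v
     ((\<Sum>e\<in>keys p. Poly_Mapping.single e (lookup p e)) * (\<Sum>e\<in>keys q. Poly_Mapping.single e (lookup q e)))"
    using single_eq_sum_keys[of p] single_eq_sum_keys[of q] by simp
  also have "\<dots> = (\<Sum>e\<in>keys p. \<Sum>e'\<in>keys q.
      (hom (lookup p e) * mon_eval v e) * (hom (lookup q e') * mon_eval v e'))"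
    by (simp add: sum_product mult_single mpoly_eval_sum mpoly_eval_single mon_eval_add hom_mult
        mult_ac)
  also have "\<dots> = mpoly_eval hom v p * mpoly_eval hom v q"
    by (simp add: sum_product mpoly_eval_def)
  finally show ?thesis .
qed

lemma mpoly_eval_hom: "comm_ring_hom (mpoly_eval hom v)"
proof
  show "mpoly_eval hom v 1 = 1"
    using mpoly_eval_single[of v 0 1] by simp
qed (simp_all add: mpoly_eval_add mpoly_eval_mult mpoly_eval_zero)

lemma mpoly_eval_mvar [simp]: "mpoly_eval hom v (mvar i) = v i"
  by (simp add: mvar_def mpoly_eval_single)

lemma mpoly_eval_mconst [simp]: "mpoly_eval hom v (mconst c) = hom c"
  by (simp add: mconst_def mpoly_eval_single)

end

lemma comm_ring_hom_id: "comm_ring_hom (\<lambda>x. x)"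
  by unfold_locales simp_all

lemma comm_ring_hom_comp:
  assumes "comm_ring_hom f" "comm_ring_hom f'"
  shows "comm_ring_hom (\<lambda>x. f (f' x))"
proof -
  interpret f: comm_ring_hom f by fact
  interpret g: comm_ring_hom f' by fact
  show ?thesis
    by unfold_locales (simp_all add: g.hom_add f.hom_add g.hom_mult f.hom_mult)
qed

lemma comm_ring_hom_mconst: "comm_ring_hom mconst"
  by unfold_locales (simp_all add: mconst_def single_add mult_single)

global_interpretation mconst: comm_ring_hom mconst
  by (rule comm_ring_hom_mconst)

lemma mconst_eq_iff [simp]: "mconst a = mconst b \<longleftrightarrow> a = b"
  by (metis mconst_def lookup_single_eq)

lemma mconst_eq_0_iff [simp]: "mconst a = 0 \<longleftrightarrow> a = 0"
  using mconst_eq_iff[of a 0] by (simp del: mconst_eq_iff)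

lemma mvar_nonzero [simp]: "mvar i \<noteq> (0::'a::comm_ring_1 mpoly)"
  by (metis keys_single keys_zero insert_not_empty mvar_def zero_neq_one)

lemma comm_ring_hom_pCons: "comm_ring_hom (\<lambda>a::'a::comm_ring_1. [:a:])"
  by unfold_locales (simp_all add: one_pCons)

section \<open>Polynomials with prescribed coefficients and variables\<close>

text \<open>All carriers are subsets of types that are commutative rings, so computations can use
  the operations of the type and only closure has to be tracked.\<close>

definition subring_set :: "'a::comm_ring_1 set \<Rightarrow> bool" where
  "subring_set A \<longleftrightarrow> 1 \<in> A \<and> (\<forall>x\<in>A. \<forall>y\<in>A. x - y \<in> A \<and> x * y \<in> A)"

lemma subring_setD:
  assumes "subring_set A"
  shows "1 \<in> A" "0 \<in> A"
    and "\<And>x y. x \<in> A \<Longrightarrow> y \<in> A \<Longrightarrow> x - y \<in> A"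
    and "\<And>x. x \<in> A \<Longrightarrow> - x \<in> A"
    and "\<And>x y. x \<in> A \<Longrightarrow> y \<in> A \<Longrightarrow> x + y \<in> A"
    and "\<And>x y. x \<in> A \<Longrightarrow> y \<in> A \<Longrightarrow> x * y \<in> A"
proof -
  show 1: "1 \<in> A" and d: "\<And>x y. x \<in> A \<Longrightarrow> y \<in> A \<Longrightarrow> x - y \<in> A"
    and "\<And>x y. x \<in> A \<Longrightarrow> y \<in> A \<Longrightarrow> x * y \<in> A"
    using assms by (auto simp: subring_set_def)
  show 0: "0 \<in> A" using d[OF 1 1] by simp
  show m: "- x \<in> A" if "x \<in> A" for x using d[OF 0 that] by simp
  show "x + y \<in> A" if "x \<in> A" "y \<in> A" for x y
    using d[OF that(1) m[OF that(2)]] by simp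
qed

lemma subring_set_UNIV [simp]: "subring_set UNIV"
  by (simp add: subring_set_def)

lemma subring_set_sum:
  assumes "subring_set A" "\<And>x. x \<in> I \<Longrightarrow> f x \<in> A"
  shows "sum f I \<in> A"
  using assms(2) by (induction I rule: infinite_finite_induct) (auto simp: subring_setD[OF assms(1)])

lemma subring_set_prod:
  assumes "subring_set A" "\<And>x. x \<in> I \<Longrightarrow> f x \<in> A"
  shows "prod f I \<in> A"
  using assms(2) by (induction I rule: infinite_finite_induct) (auto simp: subring_setD[OF assms(1)])

lemma subring_set_power:
  assumes "subring_set A" "x \<in> A"
  shows "x ^ k \<in> A"
  by (induction k) (auto simp: subring_setD[OF assms(1)] assms(2))

text \<open>The set of variables is arbitrary, unlike in \<open>mpoly_ring\<close>: index 0 will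
  name an additional variable, and circuits call for polynomials in the variables of their
  support.\<close>

definition mpolys :: "'a::comm_ring_1 set \<Rightarrow> nat set \<Rightarrow> 'a mpoly set" where
  "mpolys A V = {p. (\<forall>e. lookup p e \<in> A) \<and> (\<forall>e\<in>keys p. keys e \<subseteq> V)}"

lemma mpolys_mono: "A \<subseteq> B \<Longrightarrow> V \<subseteq> W \<Longrightarrow> mpolys A V \<subseteq> mpolys B W"
  unfolding mpolys_def by blast

lemma single_in_mpolys:
  "subring_set A \<Longrightarrow> c \<in> A \<Longrightarrow> keys e \<subseteq> V \<Longrightarrow> Poly_Mapping.single e c \<in> mpolys A V"
  by (auto simp: mpolys_def lookup_single when_def subring_setD split: if_splits)

lemma mconst_in_mpolys: "subring_set A \<Longrightarrow> c \<in> A \<Longrightarrow> mconst c \<in> mpolys A V"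
  unfolding mconst_def by (rule single_in_mpolys) auto

lemma mvar_in_mpolys: "subring_set A \<Longrightarrow> i \<in> V \<Longrightarrow> mvar i \<in> mpolys A V"
  unfolding mvar_def by (rule single_in_mpolys) (auto simp: subring_setD)

lemma mpolys_0: "subring_set A \<Longrightarrow> 0 \<in> mpolys A V"
  by (auto simp: mpolys_def subring_setD)

lemma mpolys_add:
  assumes "subring_set A" "p \<in> mpolys A V" "q \<in> mpolys A V"
  shows "p + q \<in> mpolys A V"
  using assms(2,3) keys_add[of p q] unfolding mpolys_def
  by (fastforce simp: lookup_add subring_setD[OF assms(1)])

lemma mpolys_minus:
  assumes "subring_set A" "p \<in> mpolys A V" "q \<in> mpolys A V"
  shows "p - q \<in> mpolys A V"
  using assms(2,3) keys_diff[of p q] unfolding mpolys_def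
  by (fastforce simp: lookup_minus subring_setD[OF assms(1)])

lemma mpolys_sum:
  assumes "subring_set A" "\<And>x. x \<in> I \<Longrightarrow> f x \<in> mpolys A V"
  shows "sum f I \<in> mpolys A V"
  using assms(2)
  by (induction I rule: infinite_finite_induct) (auto simp: mpolys_0 mpolys_add assms(1))

lemma mpolys_mult:
  assumes "subring_set A" "p \<in> mpolys A V" "q \<in> mpolys A V"
  shows "p * q \<in> mpolys A V"
proof -
  have "p * q = (\<Sum>e\<in>keys p. \<Sum>e'\<in>keys q. Poly_Mapping.single (e + e') (lookup p e * lookup q e'))"
    by (subst single_eq_sum_keys[of p], subst single_eq_sum_keys[of q])
       (simp only: sum_product mult_single)
  also have "\<dots> \<in> mpolys A V"
    using assms(2,3)
    by (intro mpolys_sum assms(1) single_in_mpolys subring_setD(6) order_trans[OF keys_add])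
       (auto simp: mpolys_def)
  finally show ?thesis .
qed

lemma subring_set_mpolys: "subring_set A \<Longrightarrow> subring_set (mpolys A V)"
  unfolding subring_set_def[of "mpolys A V"]
  using mconst_in_mpolys[of A 1 V] by (auto simp: mpolys_minus mpolys_mult subring_setD)

lemma mon_eval_in: "subring_set B \<Longrightarrow> (\<And>i. i \<in> keys e \<Longrightarrow> v i \<in> B) \<Longrightarrow> mon_eval v e \<in> B"
  unfolding mon_eval_def by (intro subring_set_prod subring_set_power) auto

lemma mpoly_eval_in:
  assumes "subring_set B" "p \<in> mpolys A V" "\<And>a. a \<in> A \<Longrightarrow> h a \<in> B" "\<And>i. i \<in> V \<Longrightarrow> v i \<in> B"
  shows "mpoly_eval h v p \<in> B"
  unfolding mpoly_eval_def using assms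
  by (intro subring_set_sum subring_setD(6) mon_eval_in) (auto simp: mpolys_def, blast)

lemma single_eq_mconst_mon_eval: "Poly_Mapping.single e c = mconst c * mon_eval mvar e"
proof -
  have "mon_eval mvar e = (Poly_Mapping.single e 1 :: 'a mpoly)"
  proof (induction e rule: Poly_Mapping.update_induct)
    case const
    show ?case by simp
  next
    case (update f a b)
    have eq: "Poly_Mapping.update a b f = f + Poly_Mapping.single a b"
      using update by (intro poly_mapping_eqI) (auto simp: lookup_update lookup_add lookup_single when_def in_keys_iff)
    have pw: "mvar a ^ k = (Poly_Mapping.single (Poly_Mapping.single a k) 1 :: 'a mpoly)" for k
      by (induction k) (simp_all add: mvar_def mult_single single_add[symmetric])
    show ?case unfolding eq by (simp add: mon_eval_add update pw mult_single)
  qed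
  then show ?thesis by (simp add: mconst_def mult_single)
qed

text \<open>The polynomials with property \<open>P\<close> form a subring containing the constants
  and the variables, and \<open>p\<close> is its own evaluation at \<open>mvar\<close>, hence lies
  in that subring.\<close>

lemma mpolys_induct [consumes 2, case_names const var add mult]:
  assumes "subring_set A" "p \<in> mpolys A V"
    and "\<And>c. c \<in> A \<Longrightarrow> P (mconst c)" "\<And>i. i \<in> V \<Longrightarrow> P (mvar i)"
    and add: "\<And>p q. p \<in> mpolys A V \<Longrightarrow> q \<in> mpolys A V \<Longrightarrow> P p \<Longrightarrow> P q \<Longrightarrow> P (p + q)"
    and mult: "\<And>p q. p \<in> mpolys A V \<Longrightarrow> q \<in> mpolys A V \<Longrightarrow> P p \<Longrightarrow> P q \<Longrightarrow> P (p * q)"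
  shows "P p"
proof -
  note sr = subring_set_mpolys[OF assms(1), of V]
  let ?B = "{p \<in> mpolys A V. P p}"
  have m: "x * y \<in> ?B" if "x \<in> ?B" "y \<in> ?B" for x y
    using that mult subring_setD(6)[OF sr] by blast
  have 1: "1 \<in> ?B"
    using assms(3)[of 1] mconst_in_mpolys[of A 1 V] assms(1) by (auto simp: subring_setD)
  have "- 1 \<in> ?B"
    using assms(3)[of "-1"] mconst_in_mpolys[of A "-1" V] assms(1)
    by (auto simp: subring_setD mconst.hom_uminus)
  from m[OF this] have n: "- x \<in> ?B" if "x \<in> ?B" for x
    using that by simp
  have "subring_set ?B"
    unfolding subring_set_def
  proof (intro conjI ballI)
    fix x y assume xy: "x \<in> ?B" "y \<in> ?B"
    show "x * y \<in> ?B" using m[OF xy] .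
    show "x - y \<in> ?B" using xy(1) n[OF xy(2)] add[of x "- y"] subring_setD(5)[OF sr, of x "-y"] by auto
  qed (fact 1)
  then have "mpoly_eval mconst mvar p \<in> ?B"
    using assms by (intro mpoly_eval_in[OF _ assms(2)]) (auto simp: mconst_in_mpolys mvar_in_mpolys)
  also have "mpoly_eval mconst mvar p = p"
    using single_eq_sum_keys[of p] by (simp add: mpoly_eval_def single_eq_mconst_mon_eval)
  finally show ?thesis by simp
qed

lemma mpoly_hom_eqI:
  assumes "comm_ring_hom f" "comm_ring_hom f'" "subring_set A" "p \<in> mpolys A V"
    and "\<And>c. c \<in> A \<Longrightarrow> f (mconst c) = f' (mconst c)" "\<And>i. i \<in> V \<Longrightarrow> f (mvar i) = f' (mvar i)"
  shows "f p = f' p"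
proof -
  interpret f: comm_ring_hom f by fact
  interpret g: comm_ring_hom f' by fact
  show ?thesis using assms(3,4)
    by (induction p rule: mpolys_induct) (auto simp: assms f.hom_add g.hom_add f.hom_mult g.hom_mult)
qed

text \<open>From \<open>p q - h(p) h(q) = (p - h(p)) q + h(p) (q - h(q))\<close>, divisibility of
  \<open>p - h(p)\<close> by \<open>l\<close> passes to products, so it need only be checked on
  constants and variables.\<close>

lemma hom_diff_multiple:
  assumes A: "subring_set A" and h: "comm_ring_hom h"
    and hV: "\<And>p. p \<in> mpolys A V \<Longrightarrow> h p \<in> mpolys A V"
    and c: "\<And>c. c \<in> A \<Longrightarrow> \<exists>q\<in>mpolys A V. mconst c - h (mconst c) = l * q"
    and v: "\<And>i. i \<in> V \<Longrightarrow> \<exists>q\<in>mpolys A V. mvar i - h (mvar i) = l * q"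
    and p: "p \<in> mpolys A V"
  shows "\<exists>q\<in>mpolys A V. p - h p = l * q"
  using A p
proof (induction p rule: mpolys_induct)
  case (add p q)
  then obtain a b where ab: "a \<in> mpolys A V" "b \<in> mpolys A V" "p - h p = l * a" "q - h q = l * b"
    by blast
  interpret h: comm_ring_hom h by fact
  have "p + q - h (p + q) = (p - h p) + (q - h q)" by (simp add: h.hom_add)
  also have "\<dots> = l * (a + b)" by (simp add: ab distrib_left)
  finally show ?case by (rule bexI) (intro mpolys_add A ab)
next
  case (mult p q)
  then obtain a b where ab: "a \<in> mpolys A V" "b \<in> mpolys A V" "p - h p = l * a" "q - h q = l * b"
    by blast
  interpret h: comm_ring_hom h by fact
  have "p * q - h (p * q) = (p - h p) * q + h p * (q - h q)" by (simp add: h.hom_mult algebra_simps)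
  also have "\<dots> = l * (a * q + h p * b)" by (simp add: ab algebra_simps)
  finally show ?case by (rule bexI) (intro mpolys_add mpolys_mult A ab hV mult.hyps)
qed (use c v in auto)

section \<open>Ideals in subrings\<close>

text \<open>Combinations are built one term at a time, which gives membership an induction rule.
  Coefficients range over the subring \<open>A\<close>, while the operations are those of the
  type.\<close>

inductive_set gen_ideal :: "'a::comm_ring_1 set \<Rightarrow> 'a set \<Rightarrow> 'a set" for A G where
  zero: "0 \<in> gen_ideal A G"
| step: "c \<in> A \<Longrightarrow> s \<in> G \<Longrightarrow> x \<in> gen_ideal A G \<Longrightarrow> c * s + x \<in> gen_ideal A G"

lemma gen_ideal_mult_gen: "c \<in> A \<Longrightarrow> s \<in> G \<Longrightarrow> c * s \<in> gen_ideal A G"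
  using gen_ideal.step[OF _ _ gen_ideal.zero] by fastforce

lemma gen_ideal_gen: "subring_set A \<Longrightarrow> s \<in> G \<Longrightarrow> s \<in> gen_ideal A G"
  using gen_ideal_mult_gen[of 1 A s G] by (simp add: subring_setD)

lemma gen_ideal_add:
  assumes "x \<in> gen_ideal A G" "y \<in> gen_ideal A G"
  shows "x + y \<in> gen_ideal A G"
  using assms by (induction x) (auto simp: add.assoc intro: gen_ideal.step)

lemma gen_ideal_mult:
  assumes "subring_set A" "c \<in> A" "x \<in> gen_ideal A G"
  shows "c * x \<in> gen_ideal A G"
  using assms(3)
proof induction
  case (step d s x)
  then have "(c * d) * s + c * x \<in> gen_ideal A G"
    by (intro gen_ideal.step) (auto simp: subring_setD assms)
  then show ?case by (simp add: algebra_simps)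
qed (simp add: gen_ideal.zero)

lemma gen_ideal_uminus:
  "subring_set A \<Longrightarrow> x \<in> gen_ideal A G \<Longrightarrow> - x \<in> gen_ideal A G"
  using gen_ideal_mult[of A "-1" x G] by (simp add: subring_setD)

lemma gen_ideal_minus:
  "subring_set A \<Longrightarrow> x \<in> gen_ideal A G \<Longrightarrow> y \<in> gen_ideal A G \<Longrightarrow> x - y \<in> gen_ideal A G"
  using gen_ideal_add[OF _ gen_ideal_uminus, of x A G y] by simp

lemma gen_ideal_sum:
  "(\<And>i. i \<in> I \<Longrightarrow> f i \<in> gen_ideal A G) \<Longrightarrow> sum f I \<in> gen_ideal A G"
  by (induction I rule: infinite_finite_induct) (auto simp: gen_ideal.zero gen_ideal_add)

lemma gen_ideal_subset:
  assumes "0 \<in> J" "\<And>x y. x \<in> J \<Longrightarrow> y \<in> J \<Longrightarrow> x + y \<in> J"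
    and "\<And>c s. c \<in> A \<Longrightarrow> s \<in> G \<Longrightarrow> c * s \<in> J"
  shows "gen_ideal A G \<subseteq> J"
proof
  fix x assume "x \<in> gen_ideal A G"
  then show "x \<in> J" by induction (auto intro: assms)
qed

lemma gen_ideal_mono: "A \<subseteq> B \<Longrightarrow> G \<subseteq> H \<Longrightarrow> gen_ideal A G \<subseteq> gen_ideal B H"
  by (rule gen_ideal_subset) (auto intro: gen_ideal.zero gen_ideal_add gen_ideal_mult_gen)

lemma gen_ideal_hom:
  assumes "comm_ring_hom h" "x \<in> gen_ideal A G" "subring_set B"
    "\<And>c. c \<in> A \<Longrightarrow> h c \<in> B" "\<And>s. s \<in> G \<Longrightarrow> h s \<in> gen_ideal B H"
  shows "h x \<in> gen_ideal B H"
proof -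
  interpret h: comm_ring_hom h by fact
  show ?thesis using assms(2)
  proof induction
    case (step c s x)
    then show ?case
      by (auto simp: h.hom_add h.hom_mult intro: gen_ideal_add gen_ideal_mult assms)
  qed (simp add: gen_ideal.zero)
qed

lemma gen_ideal_kernel:
  assumes "comm_ring_hom h" "x \<in> gen_ideal A G" "\<And>s. s \<in> G \<Longrightarrow> h s = 0"
  shows "h x = 0"
proof -
  interpret h: comm_ring_hom h by fact
  show ?thesis using assms(2) by induction (auto simp: h.hom_add h.hom_mult assms)
qed

lemma gen_ideal_in:
  assumes "subring_set A" "G \<subseteq> A" shows "gen_ideal A G \<subseteq> A"
  using assms by (intro gen_ideal_subset) (auto simp: subring_setD)

lemma mpoly_ring_simps [simp]:
  "carrier (mpoly_ring A m) = mpolys A {1..m}"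
  "x \<otimes>\<^bsub>mpoly_ring A m\<^esub> y = x * y" "x \<oplus>\<^bsub>mpoly_ring A m\<^esub> y = x + y"
  "\<one>\<^bsub>mpoly_ring A m\<^esub> = 1" "\<zero>\<^bsub>mpoly_ring A m\<^esub> = 0"
  by (simp_all add: mpoly_ring_def mpolys_def)

lemma cring_mpoly_ring:
  assumes "subring_set A" shows "cring (mpoly_ring A m)"
proof -
  note sr = subring_setD[OF subring_set_mpolys[OF assms]]
  have inv: "\<exists>y\<in>mpolys A {1..m}. y + x = 0" if "x \<in> mpolys A {1..m}" for x
    using sr(4)[OF that] by (intro bexI[of _ "- x"]) auto
  have inv': "\<exists>y\<in>mpolys A {1..m}. x + y = 0" if "x \<in> mpolys A {1..m}" for x
    using sr(4)[OF that] by (intro bexI[of _ "- x"]) auto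
  have ab: "abelian_group (mpoly_ring A m)"
    by (rule abelian_groupI) (auto simp: sr inv inv' algebra_simps simp del: One_nat_def)
  have cm: "comm_monoid (mpoly_ring A m)"
    by (rule comm_monoidI) (auto simp: sr mult_ac)
  show ?thesis
    by (rule cringI[OF ab cm]) (simp add: ring_distribs)
qed

text \<open>The bridge from the ideals of the statement to \<open>gen_ideal\<close>: one inclusion
  by minimality of \<open>Idl\<close>, the other because an ideal is closed under combinations of
  its elements.\<close>

lemma genideal_mpoly_ring:
  assumes "subring_set A" "G \<subseteq> mpolys A {1..m}"
  shows "Idl\<^bsub>mpoly_ring A m\<^esub> G = gen_ideal (mpolys A {1..m}) G"
proof -
  let ?R = "mpoly_ring A m"
  interpret cring ?R by (rule cring_mpoly_ring[OF assms(1)])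
  note sr = subring_set_mpolys[OF assms(1), of "{1..m}"]
  have ia: "a_inv ?R x = - x" if "x \<in> mpolys A {1..m}" for x
    by (rule minus_equality) (use that subring_setD(4)[OF sr] in auto)
  have "ideal (gen_ideal (mpolys A {1..m}) G) ?R"
  proof (rule idealI)
    show "subgroup (gen_ideal (mpolys A {1..m}) G) (add_monoid ?R)"
    proof (rule group.subgroupI)
      show "group (add_monoid ?R)" by (rule add.is_group)
      show "gen_ideal (mpolys A {1..m}) G \<subseteq> carrier (add_monoid ?R)"
        using gen_ideal_in[OF sr assms(2)] by simp
      show "gen_ideal (mpolys A {1..m}) G \<noteq> {}" using gen_ideal.zero by blast
      fix a assume a: "a \<in> gen_ideal (mpolys A {1..m}) G"
      then have "a \<in> mpolys A {1..m}" using gen_ideal_in[OF sr assms(2)] by blast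
      then show "inv\<^bsub>add_monoid ?R\<^esub> a \<in> gen_ideal (mpolys A {1..m}) G"
        using ia[of a] gen_ideal_uminus[OF sr a] by (simp add: a_inv_def)
    qed (auto simp: gen_ideal_add)
  next
    fix a x assume "a \<in> gen_ideal (mpolys A {1..m}) G" "x \<in> carrier ?R"
    then show "x \<otimes>\<^bsub>?R\<^esub> a \<in> gen_ideal (mpolys A {1..m}) G"
      and "a \<otimes>\<^bsub>?R\<^esub> x \<in> gen_ideal (mpolys A {1..m}) G"
      using gen_ideal_mult[OF sr, of x a G] by (simp_all add: mult.commute)
  qed (rule ring_axioms)
  moreover have "G \<subseteq> gen_ideal (mpolys A {1..m}) G" using gen_ideal_gen[OF sr] by blast
  ultimately have 1: "Idl\<^bsub>?R\<^esub> G \<subseteq> gen_ideal (mpolys A {1..m}) G"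
    by (rule genideal_minimal)
  have G: "G \<subseteq> carrier ?R" using assms by simp
  interpret I: ideal "Idl\<^bsub>?R\<^esub> G" ?R by (rule genideal_ideal[OF G])
  have "gen_ideal (mpolys A {1..m}) G \<subseteq> Idl\<^bsub>?R\<^esub> G"
  proof (rule gen_ideal_subset)
    show "0 \<in> Idl\<^bsub>?R\<^esub> G" using additive_subgroup.zero_closed[OF I.additive_subgroup_axioms] by simp
    show "x + y \<in> Idl\<^bsub>?R\<^esub> G" if "x \<in> Idl\<^bsub>?R\<^esub> G" "y \<in> Idl\<^bsub>?R\<^esub> G" for x y
      using additive_subgroup.a_closed[OF I.additive_subgroup_axioms that] by simp
    show "c * s \<in> Idl\<^bsub>?R\<^esub> G" if "c \<in> mpolys A {1..m}" "s \<in> G" for c s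
      using I.I_l_closed[of s c] genideal_self[OF G] that by auto
  qed
  with 1 show ?thesis by blast
qed

section \<open>Linear forms\<close>

definition linear_forms :: "nat set \<Rightarrow> 'k::field mpoly set" where
  "linear_forms V = {p. \<exists>c. p = (\<Sum>j\<in>V. mconst (c j) * mvar j)}"

lemma linear_forms_scaled_diff:
  assumes "p \<in> linear_forms V" "q \<in> linear_forms V"
  shows "p - mconst b * q \<in> linear_forms V"
proof -
  obtain c d where p: "p = (\<Sum>j\<in>V. mconst (c j) * mvar j)" and q: "q = (\<Sum>j\<in>V. mconst (d j) * mvar j)"
    using assms by (auto simp: linear_forms_def)
  have "p - mconst b * q = (\<Sum>j\<in>V. mconst (c j - b * d j) * mvar j)"
    by (simp add: p q mconst.hom_minus mconst.hom_mult sum_distrib_left sum_subtractf algebra_simps)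
  then show ?thesis by (auto simp: linear_forms_def)
qed

lemma linear_forms_in_mpolys: "p \<in> linear_forms V \<Longrightarrow> p \<in> mpolys UNIV V"
  by (auto simp: linear_forms_def intro!: mpolys_sum mpolys_mult mconst_in_mpolys mvar_in_mpolys)

text \<open>Eliminating one variable along \<open>l\<close> restricts polynomials to the hyperplane \<open>l = 0\<close>.\<close>

lemma restriction_to_hyperplane:
  fixes l :: "'k::field mpoly"
  assumes V: "finite V" and l: "l \<in> linear_forms V" "l \<noteq> 0"
  obtains \<sigma> where "comm_ring_hom \<sigma>" "\<And>c. \<sigma> (mconst c) = mconst c" "\<sigma> l = 0"
    "\<And>p. p \<in> mpolys UNIV V \<Longrightarrow> \<sigma> p \<in> mpolys UNIV V"
    "\<And>p. p \<in> mpolys UNIV V \<Longrightarrow> \<exists>q\<in>mpolys UNIV V. p - \<sigma> p = l * q"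
    "\<And>p. p \<in> linear_forms V \<Longrightarrow> \<exists>b. p - \<sigma> p = mconst b * l"
proof -
  obtain c where c: "l = (\<Sum>j\<in>V. mconst (c j) * mvar j)"
    using l by (auto simp: linear_forms_def)
  obtain v where v: "v \<in> V" "c v \<noteq> 0"
  proof -
    have "\<exists>v\<in>V. c v \<noteq> 0"
    proof (rule ccontr)
      assume "\<not> ?thesis"
      then have "l = 0" unfolding c by (intro sum.neutral) auto
      then show False using l by simp
    qed
    then show ?thesis using that by blast
  qed
  \<comment> \<open>A variable \<open>x\<^sub>v\<close> occurring in \<open>l\<close> is replaced by
    \<open>x\<^sub>v - l / c\<^sub>v\<close>, the form without \<open>x\<^sub>v\<close> that agrees
    with \<open>x\<^sub>v\<close> modulo \<open>l\<close>.\<close>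
  define \<sigma> where "\<sigma> = mpoly_eval mconst (\<lambda>i. if i = v then mvar v - mconst (1 / c v) * l else mvar i :: 'k mpoly)"
  have hom: "comm_ring_hom \<sigma>" unfolding \<sigma>_def by (rule mconst.mpoly_eval_hom)
  interpret \<sigma>: comm_ring_hom \<sigma> by (rule hom)
  have const: "\<sigma> (mconst c) = mconst c" for c by (simp add: \<sigma>_def)
  have var: "\<sigma> (mvar i) = (if i = v then mvar v - mconst (1 / c v) * l else mvar i)" for i
    by (simp add: \<sigma>_def)
  have lin: "p - \<sigma> p = mconst (d v / c v) * l" if "p = (\<Sum>j\<in>V. mconst (d j) * mvar j)" for p d
  proof -
    have "p - \<sigma> p = (\<Sum>j\<in>V. mconst (d j) * (mvar j - \<sigma> (mvar j)))"
      by (simp add: that \<sigma>.hom_sum \<sigma>.hom_mult const right_diff_distrib sum_subtractf)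
    also have "\<dots> = (\<Sum>j\<in>V. if j = v then mconst (d v) * (mconst (1 / c v) * l) else 0)"
      by (rule sum.cong) (auto simp: var)
    also have "\<dots> = mconst (d v) * (mconst (1 / c v) * l)"
      using V v(1) by simp
    also have "\<dots> = mconst (d v / c v) * l"
      by (simp add: mconst.hom_mult[symmetric] mult.assoc[symmetric])
    finally show ?thesis .
  qed
  have lV: "l \<in> mpolys UNIV V" by (rule linear_forms_in_mpolys[OF l(1)])
  note sr = subring_setD[OF subring_set_mpolys[OF subring_set_UNIV]]
  have \<sigma>V: "\<sigma> p \<in> mpolys UNIV V" if "p \<in> mpolys UNIV V" for p
    unfolding \<sigma>_def
    by (rule mpoly_eval_in[OF subring_set_mpolys[OF subring_set_UNIV] that])
       (auto simp: mconst_in_mpolys mvar_in_mpolys intro!: sr lV)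
  show ?thesis
  proof (rule that[OF hom const])
    show "\<sigma> l = 0" using lin[OF c] v by simp
    show "\<exists>b. p - \<sigma> p = mconst b * l" if "p \<in> linear_forms V" for p
      using that lin by (auto simp: linear_forms_def)
    show "\<exists>q\<in>mpolys UNIV V. p - \<sigma> p = l * q" if "p \<in> mpolys UNIV V" for p
    proof (rule hom_diff_multiple[OF subring_set_UNIV hom \<sigma>V _ _ that])
      show "\<exists>q\<in>mpolys UNIV V. mconst c - \<sigma> (mconst c) = l * q" for c
        by (rule bexI[of _ 0]) (simp_all add: const sr)
      show "\<exists>q\<in>mpolys UNIV V. mvar i - \<sigma> (mvar i) = l * q" for i
        by (rule bexI[of _ "if i = v then mconst (1 / c v) else 0"])
           (auto simp: var mult.commute sr mconst_in_mpolys)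
    qed
  qed (rule \<sigma>V)
qed

section \<open>The relations of the Rees algebra\<close>

text \<open>Substituting \<open>F\<^sub>i = W / T\<^sub>i\<close> into a dependency
  \<open>\<Sum> a\<^sub>i F\<^sub>i = 0\<close> gives
  \<open>\<Sum> a\<^sub>i / T\<^sub>i = 0\<close>; this polynomial results from clearing the
  denominators \<open>T\<^sub>j\<close>, \<open>j \<in> C\<close>.\<close>

definition circuit_rel :: "(nat \<Rightarrow> 'a::comm_ring_1) \<Rightarrow> nat set \<Rightarrow> 'a mpoly" where
  "circuit_rel a C = (\<Sum>i\<in>C. mconst (a i) * (\<Prod>j\<in>C - {i}. mvar j))"

text \<open>
  The variable with index 0 is a name for the common value of all \<open>f\<^sub>i T\<^sub>i\<close>. It is sent to
  \<open>f\<^sub>1 \<cdots> f\<^sub>t \<tau>\<close>, and \<open>T\<^sub>i\<close> to \<open>f\<^sub>1 \<cdots> f\<^sub>t \<tau> / f\<^sub>i\<close>.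
\<close>

definition ext_rees_map :: "(nat \<Rightarrow> 'k::field mpoly) \<Rightarrow> nat \<Rightarrow> 'k mpoly mpoly \<Rightarrow> 'k mpoly poly" where
  "ext_rees_map f t = mpoly_eval (\<lambda>a. [:a:]) (\<lambda>i. Polynomial.monom (\<Prod>j\<in>{1..t} - {i}. f j) 1)"

text \<open>Every dependency with support exactly \<open>C\<close> contributes, minimal or not:
  lifting from the hyperplane adds an index to the support without control over minimality. The
  reduction to minimal dependencies is left to \<open>circuit_rel_in_h_ideal\<close>.\<close>

definition ext_rels :: "(nat \<Rightarrow> 'k::field mpoly) \<Rightarrow> nat \<Rightarrow> 'k mpoly mpoly set" where
  "ext_rels f t = {mconst (f i) * mvar i - mvar 0 | i. i \<in> {1..t}} \<union>
    {circuit_rel (\<lambda>i. mconst (a i)) C | a C. C \<subseteq> {1..t} \<and> (\<forall>i\<in>C. a i \<noteq> 0) \<and>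
      (\<Sum>i\<in>C. mconst (a i) * f i) = 0}"

lemma circuit_rel_in_mpolys:
  "subring_set A \<Longrightarrow> (\<And>i. i \<in> C \<Longrightarrow> a i \<in> A) \<Longrightarrow> C \<subseteq> V \<Longrightarrow> circuit_rel a C \<in> mpolys A V"
  unfolding circuit_rel_def
  by (intro mpolys_sum mpolys_mult mconst_in_mpolys subring_set_prod subring_set_mpolys mvar_in_mpolys) auto

lemma circuit_rel_insert:
  assumes "finite C" "k \<notin> C"
  shows "circuit_rel a (insert k C) = mvar k * circuit_rel a C + mconst (a k) * (\<Prod>j\<in>C. mvar j)"
proof -
  have "(\<Prod>j\<in>insert k C - {i}. mvar j) = mvar k * (\<Prod>j\<in>C - {i}. mvar j :: 'a mpoly)" if "i \<in> C" for i
  proof -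
    have "insert k C - {i} = insert k (C - {i})" using that assms by auto
    then show ?thesis using assms by simp
  qed
  moreover have "insert k C - {k} = C" using assms by auto
  ultimately show ?thesis using assms
    unfolding circuit_rel_def by (simp add: sum_distrib_left mult_ac)
qed

lemma circuit_rel_cong: "(\<And>i. i \<in> C \<Longrightarrow> a i = b i) \<Longrightarrow> circuit_rel a C = circuit_rel b C"
  unfolding circuit_rel_def by (rule sum.cong) auto

text \<open>Multiplied by all \<open>w\<^sub>j\<close>, \<open>j \<in> C\<close>, each term becomes \<open>a\<^sub>i w\<^sub>i W\<close> to the power \<open>|C| - 1\<close>.\<close>

lemma hom_circuit_rel_eq_0:
  fixes h :: "'a::comm_ring_1 mpoly \<Rightarrow> 'b::idom"
  assumes h: "comm_ring_hom h" and C: "finite C"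
    and W: "\<And>j. j \<in> C \<Longrightarrow> w j * h (mvar j) = W" "\<And>j. j \<in> C \<Longrightarrow> w j \<noteq> 0"
    and dep: "(\<Sum>i\<in>C. h (mconst (a i)) * w i) = 0"
  shows "h (circuit_rel a C) = 0"
proof -
  interpret h: comm_ring_hom h by fact
  have "(\<Prod>j\<in>C. w j) * h (circuit_rel a C) =
      (\<Sum>i\<in>C. h (mconst (a i)) * w i * ((\<Prod>j\<in>C - {i}. w j) * (\<Prod>j\<in>C - {i}. h (mvar j))))"
    unfolding circuit_rel_def h.hom_sum h.hom_mult h.hom_prod sum_distrib_left
    by (rule sum.cong) (simp_all add: prod.remove[OF C, where g = w] mult_ac)
  also have "\<dots> = (\<Sum>i\<in>C. h (mconst (a i)) * w i * W ^ (card C - 1))"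
  proof (intro sum.cong refl arg_cong[where f = "(*) _"])
    fix i assume i: "i \<in> C"
    have "(\<Prod>j\<in>C - {i}. w j) * (\<Prod>j\<in>C - {i}. h (mvar j)) = (\<Prod>j\<in>C - {i}. W)"
      unfolding prod.distrib[symmetric] by (rule prod.cong) (auto simp: W)
    then show "(\<Prod>j\<in>C - {i}. w j) * (\<Prod>j\<in>C - {i}. h (mvar j)) = W ^ (card C - 1)"
      using i C by simp
  qed
  also have "\<dots> = 0" by (simp add: sum_distrib_right[symmetric] dep)
  finally show ?thesis using W(2) C by simp
qed

lemma ext_rees_map_hom: "comm_ring_hom (ext_rees_map f t)"
  unfolding ext_rees_map_def by (rule comm_ring_hom.mpoly_eval_hom[OF comm_ring_hom_pCons])

lemma ext_rees_map_mconst [simp]: "ext_rees_map f t (mconst c) = [:c:]"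
  unfolding ext_rees_map_def by (rule comm_ring_hom.mpoly_eval_mconst[OF comm_ring_hom_pCons])

lemma ext_rees_map_mvar [simp]:
  "ext_rees_map f t (mvar i) = Polynomial.monom (\<Prod>j\<in>{1..t} - {i}. f j) 1"
  unfolding ext_rees_map_def by (rule comm_ring_hom.mpoly_eval_mvar[OF comm_ring_hom_pCons])

lemma form_times_ext_rees_map_mvar:
  assumes "i \<in> {1..t}"
  shows "[:f i:] * ext_rees_map f t (mvar i) = Polynomial.monom (\<Prod>j\<in>{1..t}. f j) 1"
  using prod.remove[OF _ assms, of f] by (simp add: smult_monom)

lemma ext_rels_kernel:
  assumes "x \<in> gen_ideal A (ext_rels f t)" "\<And>i. i \<in> {1..t} \<Longrightarrow> f i \<noteq> 0"
  shows "ext_rees_map f t x = 0"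
proof (rule gen_ideal_kernel[OF ext_rees_map_hom assms(1)])
  interpret h: comm_ring_hom "ext_rees_map f t" by (rule ext_rees_map_hom)
  fix s assume "s \<in> ext_rels f t"
  then consider i where "i \<in> {1..t}" "s = mconst (f i) * mvar i - mvar 0"
    | a C where "C \<subseteq> {1..t}" "(\<Sum>i\<in>C. mconst (a i) * f i) = 0" "s = circuit_rel (\<lambda>i. mconst (a i)) C"
    unfolding ext_rels_def by blast
  then show "ext_rees_map f t s = 0"
  proof cases
    case 1
    then show ?thesis
      using form_times_ext_rees_map_mvar[of i t f]
      by (simp add: h.hom_minus h.hom_mult del: One_nat_def)
  next
    case 2
    interpret c: comm_ring_hom "\<lambda>a::'a mpoly. [:a:]" by (rule comm_ring_hom_pCons)
    have "(\<Sum>i\<in>C. ext_rees_map f t (mconst (mconst (a i))) * [:f i:]) = [:\<Sum>i\<in>C. mconst (a i) * f i:]"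
      unfolding c.hom_sum by (rule sum.cong) (simp_all add: mult.commute)
    then have dep: "(\<Sum>i\<in>C. ext_rees_map f t (mconst (mconst (a i))) * [:f i:]) = 0"
      by (simp only: 2(2) pCons_0_0)
    show ?thesis
      unfolding 2(3)
    proof (rule hom_circuit_rel_eq_0[OF ext_rees_map_hom finite_subset[OF 2(1)] _ _ dep])
      fix j assume "j \<in> C"
      then have j: "j \<in> {1..t}" using 2(1) by blast
      show "[:f j:] * ext_rees_map f t (mvar j) = Polynomial.monom (\<Prod>j\<in>{1..t}. f j) 1"
        and "[:f j:] \<noteq> 0"
        using form_times_ext_rees_map_mvar[OF j] assms(2)[OF j] by simp_all
    qed simp
  qed
qed

lemma mpolys_Suc_expand:
  assumes "subring_set A" "p \<in> mpolys A {0..Suc t}"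
  obtains M c where "\<And>m. c m \<in> mpolys A {0..t}" "p = (\<Sum>m\<le>M::nat. c m * mvar (Suc t) ^ m)"
proof -
  let ?k = "\<lambda>e. lookup e (Suc t)"
  define q where "q e = mconst (lookup p e) * (\<Prod>i\<in>keys e - {Suc t}. mvar i ^ lookup e i)" for e
  define c where "c m = (\<Sum>e\<in>{e\<in>keys p. ?k e = m}. q e)" for m
  \<comment> \<open>The inserted 0 keeps the maximum defined for \<open>p = 0\<close>, where there
    are no exponents.\<close>
  define M where "M = Max (insert 0 (?k ` keys p))"
  have "Poly_Mapping.single e (lookup p e) = q e * mvar (Suc t) ^ ?k e" for e
  proof (cases "Suc t \<in> keys e")
    case True
    then show ?thesis
      by (simp add: single_eq_mconst_mon_eval mon_eval_def q_def
          prod.remove[OF finite_keys True] mult_ac)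
  next
    case False
    then show ?thesis
      by (simp add: single_eq_mconst_mon_eval mon_eval_def q_def in_keys_iff)
  qed
  then have "p = (\<Sum>e\<in>keys p. q e * mvar (Suc t) ^ ?k e)"
    using single_eq_sum_keys[of p] by simp
  also have "\<dots> = (\<Sum>m\<le>M. \<Sum>e\<in>{e\<in>keys p. ?k e = m}. q e * mvar (Suc t) ^ ?k e)"
    by (rule sum.group[symmetric]) (auto simp: M_def)
  also have "\<dots> = (\<Sum>m\<le>M. c m * mvar (Suc t) ^ m)"
    by (simp add: c_def sum_distrib_right)
  finally have "p = (\<Sum>m\<le>M. c m * mvar (Suc t) ^ m)" .
  moreover have "c m \<in> mpolys A {0..t}" for m
    unfolding c_def q_def
  proof (intro mpolys_sum mpolys_mult mconst_in_mpolys subring_set_prod subring_set_power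
      subring_set_mpolys mvar_in_mpolys assms(1))
    fix e i assume "e \<in> {e \<in> keys p. ?k e = m}" "i \<in> keys e - {Suc t}"
    then show "i \<in> {0..t}" using assms(2) by (fastforce simp: mpolys_def)
  qed (use assms(2) in \<open>auto simp: mpolys_def\<close>)
  ultimately show ?thesis using that by blast
qed

lemma comm_ring_hom_map_poly:
  assumes "comm_ring_hom h" shows "comm_ring_hom (map_poly h)"
proof -
  interpret h: comm_ring_hom h by fact
  show ?thesis
    by unfold_locales
       (auto intro!: poly_eqI simp: coeff_map_poly h.hom_add coeff_mult h.hom_sum h.hom_mult)
qed

lemma comm_ring_hom_pcompose: "comm_ring_hom (\<lambda>p. pcompose p (q :: 'a::comm_ring_1 poly))"
  by unfold_locales (simp_all add: pcompose_add pcompose_mult pcompose_1)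

text \<open>One more form multiplies the image of each old variable, including \<open>W\<close>, by
  that form. These images have degree one in \<tau>, so the effect is the substitution of
  \<open>f\<^sub>t\<^sub>+\<^sub>1 \<tau>\<close> for \<tau>.\<close>

lemma ext_rees_map_Suc:
  assumes "p \<in> mpolys UNIV {0..t}"
  shows "ext_rees_map f (Suc t) p = pcompose (ext_rees_map f t p) [:0, f (Suc t):]"
proof (rule mpoly_hom_eqI[OF ext_rees_map_hom comm_ring_hom_comp[OF comm_ring_hom_pcompose ext_rees_map_hom]
      subring_set_UNIV assms])
  fix i assume i: "i \<in> {0..t}"
  then have "{1..Suc t} - {i} = insert (Suc t) ({1..t} - {i})" by auto
  then show "ext_rees_map f (Suc t) (mvar i) = pcompose (ext_rees_map f t (mvar i)) [:0, f (Suc t):]"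
    by (simp add: monom_altdef pcompose_smult pcompose_pCons mult.commute del: One_nat_def)
qed simp

lemma gen_ideal_power_diff:
  assumes "subring_set A" "x \<in> A" "y \<in> A" "x - y \<in> gen_ideal A G"
  shows "x ^ m - y ^ m \<in> gen_ideal A G"
proof (induction m)
  case (Suc m)
  have "x * (x ^ m - y ^ m) + y ^ m * (x - y) \<in> gen_ideal A G"
    using assms Suc by (intro gen_ideal_add gen_ideal_mult subring_set_power)
  then show ?case by (simp add: algebra_simps)
qed (simp add: gen_ideal.zero)

lemma ext_rels_mono: "ext_rels f t \<subseteq> ext_rels f (Suc t)"
  unfolding ext_rels_def by fastforce

lemma circuit_rel_hom:
  assumes "comm_ring_hom h" "\<And>i. i \<in> C \<Longrightarrow> h (mvar i) = mvar i"
    "\<And>i. i \<in> C \<Longrightarrow> h (mconst (a i)) = mconst (b i)"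
  shows "h (circuit_rel a C) = circuit_rel b C"
proof -
  interpret h: comm_ring_hom h by fact
  show ?thesis unfolding circuit_rel_def h.hom_sum h.hom_mult h.hom_prod
    using assms by (intro sum.cong arg_cong2[where f = "(*)"] prod.cong) auto
qed

text \<open>Let \<open>f'\<close> and \<open>T'\<close> have index \<open>t + 1\<close>, and
  \<open>f\<^sub>i = \<sigma>(f\<^sub>i) + b\<^sub>i f'\<close>. Since
  \<open>f\<^sub>i T\<^sub>i\<close> and \<open>f' T'\<close> both reduce to \<open>W\<close>, the
  product \<open>(\<sigma>(f\<^sub>i) T\<^sub>i - W) T'\<close> reduces to
  \<open>- b\<^sub>i T\<^sub>i W\<close>. A dependency of the restricted forms on \<open>C\<close>
  becomes one of the original forms after adding a multiple of \<open>f'\<close>, and the relation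
  of the latter is \<open>s T'\<close> plus a scalar times the product of the
  \<open>T\<^sub>j\<close>, \<open>j \<in> C\<close>. In both cases the remainder is free of
  \<open>T'\<close>.\<close>

lemma lift_ext_rel:
  fixes f :: "nat \<Rightarrow> 'k::field mpoly"
  assumes A: "subring_set A" "range mconst \<subseteq> A" "\<And>i. f i \<in> A"
    and \<sigma>: "\<And>i. i \<in> {1..t} \<Longrightarrow> \<exists>b. f i - \<sigma> (f i) = mconst b * f (Suc t)"
    and s: "s \<in> ext_rels (\<lambda>i. \<sigma> (f i)) t"
  shows "\<exists>q\<in>mpolys A {0..t}. s * mvar (Suc t) - q \<in> gen_ideal (mpolys A {0..Suc t}) (ext_rels f (Suc t))"
proof -
  let ?T = "mvar (Suc t) :: 'k mpoly mpoly"
  let ?N = "gen_ideal (mpolys A {0..Suc t}) (ext_rels f (Suc t))"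
  note sr = subring_setD[OF subring_set_mpolys[OF A(1)]]
  note S = subring_set_mpolys[OF A(1)]
  have kA: "mconst b \<in> A" for b using A(2) by auto
  note mem = sr mconst_in_mpolys[OF A(1)] mvar_in_mpolys[OF A(1)] kA
  obtain b where b: "f i - \<sigma> (f i) = mconst (b i) * f (Suc t)" if "i \<in> {1..t}" for i
    using \<sigma> by metis
  have T: "mconst (f (Suc t)) * ?T - mvar 0 \<in> ?N"
    by (rule gen_ideal_gen[OF S]) (auto simp: ext_rels_def)
  consider i where "i \<in> {1..t}" "s = mconst (\<sigma> (f i)) * mvar i - mvar 0"
    | a C where "C \<subseteq> {1..t}" "\<forall>i\<in>C. a i \<noteq> 0" "(\<Sum>i\<in>C. mconst (a i) * \<sigma> (f i)) = 0"
      "s = circuit_rel (\<lambda>i. mconst (a i)) C"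
    using s unfolding ext_rels_def by blast
  then show ?thesis
  proof cases
    case 1
    let ?b = "mconst (mconst (b i)) :: 'k mpoly mpoly"
    have fi: "mconst (\<sigma> (f i)) = mconst (f i) - ?b * mconst (f (Suc t))"
      using b[OF 1(1)] by (metis diff_diff_eq2 diff_add_cancel add_diff_cancel_left' mconst.hom_minus mconst.hom_mult)
    have g: "mconst (f i) * mvar i - mvar 0 \<in> ?N"
      using 1 by (intro gen_ideal_gen[OF S]) (auto simp: ext_rels_def)
    have eq: "s * ?T - (- (?b * mvar i * mvar 0)) =
      ?T * (mconst (f i) * mvar i - mvar 0) - (?b * mvar i) * (mconst (f (Suc t)) * ?T - mvar 0)"
      unfolding 1(2) fi by (simp add: algebra_simps)
    have "s * ?T - (- (?b * mvar i * mvar 0)) \<in> ?N"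
      unfolding eq using 1(1)
      by (intro gen_ideal_minus[OF S] gen_ideal_mult[OF S] g T mem) auto
    moreover have "- (?b * mvar i * mvar 0) \<in> mpolys A {0..t}"
      using 1(1) by (intro mem) auto
    ultimately show ?thesis by blast
  next
    case 2
    have finC: "finite C" using 2(1) finite_subset by blast
    \<comment> \<open>The coefficient of \<open>f\<^sub>t\<^sub>+\<^sub>1\<close> that completes the
      restricted dependency to one of the original forms. If it is 0, \<open>s\<close> itself is
      already a generator for the original forms.\<close>
    define c where "c = - (\<Sum>i\<in>C. a i * b i)"
    have "(\<Sum>i\<in>C. mconst (a i) * f i) - (\<Sum>i\<in>C. mconst (a i) * \<sigma> (f i)) =
        (\<Sum>i\<in>C. mconst (a i) * (mconst (b i) * f (Suc t)))"
      unfolding sum_subtractf[symmetric] right_diff_distrib[symmetric]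
      using b 2(1) by (intro sum.cong) auto
    also have "\<dots> = - mconst c * f (Suc t)"
      by (simp add: c_def mconst.hom_uminus mconst.hom_sum mconst.hom_mult sum_distrib_right mult.assoc)
    finally have dep: "(\<Sum>i\<in>C. mconst (a i) * f i) + mconst c * f (Suc t) = 0"
      using 2(3) by (simp add: algebra_simps)
    show ?thesis
    proof (cases "c = 0")
      case True
      then have "s \<in> ?N"
        using 2 dep by (intro gen_ideal_gen[OF S]) (fastforce simp: ext_rels_def)
      then have "s * ?T - 0 \<in> ?N"
        using gen_ideal_mult[OF S, of ?T _ s] by (simp add: mem mult.commute)
      then show ?thesis using mem by blast
    next
      case False
      define a' where "a' = a(Suc t := c)"
      have nin: "Suc t \<notin> C" using 2(1) by auto
      have "(\<Sum>i\<in>C. mconst (a' i) * f i) = (\<Sum>i\<in>C. mconst (a i) * f i)"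
        using nin by (intro sum.cong) (auto simp: a'_def)
      then have dep': "(\<Sum>i\<in>insert (Suc t) C. mconst (a' i) * f i) = 0"
        using dep nin finC by (simp add: a'_def add.commute)
      have "circuit_rel (\<lambda>i. mconst (a' i)) (insert (Suc t) C) \<in> ext_rels f (Suc t)"
        using 2(1,2) False nin dep' unfolding ext_rels_def
        by (intro UnI2 CollectI exI[of _ a'] exI[of _ "insert (Suc t) C"]) (auto simp: a'_def)
      moreover have "circuit_rel (\<lambda>i. mconst (a' i)) (insert (Suc t) C) =
          s * ?T - (- (mconst (mconst c) * (\<Prod>j\<in>C. mvar j)))"
      proof -
        have "circuit_rel (\<lambda>i. mconst (a' i)) C = circuit_rel (\<lambda>i. mconst (a i)) C"
          by (rule circuit_rel_cong) (use nin in \<open>auto simp: a'_def\<close>)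
        then show ?thesis
          by (simp add: circuit_rel_insert[OF finC nin] 2(4) mult.commute) (simp add: a'_def)
      qed
      ultimately have "s * ?T - (- (mconst (mconst c) * (\<Prod>j\<in>C. mvar j))) \<in> ?N"
        using gen_ideal_gen[OF S] by metis
      moreover have "- (mconst (mconst c) * (\<Prod>j\<in>C. mvar j)) \<in> mpolys A {0..t}"
        using 2(1) by (intro mem subring_set_prod[OF S]) auto
      ultimately show ?thesis by blast
    qed
  qed
qed

lemma lift_ext_ideal:
  fixes f :: "nat \<Rightarrow> 'k::field mpoly"
  assumes A: "subring_set A" "range mconst \<subseteq> A" "\<And>i. f i \<in> A"
    and \<sigma>: "\<And>i. i \<in> {1..t} \<Longrightarrow> \<exists>b. f i - \<sigma> (f i) = mconst b * f (Suc t)"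
    and x: "x \<in> gen_ideal (mpolys A {0..t}) (ext_rels (\<lambda>i. \<sigma> (f i)) t)"
  shows "\<exists>q\<in>mpolys A {0..t}. x * mvar (Suc t) - q \<in> gen_ideal (mpolys A {0..Suc t}) (ext_rels f (Suc t))"
proof -
  let ?N = "gen_ideal (mpolys A {0..Suc t}) (ext_rels f (Suc t))"
  note sr = subring_setD[OF subring_set_mpolys[OF A(1)]]
  note S = subring_set_mpolys[OF A(1)]
  show ?thesis using x
  proof induction
    case zero
    show ?case by (rule bexI[of _ 0]) (simp_all add: gen_ideal.zero sr)
  next
    case (step c s x)
    obtain q where q: "q \<in> mpolys A {0..t}" "s * mvar (Suc t) - q \<in> ?N"
      using lift_ext_rel[OF A \<sigma> step.hyps(2)] by blast
    obtain q' where q': "q' \<in> mpolys A {0..t}" "x * mvar (Suc t) - q' \<in> ?N"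
      using step.IH by blast
    have c: "c \<in> mpolys A {0..Suc t}"
      using step.hyps(1) mpolys_mono[of A A "{0..t}" "{0..Suc t}"] by auto
    have "c * (s * mvar (Suc t) - q) + (x * mvar (Suc t) - q') \<in> ?N"
      by (intro gen_ideal_add gen_ideal_mult[OF S] c q q')
    also have "c * (s * mvar (Suc t) - q) + (x * mvar (Suc t) - q') =
        (c * s + x) * mvar (Suc t) - (c * q + q')"
      by (simp add: algebra_simps)
    finally show ?case
      by (rule bexI) (intro sr step.hyps(1) q(1) q'(1))
  qed
qed

text \<open>Let \<open>f'\<close> have index \<open>t + 1\<close>, let
  \<open>g = f\<^sub>1 \<cdots> f\<^sub>t \<tau>\<close>, the image of the last variable, and let
  \<psi> substitute \<open>f' \<tau>\<close> for \<tau>. As \<open>\<psi>(g) = f' g\<close>,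
  multiplication by the \<open>M\<close>-th power of \<open>f'\<close> turns the vanishing sum into
  \<psi> of a sum whose \<open>m\<close>-th term carries the power \<open>M - m\<close> of
  \<open>f'\<close>. Now \<psi> is injective, and applying \<sigma> to the coefficients kills
  \<open>f'\<close>, so the term with \<open>m = M\<close> alone survives; the powers of
  \<open>\<sigma>(g) \<noteq> 0\<close> cancel.\<close>

lemma ext_rees_map_leading:
  fixes f :: "nat \<Rightarrow> 'k::field mpoly"
  assumes \<sigma>: "comm_ring_hom \<sigma>" "\<And>c. \<sigma> (mconst c) = mconst c" "\<sigma> (f (Suc t)) = 0"
      "\<And>i. i \<in> {1..t} \<Longrightarrow> \<sigma> (f i) \<noteq> 0"
    and f: "f (Suc t) \<noteq> 0"
    and c: "\<And>m. c m \<in> mpolys UNIV {0..t}"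
    and 0: "ext_rees_map f (Suc t) (\<Sum>m\<le>M. c m * mvar (Suc t) ^ m) = 0"
  shows "ext_rees_map (\<lambda>i. \<sigma> (f i)) t (mpoly_eval (\<lambda>a. mconst (\<sigma> a)) mvar (c M)) = 0"
proof -
  interpret \<sigma>: comm_ring_hom \<sigma> by fact
  interpret e: comm_ring_hom "ext_rees_map f (Suc t)" by (rule ext_rees_map_hom)
  interpret ms: comm_ring_hom "map_poly \<sigma>" by (rule comm_ring_hom_map_poly[OF \<sigma>(1)])
  let ?f = "f (Suc t)"
  let ?\<psi> = "\<lambda>p. pcompose p [:0, ?f:]"
  interpret \<psi>: comm_ring_hom ?\<psi> by (rule comm_ring_hom_pcompose)
  let ?g = "Polynomial.monom (\<Prod>j\<in>{1..t}. f j) 1"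
  let ?e = "ext_rees_map f t"
  have \<psi>g: "?\<psi> ?g = [:?f:] * ?g"
    by (simp add: monom_altdef pcompose_smult pcompose_pCons mult.commute)
  have g': "ext_rees_map f (Suc t) (mvar (Suc t)) = ?g"
  proof -
    have "{1..Suc t} - {Suc t} = {1..t}" by auto
    then show ?thesis by (simp del: One_nat_def)
  qed
  have "0 = [:?f:] ^ M * ext_rees_map f (Suc t) (\<Sum>m\<le>M. c m * mvar (Suc t) ^ m)"
    by (simp add: 0)
  also have "\<dots> = (\<Sum>m\<le>M. [:?f:] ^ M * (?\<psi> (?e (c m)) * ?g ^ m))"
    unfolding e.hom_sum e.hom_mult e.hom_power g' ext_rees_map_Suc[OF c] sum_distrib_left ..
  also have "\<dots> = (\<Sum>m\<le>M. ?\<psi> ([:?f:] ^ (M - m) * ?g ^ m * ?e (c m)))"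
  proof (rule sum.cong)
    fix m assume "m \<in> {..M}"
    then have "[:?f:] ^ M = [:?f:] ^ (M - m) * [:?f:] ^ m"
      by (simp add: power_add[symmetric])
    then show "[:?f:] ^ M * (?\<psi> (?e (c m)) * ?g ^ m) = ?\<psi> ([:?f:] ^ (M - m) * ?g ^ m * ?e (c m))"
      unfolding \<psi>.hom_mult \<psi>.hom_power \<psi>g by (simp only: pcompose_const power_mult_distrib mult_ac)
  qed simp
  also have "\<dots> = ?\<psi> (\<Sum>m\<le>M. [:?f:] ^ (M - m) * ?g ^ m * ?e (c m))"
    by (simp only: \<psi>.hom_sum)
  finally have "(\<Sum>m\<le>M. [:?f:] ^ (M - m) * ?g ^ m * ?e (c m)) = 0"
    using pcompose_eq_0[of _ "[:0, ?f:]"] f by simp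
  then have "0 = map_poly \<sigma> (\<Sum>m\<le>M. [:?f:] ^ (M - m) * ?g ^ m * ?e (c m))"
    by simp
  also have "\<dots> = (\<Sum>m\<le>M. map_poly \<sigma> [:?f:] ^ (M - m) * map_poly \<sigma> ?g ^ m * map_poly \<sigma> (?e (c m)))"
    by (simp only: ms.hom_sum ms.hom_mult ms.hom_power)
  also have "map_poly \<sigma> [:?f:] = 0"
    by (simp add: \<sigma>(3) map_poly_pCons)
  also have "(\<Sum>m\<le>M. 0 ^ (M - m) * map_poly \<sigma> ?g ^ m * map_poly \<sigma> (?e (c m))) =
      (\<Sum>m\<le>M. if m = M then map_poly \<sigma> ?g ^ M * map_poly \<sigma> (?e (c M)) else 0)"
    by (rule sum.cong) (auto simp: power_0_left)
  also have "\<dots> = map_poly \<sigma> ?g ^ M * map_poly \<sigma> (?e (c M))" by simp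
  finally have "map_poly \<sigma> ?g ^ M * map_poly \<sigma> (?e (c M)) = 0" by simp
  moreover have "map_poly \<sigma> ?g \<noteq> 0"
    using \<sigma>(4) by (simp add: map_poly_monom \<sigma>.hom_prod)
  ultimately have "map_poly \<sigma> (?e (c M)) = 0" by simp
  moreover have "map_poly \<sigma> (?e (c M)) =
      ext_rees_map (\<lambda>i. \<sigma> (f i)) t (mpoly_eval (\<lambda>a. mconst (\<sigma> a)) mvar (c M))"
  proof -
    interpret m\<sigma>: comm_ring_hom "\<lambda>a. mconst (\<sigma> a)"
      by (rule comm_ring_hom_comp[OF comm_ring_hom_mconst \<sigma>(1)])
    show ?thesis
      by (rule mpoly_hom_eqI[OF comm_ring_hom_comp[OF ms.comm_ring_hom_axioms ext_rees_map_hom]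
            comm_ring_hom_comp[OF ext_rees_map_hom m\<sigma>.mpoly_eval_hom] subring_set_UNIV c])
         (simp_all add: map_poly_pCons map_poly_monom \<sigma>.hom_prod)
  qed
  ultimately show ?thesis by simp
qed

text \<open>Without forms the map sends \<open>W\<close> to \<tau>; evaluation at \<open>W\<close>
  inverts it.\<close>

lemma ext_rees_map_0_injective:
  fixes f :: "nat \<Rightarrow> 'k::field mpoly"
  assumes "p \<in> mpolys UNIV {0..0}" "ext_rees_map f 0 p = 0"
  shows "p = 0"
proof -
  define h where "h = (\<lambda>q. poly (map_poly mconst q) (mvar 0 :: 'k mpoly mpoly))"
  have "comm_ring_hom (\<lambda>q. poly q (mvar 0 :: 'k mpoly mpoly))"
    by unfold_locales simp_all
  from comm_ring_hom_comp[OF this comm_ring_hom_map_poly[OF comm_ring_hom_mconst]]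
  have h: "comm_ring_hom h" unfolding h_def .
  have "h (ext_rees_map f 0 p) = p"
  proof (rule mpoly_hom_eqI[OF comm_ring_hom_comp[OF h ext_rees_map_hom] comm_ring_hom_id
        subring_set_UNIV assms(1)])
    show "h (ext_rees_map f 0 (mconst c)) = mconst c" for c
      by (simp add: h_def map_poly_pCons)
    show "h (ext_rees_map f 0 (mvar i)) = mvar i" if "i \<in> {0..0}" for i
      using that by (simp add: h_def map_poly_monom poly_monom)
  qed
  then show ?thesis by (simp add: assms(2) h_def)
qed

text \<open>The induction hypothesis serves two families, which is why \<open>f\<close> stays
  arbitrary: the first \<open>t\<close> forms themselves, for polynomials free of the last variable,
  and their restrictions to the hyperplane, for leading coefficients.\<close>

theorem ext_rees_map_kernel:
  fixes f :: "nat \<Rightarrow> 'k::field mpoly"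
  assumes V: "finite V"
    and "\<And>i. f i \<in> linear_forms V" "\<And>i. i \<in> {1..t} \<Longrightarrow> f i \<noteq> 0"
    and "p \<in> mpolys (mpolys UNIV V) {0..t}" "ext_rees_map f t p = 0"
  shows "p \<in> gen_ideal (mpolys (mpolys UNIV V) {0..t}) (ext_rels f t)"
  using assms(2-)
proof (induction t arbitrary: f p)
  case 0
  then have "p = 0"
    using ext_rees_map_0_injective mpolys_mono[of "mpolys UNIV V" UNIV] by blast
  then show ?case by (simp add: gen_ideal.zero)
next
  case (Suc t)
  let ?A = "mpolys UNIV V :: 'k mpoly set"
  let ?N = "gen_ideal (mpolys ?A {0..Suc t}) (ext_rels f (Suc t))"
  let ?T = "mvar (Suc t) :: 'k mpoly mpoly"
  let ?f = "f (Suc t)"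
  have A: "subring_set ?A" by (rule subring_set_mpolys) simp
  note S = subring_set_mpolys[OF A]
  note sr = subring_setD[OF S]
  have kA: "range mconst \<subseteq> ?A" by (auto intro: mconst_in_mpolys)
  have fA: "f i \<in> ?A" for i by (rule linear_forms_in_mpolys[OF Suc.prems(1)])
  have sub: "mpolys ?A {0..t} \<subseteq> mpolys ?A {0..Suc t}" "mpolys ?A {0..t} \<subseteq> mpolys UNIV {0..t}"
    by (rule mpolys_mono; auto)+
  have f0: "?f \<noteq> 0" using Suc.prems(2) by simp
  have T: "?T \<in> mpolys ?A {0..Suc t}" by (rule mvar_in_mpolys[OF A]) simp
  interpret e: comm_ring_hom "ext_rees_map f (Suc t)" by (rule ext_rees_map_hom)
  obtain \<sigma> where \<sigma>: "comm_ring_hom \<sigma>" "\<And>c. \<sigma> (mconst c) = mconst c" "\<sigma> ?f = 0"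
    "\<And>p. p \<in> ?A \<Longrightarrow> \<sigma> p \<in> ?A"
    "\<And>p. p \<in> ?A \<Longrightarrow> \<exists>q\<in>?A. p - \<sigma> p = ?f * q"
    "\<And>p. p \<in> linear_forms V \<Longrightarrow> \<exists>b. p - \<sigma> p = mconst b * ?f"
    by (rule restriction_to_hyperplane[OF V Suc.prems(1) f0]) blast
  interpret \<sigma>: comm_ring_hom \<sigma> by (rule \<sigma>(1))
  have T_free: "q \<in> ?N" if q: "q \<in> mpolys ?A {0..t}" "ext_rees_map f (Suc t) q = 0" for q
  proof -
    have "ext_rees_map f t q = 0"
      using q ext_rees_map_Suc[of q t f] sub(2) pcompose_eq_0[of "ext_rees_map f t q" "[:0, ?f:]"] f0
      by auto
    then have "q \<in> gen_ideal (mpolys ?A {0..t}) (ext_rels f t)"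
      using q Suc.prems by (intro Suc.IH) auto
    then show ?thesis using gen_ideal_mono[OF sub(1) ext_rels_mono] by blast
  qed
  show ?case
  proof (cases "\<exists>i\<in>{1..t}. \<sigma> (f i) = 0")
    case True
    then obtain i where i: "i \<in> {1..t}" "\<sigma> (f i) = 0" by blast
    \<comment> \<open>The circuit on \<open>{i, t + 1}\<close> amounts to
      \<open>T\<^sub>t\<^sub>+\<^sub>1 = b T\<^sub>i\<close>, which eliminates the last variable
      from \<open>p\<close> altogether.\<close>
    obtain b where b: "f i = mconst b * ?f" using \<sigma>(6)[OF Suc.prems(1), of i] i by auto
    define a where "a = (\<lambda>j. if j = i then 1 else - b)"
    have b0: "b \<noteq> 0" using Suc.prems(2)[of i] i b by auto
    have it: "i \<noteq> Suc t" using i by auto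
    have "circuit_rel (\<lambda>j. mconst (a j)) {i, Suc t} \<in> ext_rels f (Suc t)"
      unfolding ext_rels_def using i b0 it b
      by (intro UnI2 CollectI exI[of _ a] exI[of _ "{i, Suc t}"])
         (auto simp: a_def mconst.hom_uminus)
    moreover have "circuit_rel (\<lambda>j. mconst (a j)) {i, Suc t} = ?T - mconst (mconst b) * mvar i"
    proof -
      have "{i, Suc t} - {i} = {Suc t}" "{i, Suc t} - {Suc t} = {i}" using it by auto
      then show ?thesis using it by (simp add: circuit_rel_def a_def mconst.hom_uminus)
    qed
    ultimately have par: "?T - mconst (mconst b) * mvar i \<in> ?N"
      using gen_ideal_gen[OF S] by metis
    let ?y = "mconst (mconst b) * mvar i :: 'k mpoly mpoly"
    have y: "?y \<in> mpolys ?A {0..t}"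
      using i kA by (intro mpolys_mult A mconst_in_mpolys mvar_in_mpolys) auto
    obtain M c where c: "\<And>m. c m \<in> mpolys ?A {0..t}" and p: "p = (\<Sum>m\<le>M. c m * ?T ^ m)"
      using mpolys_Suc_expand[OF A Suc.prems(3)] by blast
    let ?q = "\<Sum>m\<le>M. c m * ?y ^ m"
    have "p - ?q = (\<Sum>m\<le>M. c m * (?T ^ m - ?y ^ m))"
      by (simp add: p sum_subtractf right_diff_distrib)
    also have "\<dots> \<in> ?N"
      using c y sub(1) par T
      by (intro gen_ideal_sum gen_ideal_mult[OF S] gen_ideal_power_diff[OF S]) auto
    finally have pq: "p - ?q \<in> ?N" .
    have "ext_rees_map f (Suc t) ?q = 0"
      using ext_rels_kernel[OF pq Suc.prems(2)] Suc.prems(4) by (simp add: e.hom_minus)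
    then have "?q \<in> ?N"
      by (intro T_free subring_set_sum[OF S] sr(6)[OF c] subring_set_power[OF S] y)
    from gen_ideal_add[OF pq this] show ?thesis by simp
  next
    case False
    let ?\<sigma>S = "mpoly_eval (\<lambda>a. mconst (\<sigma> a)) mvar"
    interpret m\<sigma>: comm_ring_hom "\<lambda>a. mconst (\<sigma> a)"
      by (rule comm_ring_hom_comp[OF comm_ring_hom_mconst \<sigma>(1)])
    interpret \<sigma>S: comm_ring_hom ?\<sigma>S by (rule m\<sigma>.mpoly_eval_hom)
    have \<sigma>S: "?\<sigma>S q \<in> mpolys ?A {0..t}" if "q \<in> mpolys ?A {0..t}" for q
      by (rule mpoly_eval_in[OF S that]) (auto intro: mconst_in_mpolys mvar_in_mpolys A \<sigma>(4))
    have \<sigma>lin: "\<sigma> (f i) \<in> linear_forms V" for i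
    proof -
      obtain b where "f i - \<sigma> (f i) = mconst b * ?f" using \<sigma>(6)[OF Suc.prems(1)] by blast
      then have "\<sigma> (f i) = f i - mconst b * ?f" by (metis diff_diff_eq2 add_diff_cancel_left')
      then show ?thesis using linear_forms_scaled_diff[OF Suc.prems(1) Suc.prems(1)] by simp
    qed
    have diff: "\<exists>r\<in>mpolys ?A {0..t}. q - ?\<sigma>S q = mconst ?f * r" if "q \<in> mpolys ?A {0..t}" for q
    proof (rule hom_diff_multiple[OF A m\<sigma>.mpoly_eval_hom \<sigma>S _ _ that])
      fix c assume "c \<in> ?A"
      then obtain r where "r \<in> ?A" "c - \<sigma> c = ?f * r" using \<sigma>(5) by blast
      then show "\<exists>r\<in>mpolys ?A {0..t}. mconst c - ?\<sigma>S (mconst c) = mconst ?f * r"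
        by (intro bexI[of _ "mconst r"])
           (auto simp: mconst.hom_minus[symmetric] mconst.hom_mult[symmetric] intro: mconst_in_mpolys A)
    next
      show "\<exists>r\<in>mpolys ?A {0..t}. mvar i - ?\<sigma>S (mvar i) = mconst ?f * r" for i
        by (intro bexI[of _ 0]) (auto simp: sr)
    qed
    \<comment> \<open>Split \<open>x\<close> into its restriction, whose multiple by
      \<open>T\<^sub>t\<^sub>+\<^sub>1\<close> is lifted from the hyperplane, and a multiple
      \<open>f\<^sub>t\<^sub>+\<^sub>1 r\<close>, which \<open>T\<^sub>t\<^sub>+\<^sub>1\<close>
      turns into \<open>r W\<close>.\<close>
    have step: "\<exists>q\<in>mpolys ?A {0..t}. x * ?T - q \<in> ?N"
      if x: "x \<in> mpolys ?A {0..t}" "ext_rees_map (\<lambda>i. \<sigma> (f i)) t (?\<sigma>S x) = 0" for x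
    proof -
      obtain r where r: "r \<in> mpolys ?A {0..t}" "x - ?\<sigma>S x = mconst ?f * r"
        using diff[OF x(1)] by blast
      have "?\<sigma>S x \<in> gen_ideal (mpolys ?A {0..t}) (ext_rels (\<lambda>i. \<sigma> (f i)) t)"
        using False by (intro Suc.IH \<sigma>lin \<sigma>S x) auto
      then obtain q where q: "q \<in> mpolys ?A {0..t}" "?\<sigma>S x * ?T - q \<in> ?N"
        using lift_ext_ideal[where f = f, OF A kA fA, where \<sigma> = \<sigma> and t = t] \<sigma>(6)[OF Suc.prems(1)] by blast
      have "mconst ?f * ?T - mvar 0 \<in> ?N"
        by (rule gen_ideal_gen[OF S]) (auto simp: ext_rels_def)
      then have "(?\<sigma>S x * ?T - q) + r * (mconst ?f * ?T - mvar 0) \<in> ?N"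
        using r(1) sub(1) by (intro gen_ideal_add gen_ideal_mult[OF S] q) auto
      also have "(?\<sigma>S x * ?T - q) + r * (mconst ?f * ?T - mvar 0) = x * ?T - (q + r * mvar 0)"
      proof -
        have "x = ?\<sigma>S x + mconst ?f * r" using r(2) by (simp add: algebra_simps)
        then have "x * ?T = (?\<sigma>S x + mconst ?f * r) * ?T" by simp
        then show ?thesis by (simp add: algebra_simps)
      qed
      finally show ?thesis
        using q(1) r(1) by (intro bexI[of _ "q + r * mvar 0"]) (auto intro!: sr mvar_in_mpolys A)
    qed
    have main: "(\<Sum>m\<le>M. c m * ?T ^ m) \<in> ?N"
      if "\<And>m. c m \<in> mpolys ?A {0..t}" "ext_rees_map f (Suc t) (\<Sum>m\<le>M. c m * ?T ^ m) = 0" for M c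
      using that
    proof (induction M arbitrary: c)
      case 0
      then show ?case using T_free[of "c 0"] by simp
    next
      case (Suc M)
      note prems = Suc.prems
      let ?p = "\<Sum>m\<le>Suc M. c m * ?T ^ m"
      have "ext_rees_map (\<lambda>i. \<sigma> (f i)) t (?\<sigma>S (c (Suc M))) = 0"
        using False prems sub(2) by (intro ext_rees_map_leading[OF \<sigma>(1-3) _ f0 _ prems(2)]) blast+
      then obtain q where q: "q \<in> mpolys ?A {0..t}" "c (Suc M) * ?T - q \<in> ?N"
        using step prems(1) by blast
      \<comment> \<open>As \<open>c\<^sub>M\<^sub>+\<^sub>1 T\<close> is congruent to
        \<open>q\<close>, the leading term moves into the coefficient of degree \<open>M\<close>,
        and the degree in the last variable drops.\<close>
      define c' where "c' = c(M := c M + q)"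
      have "(\<Sum>m\<le>M. c' m * ?T ^ m) = (\<Sum>m\<le>M. c m * ?T ^ m + (if m = M then q * ?T ^ M else 0))"
        by (rule sum.cong) (auto simp: c'_def algebra_simps)
      also have "\<dots> = (\<Sum>m\<le>M. c m * ?T ^ m) + q * ?T ^ M"
        by (simp add: sum.distrib)
      finally have "?p - (\<Sum>m\<le>M. c' m * ?T ^ m) = ?T ^ M * (c (Suc M) * ?T - q)"
        by (simp add: algebra_simps)
      also have "\<dots> \<in> ?N"
        by (intro gen_ideal_mult[OF S] subring_set_power[OF S] T q)
      finally have d: "?p - (\<Sum>m\<le>M. c' m * ?T ^ m) \<in> ?N" .
      have "ext_rees_map f (Suc t) (\<Sum>m\<le>M. c' m * ?T ^ m) = 0"
        using ext_rels_kernel[OF d \<open>\<And>i. i \<in> {1..Suc t} \<Longrightarrow> f i \<noteq> 0\<close>] prems(2)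
        by (simp add: e.hom_minus del: sum.atMost_Suc)
      moreover have "c' m \<in> mpolys ?A {0..t}" for m
        using prems(1) q(1) by (auto simp: c'_def sr)
      ultimately have "(\<Sum>m\<le>M. c' m * ?T ^ m) \<in> ?N" by (rule Suc.IH[rotated])
      from gen_ideal_add[OF d this] show ?case by (simp del: sum.atMost_Suc)
    qed
    obtain M c where "\<And>m. c m \<in> mpolys ?A {0..t}" "p = (\<Sum>m\<le>M. c m * ?T ^ m)"
      using mpolys_Suc_expand[OF A Suc.prems(3)] by blast
    then show ?thesis using main Suc.prems(4) by blast
  qed
qed

section \<open>Minors indexed by sets\<close>

lemma bij_betw_sorted_nth:
  "finite X \<Longrightarrow> bij_betw ((!) (sorted_list_of_set X)) {..<card X} X"
  by (rule bij_betw_nth) (simp_all add: atLeast0LessThan lessThan_def)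

text \<open>Signs are expressed by numbers of smaller elements, whereas determinants are indexed by
  list positions; the two are matched here.\<close>

lemma card_less_sorted_nth:
  fixes X :: "nat set"
  assumes X: "finite X" and i: "i < card X"
  shows "card {y \<in> X. y < sorted_list_of_set X ! i} = i"
proof -
  let ?xs = "sorted_list_of_set X"
  have l: "length ?xs = card X" by simp
  have sd: "sorted_wrt (<) ?xs" by simp
  have lt: "?xs ! a < ?xs ! b \<longleftrightarrow> a < b" if "a < card X" "b < card X" for a b
    using sorted_wrt_nth_less[OF sd, of a b] sorted_wrt_nth_less[OF sd, of b a] that l
    by (cases a b rule: linorder_cases) auto
  have "{y \<in> X. y < ?xs ! i} = (!) ?xs ` {..<i}"
  proof (intro Set.set_eqI iffI)
    fix y assume y: "y \<in> {y \<in> X. y < ?xs ! i}"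
    then obtain a where "a < card X" "y = ?xs ! a"
      using bij_betw_sorted_nth[OF X] by (auto simp: bij_betw_def)
    then show "y \<in> (!) ?xs ` {..<i}" using y lt i by auto
  next
    fix y assume "y \<in> (!) ?xs ` {..<i}"
    then obtain a where a: "a < i" "y = ?xs ! a" by auto
    then have "y \<in> X" using bij_betw_sorted_nth[OF X] i by (auto simp: bij_betw_def)
    then show "y \<in> {y \<in> X. y < ?xs ! i}" using a lt i by auto
  qed
  moreover have "inj_on ((!) ?xs) {..<i}"
    using bij_betw_sorted_nth[OF X] i by (auto simp: bij_betw_def intro: inj_on_subset)
  ultimately show ?thesis by (simp add: card_image)
qed

lemma sorted_nth_card_less:
  fixes X :: "nat set"
  assumes X: "finite X" and x: "x \<in> X"
  shows "card {y \<in> X. y < x} < card X" "sorted_list_of_set X ! card {y \<in> X. y < x} = x"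
proof -
  obtain i where "i < card X" "x = sorted_list_of_set X ! i"
    using bij_betw_sorted_nth[OF X] x by (auto simp: bij_betw_def)
  then show "card {y \<in> X. y < x} < card X" "sorted_list_of_set X ! card {y \<in> X. y < x} = x"
    using card_less_sorted_nth[OF X] by auto
qed

text \<open>Deleting an element shifts the later positions by one, exactly as
  \<open>mat_delete\<close> shifts rows and columns.\<close>

lemma sorted_nth_remove:
  fixes X :: "nat set"
  assumes X: "finite X" and q: "q < card X" and i: "i < card X - 1"
  shows "sorted_list_of_set (X - {sorted_list_of_set X ! q}) ! i =
    sorted_list_of_set X ! (if i < q then i else Suc i)"
proof -
  let ?xs = "sorted_list_of_set X"
  have l: "length ?xs = card X" by simp
  have "sorted_list_of_set (X - {?xs ! q}) = remove1 (?xs ! q) ?xs"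
    using X by (simp add: sorted_list_of_set_remove)
  also have "\<dots> = remove1 (?xs ! q) (take q ?xs @ ?xs ! q # drop (Suc q) ?xs)"
    using id_take_nth_drop[of q ?xs] q l by simp
  also have "\<dots> = take q ?xs @ drop (Suc q) ?xs"
  proof -
    have "distinct (take q ?xs @ ?xs ! q # drop (Suc q) ?xs)"
      using id_take_nth_drop[of q ?xs] q l by (metis distinct_sorted_list_of_set)
    then show ?thesis by (auto simp: remove1_append)
  qed
  finally show ?thesis using q i l by (auto simp: nth_append)
qed

lemma minor_transpose:
  assumes "card X = card Y"
  shows "minor M X Y = minor (\<lambda>y x. M x y) Y X"
proof -
  let ?A = "mat (card X) (card Y) (\<lambda>(a, b). M (sorted_list_of_set X ! a) (sorted_list_of_set Y ! b))"
  have "det ?A = det (transpose_mat ?A)"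
    by (rule det_transpose[symmetric]) (use assms in auto)
  also have "transpose_mat ?A = mat (card Y) (card X) (\<lambda>(a, b). M (sorted_list_of_set X ! b) (sorted_list_of_set Y ! a))"
    by (rule eq_matI) auto
  finally show ?thesis unfolding minor_def .
qed

lemma minor_eq_0_iff:
  fixes M :: "nat \<Rightarrow> nat \<Rightarrow> 'a::idom"
  assumes X: "finite X" and Y: "finite Y" and c: "card X = card Y"
  shows "minor M X Y = 0 \<longleftrightarrow> (\<exists>v. (\<exists>y\<in>Y. v y \<noteq> 0) \<and> (\<forall>x\<in>X. (\<Sum>y\<in>Y. M x y * v y) = 0))"
proof -
  let ?p = "card X"
  let ?xs = "(!) (sorted_list_of_set X)" and ?ys = "(!) (sorted_list_of_set Y)"
  let ?A = "mat ?p ?p (\<lambda>(a, b). M (?xs a) (?ys b))"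
  have bx: "bij_betw ?xs {..<?p} X" by (rule bij_betw_sorted_nth[OF X])
  have bY: "bij_betw ?ys {..<?p} Y" unfolding c by (rule bij_betw_sorted_nth[OF Y])
  have "minor M X Y = 0 \<longleftrightarrow> (\<exists>w. w \<in> carrier_vec ?p \<and> w \<noteq> 0\<^sub>v ?p \<and> ?A *\<^sub>v w = 0\<^sub>v ?p)"
    unfolding minor_def c[symmetric] by (rule det_0_iff_vec_prod_zero) simp
  also have "\<dots> \<longleftrightarrow> (\<exists>v. (\<exists>y\<in>Y. v y \<noteq> 0) \<and> (\<forall>x\<in>X. (\<Sum>y\<in>Y. M x y * v y) = 0))"
  proof
    assume "\<exists>w. w \<in> carrier_vec ?p \<and> w \<noteq> 0\<^sub>v ?p \<and> ?A *\<^sub>v w = 0\<^sub>v ?p"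
    then obtain w where w: "w \<in> carrier_vec ?p" "w \<noteq> 0\<^sub>v ?p" "?A *\<^sub>v w = 0\<^sub>v ?p" by blast
    define v where "v y = w $ (the_inv_into {..<?p} ?ys y)" for y
    have v: "v (?ys b) = w $ b" if "b < ?p" for b
      using that bY by (simp add: v_def the_inv_into_f_f bij_betw_def)
    obtain b where b: "b < ?p" "w $ b \<noteq> 0"
      using w by (metis carrier_vecD eq_vecI index_zero_vec)
    then have "\<exists>y\<in>Y. v y \<noteq> 0" using v bY by (metis bij_betw_apply lessThan_iff)
    moreover have "(\<Sum>y\<in>Y. M x y * v y) = 0" if x: "x \<in> X" for x
    proof -
      obtain a where a: "a < ?p" "x = ?xs a" using x bx by (auto simp: bij_betw_def)
      have "(\<Sum>y\<in>Y. M x y * v y) = (\<Sum>b<?p. M x (?ys b) * v (?ys b))"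
        by (rule sum.reindex_bij_betw[OF bY, symmetric])
      also have "\<dots> = (?A *\<^sub>v w) $ a"
        using a w(1) v by (simp add: scalar_prod_def atLeast0LessThan)
      finally show ?thesis using w(3) a by simp
    qed
    ultimately show "\<exists>v. (\<exists>y\<in>Y. v y \<noteq> 0) \<and> (\<forall>x\<in>X. (\<Sum>y\<in>Y. M x y * v y) = 0)" by blast
  next
    assume "\<exists>v. (\<exists>y\<in>Y. v y \<noteq> 0) \<and> (\<forall>x\<in>X. (\<Sum>y\<in>Y. M x y * v y) = 0)"
    then obtain v y where v: "y \<in> Y" "v y \<noteq> 0" "\<And>x. x \<in> X \<Longrightarrow> (\<Sum>y\<in>Y. M x y * v y) = 0" by blast
    let ?w = "vec ?p (\<lambda>b. v (?ys b))"
    obtain b where b: "b < ?p" "y = ?ys b" using v(1) bY by (auto simp: bij_betw_def)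
    have "?w $ b \<noteq> 0" using b v by simp
    then have "?w \<noteq> 0\<^sub>v ?p" using b by (metis index_zero_vec(1))
    moreover have "?A *\<^sub>v ?w = 0\<^sub>v ?p"
    proof (rule eq_vecI)
      fix a assume a: "a < dim_vec (0\<^sub>v ?p :: 'a vec)"
      then have "?xs a \<in> X" using bx by (auto simp: bij_betw_def)
      from v(3)[OF this] have "(\<Sum>b<?p. M (?xs a) (?ys b) * v (?ys b)) = 0"
        by (simp add: sum.reindex_bij_betw[OF bY, of "\<lambda>y. M (?xs a) y * v y"])
      then show "(?A *\<^sub>v ?w) $ a = 0\<^sub>v ?p $ a"
        using a by (simp add: scalar_prod_def atLeast0LessThan)
    qed simp
    ultimately show "\<exists>w. w \<in> carrier_vec ?p \<and> w \<noteq> 0\<^sub>v ?p \<and> ?A *\<^sub>v w = 0\<^sub>v ?p"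
      by (intro exI[of _ ?w]) auto
  qed
  finally show ?thesis .
qed

lemma minor_laplace:
  assumes X: "finite X" and Y: "finite Y" and c: "card X = card Y" and x: "x \<in> X"
  shows "minor M X Y = (\<Sum>y\<in>Y. (-1) ^ (card {x'\<in>X. x' < x} + card {y'\<in>Y. y' < y}) * M x y *
    minor M (X - {x}) (Y - {y}))"
proof -
  let ?p = "card X"
  let ?xs = "(!) (sorted_list_of_set X)" and ?ys = "(!) (sorted_list_of_set Y)"
  let ?A = "mat ?p ?p (\<lambda>(a, b). M (?xs a) (?ys b))"
  have bY: "bij_betw ?ys {..<?p} Y" unfolding c by (rule bij_betw_sorted_nth[OF Y])
  define q where "q = card {x'\<in>X. x' < x}"
  have q: "q < ?p" "?xs q = x" unfolding q_def by (rule sorted_nth_card_less[OF X x])+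
  have "minor M X Y = (\<Sum>b<?p. ?A $$ (q, b) * cofactor ?A q b)"
    unfolding minor_def c[symmetric] by (rule laplace_expansion_row[OF _ q(1)]) simp
  also have "\<dots> = (\<Sum>b<?p. (-1) ^ (q + card {y'\<in>Y. y' < ?ys b}) * M x (?ys b) *
      minor M (X - {x}) (Y - {?ys b}))"
  proof (rule sum.cong)
    fix b assume "b \<in> {..<?p}"
    then have b: "b < ?p" by simp
    have yb: "?ys b \<in> Y" using b bY by (auto simp: bij_betw_def)
    have cX: "card (X - {x}) = ?p - 1" "card (Y - {?ys b}) = ?p - 1"
      using X x yb Y c by simp_all
    let ?D = "mat (?p - 1) (?p - 1) (\<lambda>(a', b').
        M (sorted_list_of_set (X - {x}) ! a') (sorted_list_of_set (Y - {?ys b}) ! b'))"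
    have "mat_delete ?A q b = ?D"
      unfolding mat_delete_def
    proof (rule eq_matI)
      fix i j assume "i < dim_row ?D" "j < dim_col ?D"
      then have ij: "i < ?p - 1" "j < ?p - 1" by simp_all
      have "sorted_list_of_set (X - {x}) ! i = ?xs (if i < q then i else Suc i)"
        using sorted_nth_remove[OF X q(1) ij(1)] q(2) by simp
      moreover have "sorted_list_of_set (Y - {?ys b}) ! j = ?ys (if j < b then j else Suc j)"
        using sorted_nth_remove[OF Y, of b j] b ij(2) c by simp
      ultimately show "mat (dim_row ?A - 1) (dim_col ?A - 1) (\<lambda>(i', j').
          ?A $$ (if i' < q then i' else Suc i', if j' < b then j' else Suc j')) $$ (i, j) = ?D $$ (i, j)"
        using ij by simp
    qed simp_all
    then have "det (mat_delete ?A q b) = minor M (X - {x}) (Y - {?ys b})"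
      unfolding minor_def cX by simp
    moreover have "card {y'\<in>Y. y' < ?ys b} = b" using card_less_sorted_nth[OF Y] b c by simp
    ultimately show "?A $$ (q, b) * cofactor ?A q b = (-1) ^ (q + card {y'\<in>Y. y' < ?ys b}) * M x (?ys b) *
      minor M (X - {x}) (Y - {?ys b})"
      using q b by (simp add: cofactor_def mult_ac)
  qed simp
  also have "\<dots> = (\<Sum>y\<in>Y. (-1) ^ (q + card {y'\<in>Y. y' < y}) * M x y * minor M (X - {x}) (Y - {y}))"
    by (rule sum.reindex_bij_betw[OF bY])
  finally show ?thesis unfolding q_def .
qed

lemma minor_cong:
  assumes "\<And>x y. x \<in> X \<Longrightarrow> y \<in> Y \<Longrightarrow> M x y = N x y" "finite X" "finite Y"
  shows "minor M X Y = minor N X Y"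
proof -
  have "sorted_list_of_set X ! a \<in> X" if "a < card X" for a
    using nth_mem[of a "sorted_list_of_set X"] that assms by simp
  moreover have "sorted_list_of_set Y ! a \<in> Y" if "a < card Y" for a
    using nth_mem[of a "sorted_list_of_set Y"] that assms by simp
  ultimately show ?thesis
    unfolding minor_def by (intro arg_cong[where f = det] eq_matI) (auto simp: assms)
qed

text \<open>Expansion along a new row \<open>z\<close> that copies row \<open>x\<close>. The
  enlarged minor vanishes, as rows \<open>z\<close> and \<open>x\<close> cancel, and the position of
  \<open>z\<close> contributes a sign common to all terms.\<close>

lemma minor_laplace_repeated:
  fixes M :: "nat \<Rightarrow> nat \<Rightarrow> 'a::idom"
  assumes X: "finite X" and Y: "finite Y" and c: "card Y = Suc (card X)" and x: "x \<in> X"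
  shows "(\<Sum>y\<in>Y. (-1) ^ card {y'\<in>Y. y' < y} * M x y * minor M X (Y - {y})) = 0"
proof -
  obtain z where z: "z \<notin> X" using X ex_new_if_finite infinite_UNIV_nat by blast
  define N where "N = (\<lambda>a. if a = z then M x else M a)"
  let ?Z = "insert z X"
  let ?s = "card {x'\<in>?Z. x' < z}"
  have cZ: "card ?Z = card Y" using z X c by simp
  have xz: "x \<noteq> z" using x z by blast
  have "minor N ?Z Y = minor (\<lambda>y x. N x y) Y ?Z" by (rule minor_transpose[OF cZ])
  also have "\<dots> = 0"
  proof (subst minor_eq_0_iff)
    let ?v = "\<lambda>k. if k = z then 1 else if k = x then - 1 else 0 :: 'a"
    have "(\<Sum>k\<in>?Z. N k y * ?v k) = 0" for y
    proof -
      have "(\<Sum>k\<in>?Z. N k y * ?v k) = M x y + (\<Sum>k\<in>X. N k y * ?v k)"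
        using X z by (simp add: N_def)
      also have "(\<Sum>k\<in>X. N k y * ?v k) = (\<Sum>k\<in>X. if k = x then - M x y else 0)"
        using z by (intro sum.cong) (auto simp: N_def)
      also have "\<dots> = - M x y" using X x by simp
      finally show ?thesis by simp
    qed
    then show "\<exists>v. (\<exists>y\<in>?Z. v y \<noteq> 0) \<and> (\<forall>y\<in>Y. (\<Sum>k\<in>?Z. N k y * v k) = 0)"
      by (intro exI[of _ ?v]) auto
  qed (use X Y cZ in auto)
  finally have "0 = (\<Sum>y\<in>Y. (-1) ^ (?s + card {y'\<in>Y. y' < y}) * N z y * minor N (?Z - {z}) (Y - {y}))"
    using minor_laplace[OF _ Y cZ, of z N] X by simp
  also have "\<dots> = (\<Sum>y\<in>Y. (-1) ^ ?s * ((-1) ^ card {y'\<in>Y. y' < y} * M x y * minor M X (Y - {y})))"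
  proof (rule sum.cong)
    fix y assume "y \<in> Y"
    have "?Z - {z} = X" using z by auto
    moreover have "minor N X (Y - {y}) = minor M X (Y - {y})"
      using X Y z by (intro minor_cong) (auto simp: N_def)
    ultimately show "(-1) ^ (?s + card {y'\<in>Y. y' < y}) * N z y * minor N (?Z - {z}) (Y - {y}) =
      (-1) ^ ?s * ((-1) ^ card {y'\<in>Y. y' < y} * M x y * minor M X (Y - {y}))"
      by (simp add: N_def power_add mult_ac)
  qed simp
  finally show ?thesis by (simp add: sum_distrib_left[symmetric])
qed

section \<open>Linear dependencies and minors of \<open>U\<close>\<close>

text \<open>The vanishing of the coefficient of each \<open>x\<^sub>j\<close> in
  \<open>\<Sum> a\<^sub>k F\<^sub>k\<close>; the polynomial form of the condition is
  \<open>dependency_iff\<close>.\<close>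

definition dependency :: "nat \<Rightarrow> nat \<Rightarrow> (nat \<Rightarrow> nat \<Rightarrow> 'k::field) \<Rightarrow> (nat \<Rightarrow> 'k) \<Rightarrow> bool" where
  "dependency n r u a \<longleftrightarrow> (\<forall>j\<in>{1..n}. a j + (\<Sum>i=1..r. a (n + i) * u i j) = 0)"

lemma dependency_scaled_diff:
  assumes "dependency n r u a" "dependency n r u b"
  shows "dependency n r u (\<lambda>k. a k - c * b k)"
  unfolding dependency_def
proof
  fix j assume "j \<in> {1..n}"
  then have "a j + (\<Sum>i=1..r. a (n + i) * u i j) = 0" "b j + (\<Sum>i=1..r. b (n + i) * u i j) = 0"
    using assms by (auto simp: dependency_def)
  then have "(a j + (\<Sum>i=1..r. a (n + i) * u i j)) - c * (b j + (\<Sum>i=1..r. b (n + i) * u i j)) = 0"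
    by simp
  then show "a j - c * b j + (\<Sum>i=1..r. (a (n + i) - c * b (n + i)) * u i j) = 0"
    by (simp add: left_diff_distrib sum_subtractf sum_distrib_left algebra_simps)
qed

definition form_coeff :: "nat \<Rightarrow> (nat \<Rightarrow> nat \<Rightarrow> 'k::field) \<Rightarrow> nat \<Rightarrow> nat \<Rightarrow> 'k" where
  "form_coeff n u m k = (if m \<le> n then (if k = m then 1 else 0) else u (m - n) k)"

lemma sum_form_coeff:
  assumes "k \<in> {1..n}"
  shows "(\<Sum>m=1..n + r. b m * form_coeff n u m k) = b k + (\<Sum>i=1..r. b (n + i) * u i k)"
proof -
  have split: "{1..n + r} = {1..n} \<union> {n + 1..n + r}" "{1..n} \<inter> {n + 1..n + r} = {}" by auto
  have "(\<Sum>m=1..n + r. b m * form_coeff n u m k) =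
      (\<Sum>m=1..n. b m * form_coeff n u m k) + (\<Sum>m=n+1..n+r. b m * form_coeff n u m k)"
    unfolding split(1) by (rule sum.union_disjoint) (use split(2) in auto)
  also have "(\<Sum>m=n+1..n+r. b m * form_coeff n u m k) = (\<Sum>i=1..r. b (n + i) * u i k)"
    by (rule sum.reindex_bij_witness[of _ "\<lambda>i. n + i" "\<lambda>k. k - n"]) (auto simp: form_coeff_def)
  also have "(\<Sum>m=1..n. b m * form_coeff n u m k) = (\<Sum>m=1..n. if m = k then b m else 0)"
    by (rule sum.cong) (auto simp: form_coeff_def)
  also have "\<dots> = b k" using assms by simp
  finally show ?thesis .
qed

lemma F_eq_form_coeff:
  assumes "m \<in> {1..n + r}"
  shows "F n u m = (\<Sum>k=1..n. mconst (form_coeff n u m k) * mvar k)"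
proof (cases "m \<le> n")
  case True
  have "(\<Sum>k=1..n. mconst (form_coeff n u m k) * mvar k) = (\<Sum>k=1..n. if k = m then mvar k else 0 :: 'a mpoly)"
    using True by (intro sum.cong) (auto simp: form_coeff_def)
  also have "\<dots> = mvar m" using True assms by simp
  finally show ?thesis using True by (simp add: F_def)
qed (simp add: F_def form_coeff_def)

lemma sum_F:
  "(\<Sum>k=1..n + r. mconst (a k) * F n u k) =
    (\<Sum>j=1..n. mconst (a j + (\<Sum>i=1..r. a (n + i) * u i j)) * mvar j)"
proof -
  have "(\<Sum>k=1..n + r. mconst (a k) * F n u k) =
      (\<Sum>k=1..n + r. \<Sum>j=1..n. mconst (a k * form_coeff n u k j) * mvar j)"
    by (rule sum.cong) (simp_all only: F_eq_form_coeff sum_distrib_left mconst.hom_mult mult.assoc)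
  also have "\<dots> = (\<Sum>j=1..n. mconst (\<Sum>k=1..n + r. a k * form_coeff n u k j) * mvar j)"
    by (subst sum.swap) (simp only: mconst.hom_sum sum_distrib_right)
  finally show ?thesis by (simp only: sum_form_coeff cong: sum.cong)
qed

lemma linear_form_eq_0_iff:
  assumes "finite V"
  shows "(\<Sum>j\<in>V. mconst (c j) * mvar j) = (0 :: 'k::comm_ring_1 mpoly) \<longleftrightarrow> (\<forall>j\<in>V. c j = 0)"
proof
  assume 0: "(\<Sum>j\<in>V. mconst (c j) * mvar j) = (0 :: 'k mpoly)"
  show "\<forall>j\<in>V. c j = 0"
  proof
    fix k assume k: "k \<in> V"
    have inj: "Poly_Mapping.single j (1::nat) = Poly_Mapping.single k 1 \<longleftrightarrow> j = k" for j
      by (metis lookup_single_eq lookup_single_not_eq zero_neq_one)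
    have "0 = lookup (\<Sum>j\<in>V. mconst (c j) * mvar j) (Poly_Mapping.single k 1)"
      by (simp add: 0)
    also have "\<dots> = (\<Sum>j\<in>V. if j = k then c j else 0)"
      unfolding lookup_sum
      by (rule sum.cong) (auto simp: mconst_def mvar_def mult_single lookup_single when_def inj[unfolded One_nat_def])
    also have "\<dots> = c k" using k assms by simp
    finally show "c k = 0" by simp
  qed
qed (simp add: sum.neutral)

lemma dependency_iff:
  "dependency n r u a \<longleftrightarrow> (\<Sum>k=1..n + r. mconst (a k) * F n u k) = 0"
  unfolding sum_F dependency_def by (subst linear_form_eq_0_iff) auto

text \<open>This makes \<open>U\<^sub>\<chi>\<close> a square minor: the number of elements of
  \<chi> up to \<open>n\<close> is \<open>r\<close> minus the number above \<open>n\<close>, and the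
  latter remove columns.\<close>

lemma card_U_minor_sets:
  assumes "\<chi> \<subseteq> {1..n + r}" "card \<chi> = r"
  shows "card (\<chi> \<inter> {1..n}) = card {i\<in>{1..r}. n + i \<notin> \<chi>}"
proof -
  let ?Z = "{i\<in>{1..r}. n + i \<in> \<chi>}"
  have f: "finite \<chi>" using assms(1) finite_subset by blast
  have "\<chi> = (\<chi> \<inter> {1..n}) \<union> (+) n ` ?Z"
  proof (intro equalityI subsetI)
    fix x assume x: "x \<in> \<chi>"
    show "x \<in> (\<chi> \<inter> {1..n}) \<union> (+) n ` ?Z"
    proof (cases "x \<le> n")
      case False
      then have "x = n + (x - n)" "x - n \<in> ?Z" using x assms(1) by auto
      then show ?thesis by blast
    qed (use x assms(1) in auto)
  qed auto
  moreover have "(\<chi> \<inter> {1..n}) \<inter> (+) n ` ?Z = {}" by auto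
  ultimately have "r = card (\<chi> \<inter> {1..n}) + card ((+) n ` ?Z)"
    using card_Un_disjoint[of "\<chi> \<inter> {1..n}" "(+) n ` ?Z"] assms(2) f by simp
  also have "card ((+) n ` ?Z) = card ?Z" by (simp add: card_image)
  finally have "r = card (\<chi> \<inter> {1..n}) + card ?Z" .
  moreover have "card ?Z + card {i\<in>{1..r}. n + i \<notin> \<chi>} = r"
  proof -
    have "?Z \<union> {i\<in>{1..r}. n + i \<notin> \<chi>} = {1..r}" by auto
    then show ?thesis
      using card_Un_disjoint[of ?Z "{i\<in>{1..r}. n + i \<notin> \<chi>}"] by (auto simp: disjoint_iff)
  qed
  ultimately show ?thesis by linarith
qed

text \<open>A kernel vector of the submatrix supplies the coefficients of the
  \<open>L\<^sub>i\<close> with \<open>n + i \<notin> \<chi>\<close>. Those of the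
  \<open>x\<^sub>k\<close> are then forced, and they vanish for \<open>k \<in> \<chi>\<close> by the
  kernel equations.\<close>

lemma U_minor_eq_0_dependency:
  fixes u :: "nat \<Rightarrow> nat \<Rightarrow> 'k::field"
  assumes \<chi>: "\<chi> \<subseteq> {1..n + r}" "card \<chi> = r" and 0: "U_minor n r u \<chi> = 0"
  obtains a k where "dependency n r u a" "k \<in> {1..n + r}" "a k \<noteq> 0" "\<And>k. k \<in> \<chi> \<Longrightarrow> a k = 0"
proof -
  let ?X = "\<chi> \<inter> {1..n}" and ?Y = "{i\<in>{1..r}. n + i \<notin> \<chi>}"
  have "finite ?X" by simp
  then obtain v y where v: "y \<in> ?Y" "v y \<noteq> 0" "\<And>x. x \<in> ?X \<Longrightarrow> (\<Sum>y\<in>?Y. u y x * v y) = 0"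
    using minor_eq_0_iff[OF _ _ card_U_minor_sets[OF \<chi>], of "\<lambda>k i. u i k"] 0
    unfolding U_minor_def by auto
  define a where "a k = (if k \<le> n then - (\<Sum>y\<in>?Y. u y k * v y) else if k - n \<in> ?Y then v (k - n) else 0)" for k
  have s: "(\<Sum>i=1..r. a (n + i) * u i j) = (\<Sum>y\<in>?Y. u y j * v y)" for j
    by (rule sum.mono_neutral_cong_right) (auto simp: a_def)
  show ?thesis
  proof (rule that[of a "n + y"])
    show "dependency n r u a"
      unfolding dependency_def s by (auto simp: a_def)
    show "n + y \<in> {1..n + r}" "a (n + y) \<noteq> 0" using v(1,2) by (auto simp: a_def)
    show "a k = 0" if "k \<in> \<chi>" for k
      using that v(3)[of k] \<chi>(1) by (auto simp: a_def)
  qed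
qed

text \<open>At the rows in \<chi> the equations of a dependency that vanishes on \<chi> say that the
  coefficients of the remaining \<open>L\<^sub>i\<close> form a kernel vector of an invertible
  matrix. So these are 0, and with them the coefficients of the \<open>x\<^sub>k\<close>.\<close>

lemma U_minor_neq_0_dependency:
  fixes u :: "nat \<Rightarrow> nat \<Rightarrow> 'k::field"
  assumes \<chi>: "\<chi> \<subseteq> {1..n + r}" "card \<chi> = r" and 0: "U_minor n r u \<chi> \<noteq> 0"
    and a: "dependency n r u a" "\<And>k. k \<in> \<chi> \<Longrightarrow> a k = 0" and k: "k \<in> {1..n + r}"
  shows "a k = 0"
proof -
  let ?X = "\<chi> \<inter> {1..n}" and ?Y = "{i\<in>{1..r}. n + i \<notin> \<chi>}"
  have s: "(\<Sum>i=1..r. a (n + i) * u i j) = (\<Sum>y\<in>?Y. u y j * a (n + y))" for j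
    by (rule sum.mono_neutral_cong_right) (use a(2) in \<open>auto simp: mult.commute\<close>)
  have d: "a j + (\<Sum>y\<in>?Y. u y j * a (n + y)) = 0" if "j \<in> {1..n}" for j
    using a(1) that unfolding dependency_def s by blast
  have z: "a (n + y) = 0" if "y \<in> ?Y" for y
  proof (rule ccontr)
    assume "a (n + y) \<noteq> 0"
    moreover have "(\<Sum>y\<in>?Y. u y x * a (n + y)) = 0" if "x \<in> ?X" for x
      using d[of x] a(2)[of x] that by auto
    moreover have "finite ?X" by simp
    ultimately have "minor (\<lambda>k i. u i k) ?X ?Y = 0"
      using that by (subst minor_eq_0_iff[OF _ _ card_U_minor_sets[OF \<chi>]])
        (auto intro!: exI[of _ "\<lambda>y. a (n + y)"])
    then show False using 0 by (simp add: U_minor_def)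
  qed
  show ?thesis
  proof (cases "k \<le> n")
    case True
    moreover have "(\<Sum>y\<in>?Y. u y k * a (n + y)) = 0" using z by (intro sum.neutral) auto
    ultimately show ?thesis using d[of k] k by auto
  next
    case False
    then have "k = n + (k - n)" "k - n \<in> {1..r}" using k by auto
    then show ?thesis using z[of "k - n"] a(2)[of k] by (cases "k \<in> \<chi>") auto
  qed
qed

text \<open>Opposite parity is expressed by adding even amounts on both sides, which avoids
  subtraction of natural numbers.\<close>

lemma minus_one_power_opposite:
  assumes "a + 2 * c = 2 * d + 1 + b" shows "(-1 :: 'a::ring_1) ^ a = - ((-1) ^ b)"
proof -
  have "even a \<longleftrightarrow> odd b" using assms by presburger
  then show ?thesis by (simp add: minus_one_power_iff)
qed

text \<open>
  Coefficients of the dependency between the \<open>n + 1\<close> forms outside \<open>\<Theta>\<close> given by Cramer's rule; the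
  sign agrees with \<open>\<alpha>\<close>.
\<close>

definition cramer :: "nat \<Rightarrow> nat \<Rightarrow> (nat \<Rightarrow> nat \<Rightarrow> 'k::field) \<Rightarrow> nat set \<Rightarrow> nat \<Rightarrow> 'k" where
  "cramer n r u \<Theta> k = (if k \<in> {1..n + r} - \<Theta> then
     (-1) ^ (if k \<le> n then card (\<Theta> \<inter> {1..n}) + card {j\<in>\<Theta>. j < k}
             else n + 1 + card {j\<in>{1..n + r} - \<Theta>. j < k}) * U_minor n r u (\<Theta> \<union> {k})
   else 0)"

text \<open>Up to sign, the contribution of the \<open>L\<^sub>i\<close> to the coefficient of
  \<open>x\<^sub>j\<close> is a Laplace expansion along row \<open>j\<close>. For
  \<open>j \<in> \<Theta>\<close> this row is repeated and the expansion is 0; for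
  \<open>j \<notin> \<Theta>\<close> it is the minor in the coefficient of \<open>x\<^sub>j\<close>
  itself, and the signs are such that both cancel.\<close>

lemma dependency_cramer:
  fixes u :: "nat \<Rightarrow> nat \<Rightarrow> 'k::field"
  assumes \<Theta>: "\<Theta> \<subseteq> {1..n + r}" "card \<Theta> = r - 1" and r: "r \<ge> 1"
  shows "dependency n r u (cramer n r u \<Theta>)"
proof -
  let ?X = "\<Theta> \<inter> {1..n}" and ?Y = "{i\<in>{1..r}. n + i \<notin> \<Theta>}"
  let ?M = "\<lambda>k i. u i k"
  let ?p = "card ?X"
  let ?s = "\<lambda>y. card {y'\<in>?Y. y' < y}"
  have f\<Theta>: "finite \<Theta>" using \<Theta>(1) finite_subset by blast
  have fX: "finite ?X" and fY: "finite ?Y" by auto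
  \<comment> \<open>There is one more column than rows, since adding any index outside \<Theta>
    makes the submatrix square, by a new row or by removing a column.\<close>
  have cY: "card ?Y = Suc ?p"
  proof -
    obtain k where k: "k \<in> {1..n + r} - \<Theta>"
    proof -
      have "card \<Theta> < card {1..n + r}" using \<Theta>(2) r by simp
      then show ?thesis using that f\<Theta> by (metis Diff_eq_empty_iff all_not_in_conv card_mono not_less)
    qed
    have c: "card (insert k \<Theta> \<inter> {1..n}) = card {i\<in>{1..r}. n + i \<notin> insert k \<Theta>}"
      using k \<Theta> r f\<Theta> by (intro card_U_minor_sets) auto
    show ?thesis
    proof (cases "k \<le> n")
      case True
      then have "insert k \<Theta> \<inter> {1..n} = insert k ?X" "{i\<in>{1..r}. n + i \<notin> insert k \<Theta>} = ?Y"
        using k by auto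
      then show ?thesis using c k fX by simp
    next
      case False
      then have "insert k \<Theta> \<inter> {1..n} = ?X" "{i\<in>{1..r}. n + i \<notin> insert k \<Theta>} = ?Y - {k - n}"
        and kY: "k - n \<in> ?Y"
        using k by auto
      then show ?thesis using c card_Suc_Diff1[OF fY kY] by simp
    qed
  qed
  have pn: "?p \<le> n" using card_mono[of "{1..n}" ?X] by simp
  have cEn: "card ({1..n} - \<Theta>) = n - ?p"
    using card_Diff_subset_Int[of "{1..n}" \<Theta>] fX by (simp add: Int_commute)
  have cr: "cramer n r u \<Theta> (n + i) * u i j = (if i \<in> ?Y then
      - ((-1) ^ (?p + ?s i) * u i j * minor ?M ?X (?Y - {i})) else 0)" if i: "i \<in> {1..r}" for i j
  proof (cases "i \<in> ?Y")
    case True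
    have "{j\<in>{1..n + r} - \<Theta>. j < n + i} = ({1..n} - \<Theta>) \<union> (+) n ` {y'\<in>?Y. y' < i}"
    proof (intro equalityI subsetI)
      fix x assume x: "x \<in> {j\<in>{1..n + r} - \<Theta>. j < n + i}"
      show "x \<in> ({1..n} - \<Theta>) \<union> (+) n ` {y'\<in>?Y. y' < i}"
      proof (cases "x \<le> n")
        case False
        then have "x = n + (x - n)" "x - n \<in> {y'\<in>?Y. y' < i}" using x by auto
        then show ?thesis by blast
      qed (use x in auto)
    qed (use i in auto)
    moreover have "({1..n} - \<Theta>) \<inter> (+) n ` {y'\<in>?Y. y' < i} = {}" by auto
    ultimately have "card {j\<in>{1..n + r} - \<Theta>. j < n + i} = n - ?p + ?s i"
      using card_Un_disjoint[of "{1..n} - \<Theta>" "(+) n ` {y'\<in>?Y. y' < i}"] cEn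
      by (simp add: card_image)
    \<comment> \<open>The two exponents differ by the odd number \<open>2 (n - p) + 1\<close>. The
      resulting minus sign is what lets the contribution of the \<open>L\<^sub>i\<close> cancel
      against that of \<open>x\<^sub>j\<close>.\<close>
    moreover have "n + 1 + (n - ?p + ?s i) + 2 * ?p = 2 * n + 1 + (?p + ?s i)" using pn by simp
    then have "(-1 :: 'k) ^ (n + 1 + (n - ?p + ?s i)) = - ((-1) ^ (?p + ?s i))"
      by (rule minus_one_power_opposite)
    moreover have "U_minor n r u (\<Theta> \<union> {n + i}) = minor ?M ?X (?Y - {i})"
    proof -
      have "(\<Theta> \<union> {n + i}) \<inter> {1..n} = ?X" "{i'\<in>{1..r}. n + i' \<notin> \<Theta> \<union> {n + i}} = ?Y - {i}"
        using i by auto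
      then show ?thesis by (simp add: U_minor_def)
    qed
    ultimately show ?thesis
      using True i unfolding cramer_def by (simp add: mult_ac del: power_Suc)
  next
    case False
    then show ?thesis using i by (simp add: cramer_def)
  qed
  show ?thesis
    unfolding dependency_def
  proof
    fix j assume j: "j \<in> {1..n}"
    let ?S = "\<Sum>y\<in>?Y. (-1) ^ ?s y * u y j * minor ?M ?X (?Y - {y})"
    have "(\<Sum>i=1..r. cramer n r u \<Theta> (n + i) * u i j) =
        (\<Sum>y\<in>?Y. - ((-1) ^ (?p + ?s y) * u y j * minor ?M ?X (?Y - {y})))"
      by (rule sum.mono_neutral_cong_right) (auto simp: cr)
    also have "\<dots> = - ((-1) ^ ?p * ?S)"
      by (simp add: sum_distrib_left sum_negf power_add mult_ac)
    finally have sum: "(\<Sum>i=1..r. cramer n r u \<Theta> (n + i) * u i j) = - ((-1) ^ ?p * ?S)" .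
    show "cramer n r u \<Theta> j + (\<Sum>i=1..r. cramer n r u \<Theta> (n + i) * u i j) = 0"
    proof (cases "j \<in> \<Theta>")
      case True
      then have "?S = 0" using minor_laplace_repeated[OF fX fY cY, of j ?M] j by simp
      then show ?thesis unfolding sum using True by (simp add: cramer_def)
    next
      case False
      let ?q = "card {j'\<in>\<Theta>. j' < j}"
      have X: "(\<Theta> \<union> {j}) \<inter> {1..n} = insert j ?X" "{i\<in>{1..r}. n + i \<notin> \<Theta> \<union> {j}} = ?Y"
        using j by auto
      have q: "{x'\<in>insert j ?X. x' < j} = {j'\<in>\<Theta>. j' < j}" using j \<Theta>(1) by auto
      have "U_minor n r u (\<Theta> \<union> {j}) = minor ?M (insert j ?X) ?Y"
        unfolding U_minor_def X ..
      also have "\<dots> = (\<Sum>y\<in>?Y. (-1) ^ (?q + ?s y) * u y j * minor ?M (insert j ?X - {j}) (?Y - {y}))"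
        unfolding q[symmetric] using False cY by (intro minor_laplace) auto
      also have "insert j ?X - {j} = ?X" using False by auto
      finally have "U_minor n r u (\<Theta> \<union> {j}) = (-1) ^ ?q * ?S"
        by (simp add: sum_distrib_left power_add mult_ac)
      moreover have "(-1 :: 'k) ^ (?p + ?q) * ((-1) ^ ?q * ?S) = (-1) ^ ?p * ?S"
        by (simp add: power_add mult.assoc[symmetric])
      ultimately have "cramer n r u \<Theta> j = (-1) ^ ?p * ?S"
        using False j by (simp add: cramer_def mult_ac)
      then show ?thesis unfolding sum by simp
    qed
  qed
qed

text \<open>What has to be compared are the signs. For \<open>k\<^sub>i \<le> n\<close>, the
  difference \<open>k\<^sub>i - i\<close> is the number \<open>q\<close> of elements of \<Theta>
  below \<open>k\<^sub>i\<close>, and \<open>n - h\<close> is the number \<open>p\<close> of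
  elements of \<Theta> up to \<open>n\<close>, so \<alpha> is \<open>p - q\<close>, of the same
  parity as \<open>p + q\<close>. For \<open>k\<^sub>i > n\<close>, there are \<open>i - 1\<close>
  elements of the complement below \<open>k\<^sub>i\<close>, and both exponents are
  \<open>n + i\<close>.\<close>

lemma m_poly_eq_circuit_rel:
  fixes u :: "nat \<Rightarrow> nat \<Rightarrow> 'k::field"
  assumes \<Theta>: "\<Theta> \<subseteq> {1..n + r}" "card \<Theta> = r - 1" and r: "r \<ge> 1"
  shows "m_poly n r u \<Theta> = circuit_rel (cramer n r u \<Theta>) ({1..n + r} - \<Theta>)"
proof -
  let ?E = "{1..n + r} - \<Theta>"
  let ?k = "kth n r \<Theta>"
  have f\<Theta>: "finite \<Theta>" using \<Theta>(1) finite_subset by blast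
  have cE: "card ?E = n + 1" using card_Diff_subset[OF f\<Theta> \<Theta>(1)] \<Theta>(2) r by simp
  have "bij_betw (\<lambda>i. i - 1) {1..n + 1} {..<card ?E}"
    unfolding cE by (rule bij_betwI[of _ _ _ "\<lambda>i. i + 1"]) auto
  from bij_betw_trans[OF this bij_betw_sorted_nth[of ?E]]
  have bij: "bij_betw ?k {1..n + 1} ?E"
    by (simp add: kth_def[abs_def] o_def)
  have idx: "card {y\<in>?E. y < ?k i} = i - 1" if "i \<in> {1..n + 1}" for i
    unfolding kth_def using that cE by (intro card_less_sorted_nth) auto
  let ?p = "card (\<Theta> \<inter> {1..n})"
  have cEn: "card ({1..n} - \<Theta>) = n - ?p"
    using card_Diff_subset_Int[of "{1..n}" \<Theta>] by (simp add: Int_commute)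
  have "?k ` {j\<in>{1..n + 1}. ?k j \<le> n} = {1..n} - \<Theta>"
  proof (intro equalityI subsetI)
    fix x assume "x \<in> ?k ` {j\<in>{1..n + 1}. ?k j \<le> n}"
    then obtain j where "j \<in> {1..n + 1}" "x = ?k j" "?k j \<le> n" by blast
    moreover from this have "?k j \<in> ?E" using bij by (blast dest: bij_betw_apply)
    ultimately show "x \<in> {1..n} - \<Theta>" by auto
  next
    fix x assume x: "x \<in> {1..n} - \<Theta>"
    then have "x \<in> ?E" by auto
    then obtain j where "j \<in> {1..n + 1}" "x = ?k j"
      using bij by (metis bij_betw_iff_bijections)
    then show "x \<in> ?k ` {j\<in>{1..n + 1}. ?k j \<le> n}" using x by auto
  qed
  moreover have "inj_on ?k {j\<in>{1..n + 1}. ?k j \<le> n}"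
    using bij by (auto simp: bij_betw_def intro: inj_on_subset)
  ultimately have h: "card {j\<in>{1..n + 1}. ?k j \<le> n} = n - ?p"
    using card_image[of ?k "{j\<in>{1..n + 1}. ?k j \<le> n}"] cEn by simp
  have sgn: "(-1 :: 'k mpoly) ^ alpha n r \<Theta> i * mconst (U_minor n r u (\<Theta> \<union> {?k i})) =
      mconst (cramer n r u \<Theta> (?k i))" if i: "i \<in> {1..n + 1}" for i
  proof -
    have kE: "?k i \<in> ?E" using bij i by (auto simp: bij_betw_def)
    have "mconst (cramer n r u \<Theta> (?k i)) =
      (-1) ^ (if ?k i \<le> n then ?p + card {j\<in>\<Theta>. j < ?k i} else n + 1 + (i - 1)) *
      mconst (U_minor n r u (\<Theta> \<union> {?k i}))"
      using kE idx[OF i] by (auto simp: cramer_def mconst.hom_mult mconst.hom_power mconst.hom_uminus)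
    also have "(-1 :: 'k mpoly) ^ (if ?k i \<le> n then ?p + card {j\<in>\<Theta>. j < ?k i} else n + 1 + (i - 1)) =
      (-1) ^ alpha n r \<Theta> i"
    proof (cases "?k i \<le> n")
      case True
      let ?q = "card {j\<in>\<Theta>. j < ?k i}"
      have "{1..<?k i} = {y\<in>?E. y < ?k i} \<union> {j\<in>\<Theta>. j < ?k i}"
        using kE \<Theta>(1) by auto
      moreover have "{y\<in>?E. y < ?k i} \<inter> {j\<in>\<Theta>. j < ?k i} = {}" by auto
      ultimately have "card {1..<?k i} = i - 1 + ?q"
        using card_Un_disjoint[of "{y\<in>?E. y < ?k i}" "{j\<in>\<Theta>. j < ?k i}"] idx[OF i] f\<Theta> by simp
      then have ki: "?k i = i + ?q" using i kE by auto
      have qp: "?q \<le> ?p" using True \<Theta>(1) by (intro card_mono) auto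
      have pn: "?p \<le> n" using card_mono[of "{1..n}" "\<Theta> \<inter> {1..n}"] by simp
      have "{y\<in>?E. y < ?k i} \<subseteq> {1..n} - \<Theta>" "?k i \<in> {1..n} - \<Theta>" using True kE by auto
      then have "{y\<in>?E. y < ?k i} \<subset> {1..n} - \<Theta>" by blast
      then have "i - 1 < n - ?p"
        using psubset_card_mono[of "{1..n} - \<Theta>" "{y\<in>?E. y < ?k i}"] idx[OF i] cEn by simp
      then have "alpha n r \<Theta> i = n - (n - ?p) + i - ?k i"
        unfolding alpha_def Let_def h using i by auto
      then have "alpha n r \<Theta> i = ?p - ?q" using ki pn by simp
      moreover have "even (?p - ?q) \<longleftrightarrow> even (?p + ?q)"
        unfolding even_diff_nat using qp by linarith
      ultimately show ?thesis using True by (simp only: minus_one_power_iff if_True)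
    next
      case False
      have "{1..n} - \<Theta> \<subseteq> {y\<in>?E. y < ?k i}" using False by auto
      then have "n - ?p \<le> i - 1"
        using card_mono[of "{y\<in>?E. y < ?k i}" "{1..n} - \<Theta>"] idx[OF i] cEn by simp
      then have "alpha n r \<Theta> i = n + i"
        unfolding alpha_def Let_def h using i by auto
      then show ?thesis using False i by simp
    qed
    finally show ?thesis ..
  qed
  have "m_poly n r u \<Theta> = (\<Sum>i=1..n + 1. mconst (cramer n r u \<Theta> (?k i)) *
      (\<Prod>j\<in>{1..n + 1} - {i}. mvar (?k j)))"
    unfolding m_poly_def by (rule sum.cong) (simp_all only: sgn[symmetric] mult_ac)
  also have "\<dots> = (\<Sum>i=1..n + 1. mconst (cramer n r u \<Theta> (?k i)) * (\<Prod>j\<in>?E - {?k i}. mvar j))"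
  proof (intro sum.cong refl arg_cong[where f = "(*) _"])
    fix i assume i: "i \<in> {1..n + 1}"
    have "bij_betw ?k ({1..n + 1} - {i}) (?E - {?k i})"
      using bij i by (intro bij_betw_DiffI) (auto simp: bij_betw_def)
    then show "(\<Prod>j\<in>{1..n + 1} - {i}. mvar (?k j)) = (\<Prod>j\<in>?E - {?k i}. mvar j :: 'k mpoly)"
      by (rule prod.reindex_bij_betw)
  qed
  also have "\<dots> = circuit_rel (cramer n r u \<Theta>) ?E"
    unfolding circuit_rel_def by (rule sum.reindex_bij_betw[OF bij])
  finally show ?thesis .
qed

text \<open>An index with coefficient 0 adds no term but puts its variable as a common factor into
  all others. This is precisely how \<open>m\<^sub>\<Theta>\<close> differs from
  \<open>h\<^sub>\<Theta>\<close>.\<close>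

lemma circuit_rel_extend:
  assumes "finite C'" "C \<subseteq> C'" "\<And>i. i \<in> C' - C \<Longrightarrow> a i = 0"
  shows "circuit_rel a C' = (\<Prod>j\<in>C' - C. mvar j) * circuit_rel a C"
proof -
  have "circuit_rel a C' = (\<Sum>i\<in>C. mconst (a i) * (\<Prod>j\<in>C' - {i}. mvar j))"
    unfolding circuit_rel_def by (rule sum.mono_neutral_right) (use assms in auto)
  also have "\<dots> = (\<Sum>i\<in>C. mconst (a i) * ((\<Prod>j\<in>C' - C. mvar j) * (\<Prod>j\<in>C - {i}. mvar j)))"
  proof (intro sum.cong refl arg_cong[where f = "(*) _"])
    fix i assume "i \<in> C"
    then have "C' - {i} = (C' - C) \<union> (C - {i})" using assms(2) by auto
    then show "(\<Prod>j\<in>C' - {i}. mvar j) = (\<Prod>j\<in>C' - C. mvar j) * (\<Prod>j\<in>C - {i}. mvar j :: 'a mpoly)"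
      using assms(1) finite_subset[OF assms(2,1)]
      by (simp add: prod.union_disjoint[symmetric] Diff_Int_distrib)
        (subst prod.union_disjoint, auto)
  qed
  also have "\<dots> = (\<Prod>j\<in>C' - C. mvar j) * circuit_rel a C"
    by (simp add: circuit_rel_def sum_distrib_left mult_ac)
  finally show ?thesis .
qed

lemma circuit_rel_scaled_diff:
  "circuit_rel (\<lambda>k. a k - c * b k) C = circuit_rel a C - mconst c * circuit_rel b C"
  unfolding circuit_rel_def
  by (simp add: mconst.hom_minus mconst.hom_mult sum_distrib_left sum_subtractf algebra_simps)

text \<open>The indices outside \<Theta> that are missing here are those whose variables are divided
  out of \<open>m\<^sub>\<Theta>\<close> to obtain \<open>h\<^sub>\<Theta>\<close>.\<close>

definition cramer_support :: "nat \<Rightarrow> nat \<Rightarrow> (nat \<Rightarrow> nat \<Rightarrow> 'k::field) \<Rightarrow> nat set \<Rightarrow> nat set" where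
  "cramer_support n r u \<Theta> = {k \<in> {1..n + r}. cramer n r u \<Theta> k \<noteq> 0}"

lemma cramer_support_iff:
  "k \<in> cramer_support n r u \<Theta> \<longleftrightarrow> k \<in> {1..n + r} - \<Theta> \<and> U_minor n r u (\<Theta> \<union> {k}) \<noteq> 0"
  by (auto simp: cramer_support_def cramer_def)

lemma m_poly_eq:
  fixes u :: "nat \<Rightarrow> nat \<Rightarrow> 'k::field"
  assumes \<Theta>: "\<Theta> \<subseteq> {1..n + r}" "card \<Theta> = r - 1" and r: "r \<ge> 1"
  shows "m_poly n r u \<Theta> = (\<Prod>j\<in>({1..n + r} - \<Theta>) - cramer_support n r u \<Theta>. mvar j) *
    circuit_rel (cramer n r u \<Theta>) (cramer_support n r u \<Theta>)"
  unfolding m_poly_eq_circuit_rel[OF \<Theta> r]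
  by (rule circuit_rel_extend) (auto simp: cramer_support_def cramer_def)

lemma h_poly_eq:
  fixes u :: "nat \<Rightarrow> nat \<Rightarrow> 'k::field"
  assumes \<Theta>: "\<Theta> \<subseteq> {1..n + r}" "card \<Theta> = r - 1" and r: "r \<ge> 1"
  shows "h_poly n r u \<Theta> = circuit_rel (cramer n r u \<Theta>) (cramer_support n r u \<Theta>)"
proof -
  let ?D = "{k\<in>{1..n + r} - \<Theta>. U_minor n r u (\<Theta> \<union> {k}) = 0}"
  have D: "?D = ({1..n + r} - \<Theta>) - cramer_support n r u \<Theta>"
    by (auto simp only: cramer_support_iff Diff_iff mem_Collect_eq)
  have nz: "(\<Prod>j\<in>?D. mvar j) \<noteq> (0 :: 'k mpoly)" by simp
  show ?thesis
  proof (cases "m_poly n r u \<Theta> = 0")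
    case True
    then show ?thesis
      using m_poly_eq[OF \<Theta> r, of u] nz unfolding D h_poly_def by simp
  next
    case False
    then have "h_poly n r u \<Theta> = (THE q. q * (\<Prod>k\<in>?D. mvar k) = m_poly n r u \<Theta>)"
      unfolding h_poly_def by simp
    also have "\<dots> = circuit_rel (cramer n r u \<Theta>) (cramer_support n r u \<Theta>)"
    proof (rule the_equality)
      show *: "circuit_rel (cramer n r u \<Theta>) (cramer_support n r u \<Theta>) * (\<Prod>k\<in>?D. mvar k) = m_poly n r u \<Theta>"
        unfolding m_poly_eq[OF \<Theta> r] D by (rule mult.commute)
      fix q assume "q * (\<Prod>k\<in>?D. mvar k) = m_poly n r u \<Theta>"
      then show "q = circuit_rel (cramer n r u \<Theta>) (cramer_support n r u \<Theta>)"
        unfolding *[symmetric] using nz by (simp only: mult_cancel_right) simp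
    qed
    finally show ?thesis .
  qed
qed

text \<open>Subtract from \<open>a\<close> the multiple of the Cramer dependency with the same
  coefficient at \<open>k\<close>. The difference vanishes on \<open>\<Theta> \<union> {k}\<close>,
  whose minor is nonzero, hence everywhere.\<close>

lemma dependency_unique:
  fixes u :: "nat \<Rightarrow> nat \<Rightarrow> 'k::field"
  assumes \<Theta>: "\<Theta> \<subseteq> {1..n + r}" "card \<Theta> = r - 1" and r: "r \<ge> 1"
    and k: "k \<in> cramer_support n r u \<Theta>"
    and a: "dependency n r u a" "\<And>j. j \<in> \<Theta> \<Longrightarrow> a j = 0" and j: "j \<in> {1..n + r}"
  shows "a j = a k / cramer n r u \<Theta> k * cramer n r u \<Theta> j"
proof -
  let ?c = "a k / cramer n r u \<Theta> k"
  have f\<Theta>: "finite \<Theta>" using \<Theta>(1) finite_subset by blast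
  have k': "k \<in> {1..n + r}" "k \<notin> \<Theta>" "U_minor n r u (\<Theta> \<union> {k}) \<noteq> 0"
    using k unfolding cramer_support_iff by auto
  have ck: "cramer n r u \<Theta> k \<noteq> 0" using k by (simp add: cramer_support_def)
  have "a j - ?c * cramer n r u \<Theta> j = 0"
  proof (rule U_minor_neq_0_dependency[OF _ _ k'(3) dependency_scaled_diff[OF a(1) dependency_cramer[OF \<Theta> r]] _ j])
    show "\<Theta> \<union> {k} \<subseteq> {1..n + r}" "card (\<Theta> \<union> {k}) = r" using \<Theta> k' r f\<Theta> by auto
    fix i assume "i \<in> \<Theta> \<union> {k}"
    then show "a i - ?c * cramer n r u \<Theta> i = 0"
      using a(2) ck by (auto simp: cramer_def)
  qed
  then show ?thesis by simp
qed

section \<open>The circuit relations generate the same ideal as the \<open>h\<^sub>\<Theta>\<close>\<close>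

text \<open>The vector space over \<open>K\<close> in which the forms live, so that extension to
  bases and equality of their cardinalities are available.\<close>

global_interpretation mpoly_vs: vector_space "\<lambda>c p :: 'k::field mpoly. mconst c * p"
  by unfold_locales (simp_all add: mconst.hom_add mconst.hom_mult algebra_simps)

text \<open>Independence is a notion for sets of vectors; injectivity transfers coefficient
  functions between forms and indices.\<close>

lemma independent_F_iff:
  fixes u :: "nat \<Rightarrow> nat \<Rightarrow> 'k::field"
  assumes inj: "inj_on (F n u) {1..n + r}" and Z: "Z \<subseteq> {1..n + r}"
  shows "mpoly_vs.independent (F n u ` Z) \<longleftrightarrow>
    (\<forall>a. dependency n r u a \<longrightarrow> (\<forall>k\<in>{1..n + r} - Z. a k = 0) \<longrightarrow> (\<forall>k\<in>Z. a k = 0))"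
proof -
  have injZ: "inj_on (F n u) Z" using inj Z by (rule inj_on_subset)
  have fZ: "finite Z" using Z finite_subset by blast
  have ext: "(\<Sum>k\<in>Z. mconst (a k) * F n u k) = (\<Sum>k=1..n + r. mconst (a k) * F n u k)"
    if "\<forall>k\<in>{1..n + r} - Z. a k = 0" for a
    by (rule sum.mono_neutral_left) (use that Z in auto)
  show ?thesis
  proof
    assume ind: "mpoly_vs.independent (F n u ` Z)"
    show "\<forall>a. dependency n r u a \<longrightarrow> (\<forall>k\<in>{1..n + r} - Z. a k = 0) \<longrightarrow> (\<forall>k\<in>Z. a k = 0)"
    proof (intro allI impI ballI, rule ccontr)
      fix a k assume a: "dependency n r u a" "\<forall>k\<in>{1..n + r} - Z. a k = 0" and k: "k \<in> Z" "a k \<noteq> 0"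
      define w where "w v = a (the_inv_into Z (F n u) v)" for v
      have w: "w (F n u k) = a k" if "k \<in> Z" for k
        using that by (simp add: w_def the_inv_into_f_f[OF injZ])
      have "(\<Sum>v\<in>F n u ` Z. mconst (w v) * v) = (\<Sum>k\<in>Z. mconst (a k) * F n u k)"
        by (simp add: sum.reindex[OF injZ] w)
      also have "\<dots> = 0" using a ext[OF a(2)] by (simp add: dependency_iff)
      finally have "(\<Sum>v\<in>F n u ` Z. mconst (w v) * v) = 0" .
      moreover have "\<exists>v\<in>F n u ` Z. w v \<noteq> 0" using k w by auto
      ultimately show False
        using ind mpoly_vs.dependent_finite[OF finite_imageI[OF fZ], of "F n u"] by blast
    qed
  next
    assume *: "\<forall>a. dependency n r u a \<longrightarrow> (\<forall>k\<in>{1..n + r} - Z. a k = 0) \<longrightarrow> (\<forall>k\<in>Z. a k = 0)"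
    show "mpoly_vs.independent (F n u ` Z)"
    proof
      assume "mpoly_vs.dependent (F n u ` Z)"
      then obtain w k where w: "k \<in> Z" "w (F n u k) \<noteq> 0" "(\<Sum>v\<in>F n u ` Z. mconst (w v) * v) = 0"
        using mpoly_vs.dependent_finite[OF finite_imageI[OF fZ], of "F n u"] by blast
      define a where "a k = (if k \<in> Z then w (F n u k) else 0)" for k
      have "(\<Sum>k=1..n + r. mconst (a k) * F n u k) = (\<Sum>k\<in>Z. mconst (a k) * F n u k)"
        by (rule ext[symmetric]) (auto simp: a_def)
      also have "\<dots> = (\<Sum>k\<in>Z. mconst (w (F n u k)) * F n u k)"
        by (rule sum.cong) (auto simp: a_def)
      also have "\<dots> = 0" using w(3) by (simp add: sum.reindex[OF injZ])
      finally have "dependency n r u a" by (simp add: dependency_iff)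
      moreover have "\<forall>k\<in>{1..n + r} - Z. a k = 0" by (simp add: a_def)
      ultimately have "a k = 0" using * w(1) by blast
      then show False using w by (simp add: a_def)
    qed
  qed
qed

text \<open>
  A dependency of minimal support is given by Cramer's rule: extend its support without \<open>c\<close> to a
  basis \<open>Z\<close> and take for \<open>\<Theta>\<close> the complement of \<open>Z \<union> {c}\<close>.
\<close>

lemma minimal_dependency_cramer:
  fixes u :: "nat \<Rightarrow> nat \<Rightarrow> 'k::field"
  assumes inj: "inj_on (F n u) {1..n + r}" and r: "r \<ge> 1"
    and a: "dependency n r u a" and c: "c \<in> {1..n + r}" "a c \<noteq> 0"
    and min: "\<And>b. dependency n r u b \<Longrightarrow> {k\<in>{1..n + r}. b k \<noteq> 0} \<subset> {k\<in>{1..n + r}. a k \<noteq> 0} \<Longrightarrow>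
      {k\<in>{1..n + r}. b k \<noteq> 0} = {}"
  obtains \<Theta> where "\<Theta> \<subseteq> {1..n + r}" "card \<Theta> = r - 1" "\<And>j. j \<in> \<Theta> \<Longrightarrow> a j = 0"
    "c \<in> cramer_support n r u \<Theta>"
proof -
  let ?t = "{1..n + r}" and ?F = "F n u"
  let ?S = "{k\<in>?t. a k \<noteq> 0}"
  \<comment> \<open>By minimality: a nontrivial dependency on the support without \<open>c\<close>
    would have a strictly smaller nonempty support.\<close>
  have "mpoly_vs.independent (?F ` (?S - {c}))"
  proof (rule iffD2[OF independent_F_iff[OF inj]])
    show "\<forall>b. dependency n r u b \<longrightarrow> (\<forall>k\<in>?t - (?S - {c}). b k = 0) \<longrightarrow> (\<forall>k\<in>?S - {c}. b k = 0)"
    proof (intro allI impI)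
      fix b assume b: "dependency n r u b" "\<forall>k\<in>?t - (?S - {c}). b k = 0"
      then have "{k\<in>?t. b k \<noteq> 0} \<subseteq> ?S - {c}" by blast
      then have "{k\<in>?t. b k \<noteq> 0} \<subset> ?S" using c by blast
      from min[OF b(1) this] show "\<forall>k\<in>?S - {c}. b k = 0" by blast
    qed
  qed blast
  then obtain B where B: "?F ` (?S - {c}) \<subseteq> B" "B \<subseteq> ?F ` ?t" "mpoly_vs.independent B"
    "?F ` ?t \<subseteq> mpoly_vs.span B"
    using mpoly_vs.maximal_independent_subset_extend[of "?F ` (?S - {c})" "?F ` ?t"] by blast
  define Z where "Z = {k\<in>?t. ?F k \<in> B}"
  have BZ: "B = ?F ` Z" using B(2) by (auto simp: Z_def)
  have Zt: "Z \<subseteq> ?t" by (auto simp: Z_def)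
  have SZ: "?S - {c} \<subseteq> Z" using B(1) by (auto simp: Z_def)
  have indZ: "\<forall>k\<in>Z. b k = 0" if "dependency n r u b" "\<forall>k\<in>?t - Z. b k = 0" for b
    using B(3) that unfolding BZ independent_F_iff[OF inj Zt] by blast
  have cZ: "c \<notin> Z"
  proof
    assume "c \<in> Z"
    then have "\<forall>k\<in>?t - Z. a k = 0" using SZ by blast
    from indZ[OF a this] show False using \<open>c \<in> Z\<close> c by blast
  qed
  \<comment> \<open>\<open>B\<close> and the variables \<open>x\<^sub>1, \<dots>, x\<^sub>n\<close>
    are bases of the same space of linear forms. The value \<open>n\<close> is what gives \<Theta>
    the size \<open>n + r - (n + 1) = r - 1\<close>.\<close>
  have "card B = n"
  proof -
    let ?X = "?F ` {1..n}"
    have "mpoly_vs.independent ?X"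
    proof (rule iffD2[OF independent_F_iff[OF inj]])
      show "\<forall>b. dependency n r u b \<longrightarrow> (\<forall>k\<in>?t - {1..n}. b k = 0) \<longrightarrow> (\<forall>k\<in>{1..n}. b k = 0)"
      proof (intro allI impI ballI)
        fix b k assume b: "dependency n r u b" "\<forall>k\<in>?t - {1..n}. b k = 0" and k: "k \<in> {1..n}"
        have "(\<Sum>i=1..r. b (n + i) * u i k) = 0"
          using b(2) by (intro sum.neutral) auto
        moreover have "b k + (\<Sum>i=1..r. b (n + i) * u i k) = 0"
          using b(1) k unfolding dependency_def by blast
        ultimately show "b k = 0" by simp
      qed
    qed auto
    moreover have "mpoly_vs.span B = mpoly_vs.span ?X"
    proof (rule antisym)
      have "?F k \<in> mpoly_vs.span ?X" if "k \<in> ?t" for k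
      proof (cases "k \<le> n")
        case True
        then show ?thesis using that by (intro mpoly_vs.span_base) auto
      next
        case False
        have "mconst (u (k - n) j) * mvar j \<in> mpoly_vs.span ?X" if "j \<in> {1..n}" for j
          using that mpoly_vs.span_scale[OF mpoly_vs.span_base, of "?F j" ?X "u (k - n) j"]
          by (auto simp: F_def)
        then show ?thesis using False by (auto simp: F_def intro: mpoly_vs.span_sum)
      qed
      then show "mpoly_vs.span B \<subseteq> mpoly_vs.span ?X"
        using B(2) by (intro mpoly_vs.span_minimal) (auto simp: mpoly_vs.subspace_span)
      show "mpoly_vs.span ?X \<subseteq> mpoly_vs.span B"
        using B(4) by (intro mpoly_vs.span_minimal) (auto simp: mpoly_vs.subspace_span)
    qed
    ultimately obtain f where "bij_betw f B ?X"
      using mpoly_vs.bij_if_span_eq_span_bases[OF B(3)] by blast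
    then have "card B = card ?X" by (rule bij_betw_same_card)
    also have "\<dots> = n"
      by (subst card_image) (auto intro: inj_on_subset[OF inj])
    finally show ?thesis .
  qed
  then have cardZ: "card Z = n"
    unfolding BZ by (subst (asm) card_image) (auto intro: inj_on_subset[OF inj Zt])
  have fZ: "finite Z" using Zt finite_subset by blast
  define \<Theta> where "\<Theta> = ?t - insert c Z"
  have "card \<Theta> = card ?t - card (insert c Z)"
    unfolding \<Theta>_def using fZ Zt c by (intro card_Diff_subset) auto
  then have card\<Theta>: "card \<Theta> = r - 1" using cZ fZ cardZ by simp
  have \<Theta>c: "\<Theta> \<union> {c} = ?t - Z" using c cZ by (auto simp: \<Theta>_def)
  have card\<chi>: "card (\<Theta> \<union> {c}) = r"
    unfolding \<Theta>c using card_Diff_subset[OF fZ Zt] cardZ by simp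
  have "U_minor n r u (\<Theta> \<union> {c}) \<noteq> 0"
  proof
    assume "U_minor n r u (\<Theta> \<union> {c}) = 0"
    then obtain b k where b: "dependency n r u b" "k \<in> ?t" "b k \<noteq> 0" "\<And>k. k \<in> ?t - Z \<Longrightarrow> b k = 0"
      using U_minor_eq_0_dependency[of "\<Theta> \<union> {c}" n r u] card\<chi> unfolding \<Theta>c by blast
    then show False using indZ[OF b(1)] by blast
  qed
  then have "c \<in> cramer_support n r u \<Theta>"
    unfolding cramer_support_iff using c by (auto simp: \<Theta>_def)
  moreover have "a j = 0" if "j \<in> \<Theta>" for j using that SZ by (auto simp: \<Theta>_def)
  ultimately show ?thesis using that[of \<Theta>] card\<Theta> by (auto simp: \<Theta>_def)
qed

definition h_polys :: "nat \<Rightarrow> nat \<Rightarrow> (nat \<Rightarrow> nat \<Rightarrow> 'k::field) \<Rightarrow> 'k mpoly set" where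
  "h_polys n r u = {h_poly n r u \<Theta> | \<Theta>. \<Theta> \<subseteq> {1..n + r} \<and> card \<Theta> = r - 1}"

text \<open>The set \<open>C\<close> is kept fixed and may exceed the support, so that the relation
  is linear in \<open>a\<close> and induction on the size of the support applies. If a dependency
  \<open>b\<close> has smaller nonempty support, then \<open>a\<close> is a multiple of
  \<open>b\<close> plus a dependency in which an index of \<open>b\<close> is cancelled, and both
  have smaller support. If the support is minimal, \<open>a\<close> is a multiple of a Cramer
  dependency, and enlarging its support to \<open>C\<close> multiplies
  \<open>h\<^sub>\<Theta>\<close> by variables.\<close>

lemma circuit_rel_in_h_ideal:
  fixes u :: "nat \<Rightarrow> nat \<Rightarrow> 'k::field"
  assumes inj: "inj_on (F n u) {1..n + r}" and r: "r \<ge> 1"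
    and C: "C \<subseteq> {1..n + r}" and a: "dependency n r u a" "\<And>k. k \<in> {1..n + r} - C \<Longrightarrow> a k = 0"
  shows "circuit_rel a C \<in> gen_ideal (mpolys UNIV {1..n + r}) (h_polys n r u)"
  using a
proof (induction "card {k\<in>{1..n + r}. a k \<noteq> 0}" arbitrary: a rule: less_induct)
  case less
  let ?t = "{1..n + r}"
  let ?N = "gen_ideal (mpolys UNIV ?t) (h_polys n r u)"
  let ?supp = "\<lambda>a :: nat \<Rightarrow> 'k. {k\<in>?t. a k \<noteq> 0}"
  have S: "subring_set (mpolys UNIV ?t :: 'k mpoly set)" by (rule subring_set_mpolys) simp
  have fC: "finite C" using C finite_subset by blast
  have supp: "?supp a \<subseteq> C" using less.prems(2) by blast
  show ?case
  proof (cases "?supp a = {}")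
    case True
    then have "circuit_rel a C = 0"
      using C unfolding circuit_rel_def by (intro sum.neutral) auto
    then show ?thesis by (simp add: gen_ideal.zero)
  next
    case False
    then obtain c where c: "c \<in> ?t" "a c \<noteq> 0" by blast
    show ?thesis
    proof (cases "\<exists>b. dependency n r u b \<and> ?supp b \<subset> ?supp a \<and> ?supp b \<noteq> {}")
      case True
      then obtain b i where b: "dependency n r u b" "?supp b \<subset> ?supp a" and i: "i \<in> ?t" "b i \<noteq> 0"
        by blast
      let ?e = "\<lambda>k. a k - a i / b i * b k"
      have fin: "finite (?supp a)" by simp
      have "k \<in> ?supp a - {i}" if "k \<in> ?supp ?e" for k
      proof -
        have "k \<noteq> i" using that i(2) by auto
        moreover have "a k \<noteq> 0 \<or> b k \<noteq> 0" using that by auto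
        ultimately show ?thesis using that b(2) by blast
      qed
      moreover have "i \<in> ?supp a" using b(2) i by blast
      ultimately have "?supp ?e \<subset> ?supp a" by blast
      then have "circuit_rel ?e C \<in> ?N"
        using supp b(2) psubset_card_mono[OF fin]
        by (intro less.hyps dependency_scaled_diff less.prems b(1)) auto
      moreover have "circuit_rel b C \<in> ?N"
        using supp b psubset_card_mono[OF fin b(2)] by (intro less.hyps) auto
      then have "mconst (a i / b i) * circuit_rel b C \<in> ?N"
        by (intro gen_ideal_mult[OF S] mconst_in_mpolys) auto
      ultimately have "circuit_rel ?e C + mconst (a i / b i) * circuit_rel b C \<in> ?N"
        by (rule gen_ideal_add)
      then show ?thesis unfolding circuit_rel_scaled_diff by simp
    next
      case min: False
      obtain \<Theta> where \<Theta>: "\<Theta> \<subseteq> ?t" "card \<Theta> = r - 1" "\<And>j. j \<in> \<Theta> \<Longrightarrow> a j = 0"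
        "c \<in> cramer_support n r u \<Theta>"
        using minimal_dependency_cramer[OF inj r less.prems(1) c] min by blast
      let ?C = "cramer_support n r u \<Theta>" and ?\<delta> = "cramer n r u \<Theta>"
      let ?b = "a c / ?\<delta> c"
      have a: "a j = ?b * ?\<delta> j" if "j \<in> ?t" for j
        by (rule dependency_unique[OF \<Theta>(1,2) r \<Theta>(4) less.prems(1) \<Theta>(3) that])
      have "?\<delta> c \<noteq> 0" using \<Theta>(4) by (simp add: cramer_support_def)
      then have "?C = ?supp a" using a c(2) by (auto simp: cramer_support_def)
      then have C': "?C \<subseteq> C" "\<And>i. i \<in> C - ?C \<Longrightarrow> a i = 0" using supp C by auto
      have "circuit_rel a ?C = mconst ?b * circuit_rel ?\<delta> ?C"
        unfolding circuit_rel_def sum_distrib_left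
        by (rule sum.cong) (auto simp: a cramer_support_def mconst.hom_mult mult.assoc)
      also have "circuit_rel ?\<delta> ?C = h_poly n r u \<Theta>" by (rule h_poly_eq[OF \<Theta>(1,2) r, symmetric])
      finally have "circuit_rel a C = ((\<Prod>j\<in>C - ?C. mvar j) * mconst ?b) * h_poly n r u \<Theta>"
        using circuit_rel_extend[OF fC C'] by (simp add: mult.assoc)
      also have "\<dots> \<in> ?N"
        using \<Theta>(1,2) C
        by (intro gen_ideal_mult_gen subring_setD(6)[OF S] subring_set_prod[OF S])
           (auto simp: h_polys_def intro!: mconst_in_mpolys mvar_in_mpolys)
      finally show ?thesis .
    qed
  qed
qed

section \<open>The defining ideal of the Rees algebra\<close>

lemma gen_ideal_Un:
  "gen_ideal A (G \<union> H) = {x + y | x y. x \<in> gen_ideal A G \<and> y \<in> gen_ideal A H}"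
proof
  show "gen_ideal A (G \<union> H) \<subseteq> {x + y | x y. x \<in> gen_ideal A G \<and> y \<in> gen_ideal A H}"
  proof (rule gen_ideal_subset)
    show "0 \<in> {x + y | x y. x \<in> gen_ideal A G \<and> y \<in> gen_ideal A H}"
      using gen_ideal.zero[of A G] gen_ideal.zero[of A H] by force
  next
    fix a b assume "a \<in> {x + y | x y. x \<in> gen_ideal A G \<and> y \<in> gen_ideal A H}"
      "b \<in> {x + y | x y. x \<in> gen_ideal A G \<and> y \<in> gen_ideal A H}"
    then obtain x y x' y' where "a = x + y" "b = x' + y'" "x \<in> gen_ideal A G" "x' \<in> gen_ideal A G"
      "y \<in> gen_ideal A H" "y' \<in> gen_ideal A H" by blast
    then have "a + b = (x + x') + (y + y')" "x + x' \<in> gen_ideal A G" "y + y' \<in> gen_ideal A H"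
      by (auto intro: gen_ideal_add)
    then show "a + b \<in> {x + y | x y. x \<in> gen_ideal A G \<and> y \<in> gen_ideal A H}" by blast
  next
    fix c s assume c: "c \<in> A" "s \<in> G \<union> H"
    have "c * s = c * s + 0" "c * s = 0 + c * s" by simp_all
    then show "c * s \<in> {x + y | x y. x \<in> gen_ideal A G \<and> y \<in> gen_ideal A H}"
      using c gen_ideal.zero[of A G] gen_ideal.zero[of A H] gen_ideal_mult_gen[of c A s] by blast
  qed
  show "{x + y | x y. x \<in> gen_ideal A G \<and> y \<in> gen_ideal A H} \<subseteq> gen_ideal A (G \<union> H)"
    using gen_ideal_mono[of A A G "G \<union> H"] gen_ideal_mono[of A A H "G \<union> H"]
    by (blast intro: gen_ideal_add)
qed

lemma KT_to_S_eq: "KT_to_S p = mpoly_eval (\<lambda>c. mconst (mconst c)) mvar p"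
proof (rule poly_mapping_eqI)
  fix e
  have "mpoly_eval (\<lambda>c. mconst (mconst c)) mvar p =
      (\<Sum>e\<in>keys p. Poly_Mapping.single e (mconst (lookup p e)))"
    by (simp add: mpoly_eval_def single_eq_mconst_mon_eval)
  then have "lookup (mpoly_eval (\<lambda>c. mconst (mconst c)) mvar p) e =
      (\<Sum>e'\<in>keys p. if e' = e then mconst (lookup p e) else 0)"
    by (simp add: lookup_sum lookup_single when_def)
  also have "\<dots> = mconst (lookup p e)" by (simp add: in_keys_iff)
  finally show "lookup (KT_to_S p) e = lookup (mpoly_eval (\<lambda>c. mconst (mconst c)) mvar p) e"
    by (simp add: KT_to_S_def Poly_Mapping.map.rep_eq when_def)
qed

lemma comm_ring_hom_mconst2: "comm_ring_hom (\<lambda>c. mconst (mconst c))"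
  by (rule comm_ring_hom_comp[OF comm_ring_hom_mconst comm_ring_hom_mconst])

lemma KT_to_S_hom: "comm_ring_hom KT_to_S"
  unfolding KT_to_S_eq[abs_def] by (rule comm_ring_hom.mpoly_eval_hom[OF comm_ring_hom_mconst2])

lemma KT_to_S_mconst [simp]: "KT_to_S (mconst c) = mconst (mconst c)"
  unfolding KT_to_S_eq by (rule comm_ring_hom.mpoly_eval_mconst[OF comm_ring_hom_mconst2])

lemma KT_to_S_mvar [simp]: "KT_to_S (mvar i) = mvar i"
  unfolding KT_to_S_eq by (rule comm_ring_hom.mpoly_eval_mvar[OF comm_ring_hom_mconst2])

lemma KT_to_S_circuit_rel: "KT_to_S (circuit_rel a C) = circuit_rel (\<lambda>i. mconst (a i)) C"
  by (rule circuit_rel_hom[OF KT_to_S_hom]) simp_all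

lemma rees_map_eq: "rees_map n r u = ext_rees_map (F n u) (n + r)"
  unfolding rees_map_def[abs_def] ext_rees_map_def mpoly_eval_def mon_eval_def g_def ..

definition circuit_rels :: "nat \<Rightarrow> nat \<Rightarrow> (nat \<Rightarrow> nat \<Rightarrow> 'k::field) \<Rightarrow> 'k mpoly set" where
  "circuit_rels n r u = {circuit_rel a C | a C. C \<subseteq> {1..n + r} \<and> (\<forall>i\<in>C. a i \<noteq> 0) \<and>
    (\<Sum>i\<in>C. mconst (a i) * F n u i) = 0}"

lemma h_polys_subset_circuit_rels:
  fixes u :: "nat \<Rightarrow> nat \<Rightarrow> 'k::field"
  assumes r: "r \<ge> 1" shows "h_polys n r u \<subseteq> circuit_rels n r u"
proof
  fix s assume "s \<in> h_polys n r u"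
  then obtain \<Theta> where \<Theta>: "\<Theta> \<subseteq> {1..n + r}" "card \<Theta> = r - 1" and s: "s = h_poly n r u \<Theta>"
    unfolding h_polys_def by blast
  let ?C = "cramer_support n r u \<Theta>" and ?a = "cramer n r u \<Theta>"
  have "(\<Sum>i\<in>?C. mconst (?a i) * F n u i) = (\<Sum>i=1..n + r. mconst (?a i) * F n u i)"
    by (rule sum.mono_neutral_left) (auto simp: cramer_support_def)
  also have "\<dots> = 0" using dependency_cramer[OF \<Theta> r] by (simp add: dependency_iff)
  finally show "s \<in> circuit_rels n r u"
    unfolding s h_poly_eq[OF \<Theta> r] circuit_rels_def
    by (intro CollectI exI conjI) (auto simp: cramer_support_def)
qed

lemma circuit_rels_in_mpolys: "circuit_rels n r u \<subseteq> mpolys UNIV {1..n + r}"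
  unfolding circuit_rels_def by (auto intro!: circuit_rel_in_mpolys)

lemma F_in_mpolys: "i \<in> {1..n + r} \<Longrightarrow> F n u i \<in> mpolys UNIV {1..n}"
  unfolding F_def by (auto intro!: mvar_in_mpolys mpolys_sum mpolys_mult mconst_in_mpolys)

text \<open>The properties drawn from regularity in \<open>star_of_regular_triples\<close>: nonzero
  forms keep the images of monomials under the Rees map nonzero, and distinct forms let independence
  be read off index sets.\<close>

locale star =
  fixes n r :: nat and u :: "nat \<Rightarrow> nat \<Rightarrow> 'k::field"
  assumes r: "r \<ge> 1"
    and F_nonzero: "\<And>i. i \<in> {1..n + r} \<Longrightarrow> F n u i \<noteq> 0"
    and F_inj: "inj_on (F n u) {1..n + r}"
begin

abbreviation t where "t \<equiv> n + r"
abbreviation KT :: "'k mpoly set" where "KT \<equiv> mpolys UNIV {1..t}"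
abbreviation R :: "'k mpoly set" where "R \<equiv> mpolys UNIV {1..n}"
abbreviation S :: "'k mpoly mpoly set" where "S \<equiv> mpolys R {1..t}"
abbreviation P :: "'k mpoly set" where "P \<equiv> P_ideal n r u"

definition L_gens :: "'k mpoly mpoly set" where
  "L_gens = {mconst (F n u i) * mvar i - mconst (F n u (i + 1)) * mvar (i + 1) | i.
      1 \<le> i \<and> i \<le> t - 1}"

lemma subring_KT: "subring_set KT" and subring_R: "subring_set R" and subring_S: "subring_set S"
  by (simp_all add: subring_set_mpolys)

lemma h_polys_in_KT: "h_polys n r u \<subseteq> KT"
  using h_polys_subset_circuit_rels[OF r] circuit_rels_in_mpolys by blast

lemma P_eq: "P = gen_ideal KT (h_polys n r u)"
  unfolding P_ideal_def ring_KT_def h_polys_def[symmetric]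
  by (rule genideal_mpoly_ring[OF subring_set_UNIV h_polys_in_KT])

lemma P_subset_KT: "P \<subseteq> KT"
  unfolding P_eq by (rule gen_ideal_in[OF subring_KT h_polys_in_KT])

lemma circuit_rels_in_P: "circuit_rels n r u \<subseteq> P"
proof
  fix s assume "s \<in> circuit_rels n r u"
  then obtain a C where C: "C \<subseteq> {1..t}" and d: "(\<Sum>i\<in>C. mconst (a i) * F n u i) = 0"
    and s: "s = circuit_rel a C"
    unfolding circuit_rels_def by blast
  define b where "b i = (if i \<in> C then a i else 0)" for i
  have "(\<Sum>i=1..t. mconst (b i) * F n u i) = (\<Sum>i\<in>C. mconst (a i) * F n u i)"
    by (rule sum.mono_neutral_cong_right) (use C in \<open>auto simp: b_def\<close>)
  then have "dependency n r u b" by (simp add: dependency_iff d)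
  then have "circuit_rel b C \<in> P"
    unfolding P_eq by (intro circuit_rel_in_h_ideal F_inj r C) (auto simp: b_def)
  also have "circuit_rel b C = circuit_rel a C"
    by (rule circuit_rel_cong) (simp add: b_def)
  finally show "s \<in> P" unfolding s .
qed

lemma KT_to_S_in: "p \<in> KT \<Longrightarrow> KT_to_S p \<in> S"
  unfolding KT_to_S_eq
  by (rule mpoly_eval_in[OF subring_S])
     (auto intro!: mconst_in_mpolys mvar_in_mpolys subring_set_mpolys)

lemma L_gens_in_S: "L_gens \<subseteq> S"
proof
  fix s assume "s \<in> L_gens"
  then obtain i where i: "1 \<le> i" "i \<le> t - 1"
    and s: "s = mconst (F n u i) * mvar i - mconst (F n u (i + 1)) * mvar (i + 1)"
    unfolding L_gens_def by blast
  have "i \<in> {1..t}" "i + 1 \<in> {1..t}" using i r by auto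
  then show "s \<in> S"
    unfolding s
    by (intro subring_setD[OF subring_S] mconst_in_mpolys mvar_in_mpolys subring_R F_in_mpolys)
qed

lemma linear_ideal_eq: "linear_ideal n r u = gen_ideal S L_gens"
  unfolding linear_ideal_def L_gens_def[symmetric] ring_S_def ring_R_def mpoly_ring_simps
  by (rule genideal_mpoly_ring[OF subring_R L_gens_in_S])

lemma ideal_PS_eq: "Idl\<^bsub>ring_S n t\<^esub> (KT_to_S ` P) = gen_ideal S (KT_to_S ` P)"
  unfolding ring_S_def ring_R_def mpoly_ring_simps
  by (rule genideal_mpoly_ring[OF subring_R]) (use P_subset_KT KT_to_S_in in blast)

lemma sum_ideal_eq:
  "linear_ideal n r u <+>\<^bsub>ring_S n t\<^esub> Idl\<^bsub>ring_S n t\<^esub> (KT_to_S ` P) =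
    gen_ideal S (L_gens \<union> KT_to_S ` P)"
  unfolding linear_ideal_eq ideal_PS_eq gen_ideal_Un set_add_defs
  by (auto simp: ring_S_def ring_R_def mpoly_ring_simps)

lemma rees_defining_ideal_eq: "rees_defining_ideal n r u = {p \<in> S. ext_rees_map (F n u) t p = 0}"
  unfolding rees_defining_ideal_def a_kernel_def' rees_map_eq
  by (auto simp: ring_S_def ring_R_def rees_algebra_def ring_Rtau_def upoly_ring_def)

lemma P_in_kernel:
  assumes "p \<in> P" shows "ext_rees_map (F n u) t (KT_to_S p) = 0"
proof (rule gen_ideal_kernel[OF comm_ring_hom_comp[OF ext_rees_map_hom KT_to_S_hom]])
  show "p \<in> gen_ideal KT (h_polys n r u)" using assms by (simp add: P_eq)
  fix s assume "s \<in> h_polys n r u"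
  then have "s \<in> circuit_rels n r u" using h_polys_subset_circuit_rels[OF r] by blast
  then have "KT_to_S s \<in> ext_rels (F n u) t"
    unfolding circuit_rels_def ext_rels_def using KT_to_S_circuit_rel by fastforce
  then show "ext_rees_map (F n u) t (KT_to_S s) = 0"
    by (intro ext_rels_kernel[OF gen_ideal_gen[OF subring_set_UNIV]] F_nonzero)
qed

lemma sum_ideal_in_kernel:
  assumes "x \<in> gen_ideal S (L_gens \<union> KT_to_S ` P)" shows "ext_rees_map (F n u) t x = 0"
proof (rule gen_ideal_kernel[OF ext_rees_map_hom assms])
  interpret e: comm_ring_hom "ext_rees_map (F n u) t" by (rule ext_rees_map_hom)
  fix s assume "s \<in> L_gens \<union> KT_to_S ` P"
  then consider i where "1 \<le> i" "i \<le> t - 1"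
      "s = mconst (F n u i) * mvar i - mconst (F n u (i + 1)) * mvar (i + 1)"
    | p where "p \<in> P" "s = KT_to_S p"
    unfolding L_gens_def by blast
  then show "ext_rees_map (F n u) t s = 0"
  proof cases
    case 1
    then have i: "i \<in> {1..t}" "i + 1 \<in> {1..t}" using r by auto
    show ?thesis
      unfolding 1(3) e.hom_minus e.hom_mult ext_rees_map_mconst
        form_times_ext_rees_map_mvar[OF i(1)] form_times_ext_rees_map_mvar[OF i(2)] by simp
  next
    case 2
    then show ?thesis using P_in_kernel by simp
  qed
qed

text \<open>Modulo \<L> all \<open>F\<^sub>i T\<^sub>i\<close> equal
  \<open>F\<^sub>1 T\<^sub>1\<close>, which can therefore take the role of \<open>W\<close>.\<close>

lemma L_gens_telescope:
  assumes "i \<in> {1..t}"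
  shows "mconst (F n u i) * mvar i - mconst (F n u 1) * mvar 1 \<in> gen_ideal S L_gens"
proof -
  have "i \<ge> 1" "i \<le> t" using assms by auto
  then show ?thesis
  proof (induction i rule: dec_induct)
    case base
    then show ?case by (simp add: gen_ideal.zero)
  next
    case (step i)
    let ?d = "mconst (F n u i) * mvar i - mconst (F n u (i + 1)) * mvar (i + 1)"
    have "?d \<in> L_gens" unfolding L_gens_def using step.hyps step.prems by auto
    then have "?d \<in> gen_ideal S L_gens" by (rule gen_ideal_gen[OF subring_S])
    moreover have "mconst (F n u i) * mvar i - mconst (F n u 1) * mvar 1 \<in> gen_ideal S L_gens"
      using step.prems by (intro step.IH) simp
    ultimately have "(mconst (F n u i) * mvar i - mconst (F n u 1) * mvar 1) - ?d \<in> gen_ideal S L_gens"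
      by (rule gen_ideal_minus[OF subring_S, rotated])
    then show ?case by (simp add: algebra_simps)
  qed
qed

text \<open>The kernel theorem expresses \<open>p\<close> by relations that involve
  \<open>W\<close>. The substitution \<theta> of \<open>F\<^sub>1 T\<^sub>1\<close> for
  \<open>W\<close> fixes \<open>p\<close>, sends the linear relations into \<L> and the circuit
  relations into the image of \<open>P\<close>.\<close>

lemma kernel_in_sum_ideal:
  assumes p: "p \<in> S" "ext_rees_map (F n u) t p = 0"
  shows "p \<in> gen_ideal S (L_gens \<union> KT_to_S ` P)"
proof -
  let ?J = "gen_ideal S (L_gens \<union> KT_to_S ` P)"
  \<comment> \<open>\<open>F n u 0\<close> is the variable with index 0, which is not a form in
    \<open>x\<^sub>1, \<dots>, x\<^sub>n\<close>; the kernel theorem asks for linear forms at all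
    indices.\<close>
  define f where "f i = (if i = 0 then 0 else F n u i)" for i
  have f: "f i = F n u i" if "i \<in> {1..t}" for i using that by (simp add: f_def)
  have t1: "1 \<in> {1..t}" using r by simp
  have lin: "f i \<in> linear_forms {1..n}" for i
  proof (cases "i = 0")
    case True
    then show ?thesis
      unfolding linear_forms_def by (intro CollectI exI[of _ "\<lambda>_. 0"]) (simp add: f_def)
  next
    case False
    then show ?thesis
      using F_eq_form_coeff[of i n i u] unfolding linear_forms_def f_def by auto
  qed
  have ef: "ext_rees_map f t = ext_rees_map (F n u) t"
  proof -
    have "(\<Prod>j\<in>{1..t} - {i}. f j) = (\<Prod>j\<in>{1..t} - {i}. F n u j)" for i
      by (rule prod.cong) (auto simp: f)
    then show ?thesis unfolding ext_rees_map_def by simp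
  qed
  have sub: "S \<subseteq> mpolys R {0..t}" by (rule mpolys_mono) auto
  have mem: "p \<in> gen_ideal (mpolys R {0..t}) (ext_rels f t)"
    using p sub F_nonzero by (intro ext_rees_map_kernel lin) (auto simp: ef f simp del: One_nat_def)
  define \<theta> where "\<theta> = mpoly_eval mconst (\<lambda>i. if i = 0 then mconst (F n u 1) * mvar 1 else mvar i :: 'k mpoly mpoly)"
  have \<theta>: "comm_ring_hom \<theta>" unfolding \<theta>_def by (rule mconst.mpoly_eval_hom)
  interpret \<theta>: comm_ring_hom \<theta> by (rule \<theta>)
  have \<theta>c: "\<theta> (mconst c) = mconst c" for c by (simp add: \<theta>_def)
  have \<theta>v: "\<theta> (mvar i) = mvar i" if "i \<in> {1..t}" for i
    using that by (simp add: \<theta>_def)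
  have \<theta>0: "\<theta> (mvar 0) = mconst (F n u 1) * mvar 1" by (simp add: \<theta>_def)
  have "\<theta> p \<in> ?J"
  proof (rule gen_ideal_hom[OF \<theta> mem subring_S])
    fix c assume "c \<in> mpolys R {0..t}"
    then show "\<theta> c \<in> S"
      unfolding \<theta>_def
    proof (rule mpoly_eval_in[OF subring_S])
      show "mconst a \<in> S" if "a \<in> R" for a using that by (intro mconst_in_mpolys subring_R)
      show "(if i = 0 then mconst (F n u 1) * mvar 1 else mvar i) \<in> S" if "i \<in> {0..t}" for i
        using that t1 F_in_mpolys[OF t1]
        by (auto intro!: mpolys_mult mconst_in_mpolys mvar_in_mpolys subring_set_mpolys)
    qed
  next
    fix s assume "s \<in> ext_rels f t"
    then consider i where "i \<in> {1..t}" "s = mconst (f i) * mvar i - mvar 0"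
      | a C where "C \<subseteq> {1..t}" "\<forall>i\<in>C. a i \<noteq> 0" "(\<Sum>i\<in>C. mconst (a i) * f i) = 0"
        "s = circuit_rel (\<lambda>i. mconst (a i)) C"
      unfolding ext_rels_def by blast
    then show "\<theta> s \<in> ?J"
    proof cases
      case 1
      then have "\<theta> s = mconst (F n u i) * mvar i - mconst (F n u 1) * mvar 1"
        by (simp only: \<theta>.hom_minus \<theta>.hom_mult \<theta>c \<theta>v[OF 1(1)] \<theta>0 f[OF 1(1)])
      then show ?thesis
        using L_gens_telescope[OF 1(1)] gen_ideal_mono[of S S L_gens "L_gens \<union> KT_to_S ` P"] by auto
    next
      case 2
      have "(\<Sum>i\<in>C. mconst (a i) * F n u i) = (\<Sum>i\<in>C. mconst (a i) * f i)"
        by (rule sum.cong) (use 2(1) f in auto)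
      then have "circuit_rel a C \<in> circuit_rels n r u"
        using 2(1-3) unfolding circuit_rels_def by auto
      then have "circuit_rel a C \<in> P" using circuit_rels_in_P by blast
      moreover have "\<theta> s = KT_to_S (circuit_rel a C)"
        unfolding 2(4) KT_to_S_circuit_rel
        by (rule circuit_rel_hom[OF \<theta>]) (use 2(1) in \<open>auto simp: \<theta>c intro!: \<theta>v\<close>)
      ultimately show ?thesis by (intro gen_ideal_gen[OF subring_S]) blast
    qed
  qed
  also have "\<theta> p = p"
    by (rule mpoly_hom_eqI[OF \<theta> comm_ring_hom_id subring_R p(1)]) (auto simp: \<theta>c intro!: \<theta>v)
  finally show ?thesis .
qed

theorem rees_defining_ideal_eq_sum:
  "rees_defining_ideal n r u =
    linear_ideal n r u <+>\<^bsub>ring_S n t\<^esub> Idl\<^bsub>ring_S n t\<^esub> (KT_to_S ` P)"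
  unfolding rees_defining_ideal_eq sum_ideal_eq
proof (intro equalityI subsetI)
  fix x assume x: "x \<in> gen_ideal S (L_gens \<union> KT_to_S ` P)"
  have "L_gens \<union> KT_to_S ` P \<subseteq> S" using L_gens_in_S P_subset_KT KT_to_S_in by blast
  then show "x \<in> {p \<in> S. ext_rees_map (F n u) t p = 0}"
    using x gen_ideal_in[OF subring_S] sum_ideal_in_kernel by blast
qed (use kernel_in_sum_ideal in blast)

text \<open>Setting all \<open>x\<^sub>j\<close> to 0 kills \<open>\<L>\<close> and recovers \<open>p\<close> from its image in \<open>S\<close>.\<close>

lemma P_eq_kernel: "P = {p \<in> KT. ext_rees_map (F n u) t (KT_to_S p) = 0}"
proof (intro equalityI subsetI)
  fix p assume "p \<in> {p \<in> KT. ext_rees_map (F n u) t (KT_to_S p) = 0}"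
  then have p: "p \<in> KT" "ext_rees_map (F n u) t (KT_to_S p) = 0" by auto
  define z where "z = mpoly_eval (\<lambda>x. x) (\<lambda>_. 0 :: 'k)"
  have z: "comm_ring_hom z" unfolding z_def by (rule comm_ring_hom.mpoly_eval_hom[OF comm_ring_hom_id])
  interpret z: comm_ring_hom z by (rule z)
  have zc [simp]: "z (mconst c) = c" for c
    unfolding z_def by (rule comm_ring_hom.mpoly_eval_mconst[OF comm_ring_hom_id])
  have zv: "z (mvar i) = 0" for i
    unfolding z_def by (rule comm_ring_hom.mpoly_eval_mvar[OF comm_ring_hom_id])
  have zF: "z (F n u i) = 0" for i
    unfolding F_def by (simp add: zv z.hom_sum z.hom_mult)
  have hz: "comm_ring_hom (\<lambda>c. mconst (z c))" by (rule comm_ring_hom_comp[OF comm_ring_hom_mconst z])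
  define \<zeta> where "\<zeta> = mpoly_eval (\<lambda>c. mconst (z c)) mvar"
  have \<zeta>: "comm_ring_hom \<zeta>" unfolding \<zeta>_def by (rule comm_ring_hom.mpoly_eval_hom[OF hz])
  interpret \<zeta>: comm_ring_hom \<zeta> by (rule \<zeta>)
  have \<zeta>c: "\<zeta> (mconst c) = mconst (z c)" for c
    unfolding \<zeta>_def by (rule comm_ring_hom.mpoly_eval_mconst[OF hz])
  have \<zeta>v: "\<zeta> (mvar i) = mvar i" for i
    unfolding \<zeta>_def by (rule comm_ring_hom.mpoly_eval_mvar[OF hz])
  have \<zeta>K: "\<zeta> (KT_to_S q) = q" if "q \<in> KT" for q
    by (rule mpoly_hom_eqI[OF comm_ring_hom_comp[OF \<zeta> KT_to_S_hom] comm_ring_hom_id subring_set_UNIV that])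
       (simp_all add: \<zeta>c \<zeta>v)
  have "KT_to_S p \<in> gen_ideal S (L_gens \<union> KT_to_S ` P)"
    by (rule kernel_in_sum_ideal[OF KT_to_S_in[OF p(1)] p(2)])
  then have "\<zeta> (KT_to_S p) \<in> gen_ideal KT (h_polys n r u)"
  proof (rule gen_ideal_hom[OF \<zeta> _ subring_KT])
    show "\<zeta> c \<in> KT" if "c \<in> S" for c
      unfolding \<zeta>_def by (rule mpoly_eval_in[OF subring_KT that]) (auto intro!: mconst_in_mpolys mvar_in_mpolys)
    fix s assume "s \<in> L_gens \<union> KT_to_S ` P"
    then show "\<zeta> s \<in> gen_ideal KT (h_polys n r u)"
    proof
      assume "s \<in> L_gens"
      then have "\<zeta> s = 0"
        unfolding L_gens_def by (auto simp: \<zeta>.hom_minus \<zeta>.hom_mult \<zeta>c zF)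
      then show ?thesis by (simp add: gen_ideal.zero)
    next
      assume "s \<in> KT_to_S ` P"
      then show ?thesis using \<zeta>K P_subset_KT unfolding P_eq[symmetric] by auto
    qed
  qed
  then show "p \<in> P" using \<zeta>K[OF p(1)] by (simp add: P_eq)
qed (use P_subset_KT P_in_kernel in auto)

end

section \<open>Further determinant identities\<close>

lemma minor_mult:
  fixes M N :: "nat \<Rightarrow> nat \<Rightarrow> 'a::comm_ring_1"
  assumes Z: "finite Z" and c: "card X = card Z" "card Y = card Z"
  shows "minor (\<lambda>x y. \<Sum>z\<in>Z. M x z * N z y) X Y = minor M X Z * minor N Z Y"
proof -
  let ?p = "card Z"
  let ?xs = "(!) (sorted_list_of_set X)" and ?ys = "(!) (sorted_list_of_set Y)"
  let ?zs = "(!) (sorted_list_of_set Z)"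
  let ?A = "mat ?p ?p (\<lambda>(a, b). M (?xs a) (?zs b))" and ?B = "mat ?p ?p (\<lambda>(a, b). N (?zs a) (?ys b))"
  have "mat ?p ?p (\<lambda>(a, b). \<Sum>z\<in>Z. M (?xs a) z * N z (?ys b)) = ?A * ?B"
  proof (rule eq_matI)
    fix a b assume "a < dim_row (?A * ?B)" "b < dim_col (?A * ?B)"
    then have ab: "a < ?p" "b < ?p" by simp_all
    have "(\<Sum>z\<in>Z. M (?xs a) z * N z (?ys b)) = (\<Sum>c<?p. M (?xs a) (?zs c) * N (?zs c) (?ys b))"
      by (rule sum.reindex_bij_betw[OF bij_betw_sorted_nth[OF Z], symmetric])
    then show "mat ?p ?p (\<lambda>(a, b). \<Sum>z\<in>Z. M (?xs a) z * N z (?ys b)) $$ (a, b) = (?A * ?B) $$ (a, b)"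
      using ab by (simp add: scalar_prod_def atLeast0LessThan)
  qed simp_all
  moreover have "det (?A * ?B) = det ?A * det ?B"
    by (rule det_mult) auto
  ultimately show ?thesis unfolding minor_def c by simp
qed

lemma minor_hom:
  assumes "comm_ring_hom h" "card X = card Y"
  shows "h (minor M X Y) = minor (\<lambda>x y. h (M x y)) X Y"
proof -
  interpret h: comm_ring_hom h by fact
  let ?A = "mat (card X) (card Y) (\<lambda>(a, b). M (sorted_list_of_set X ! a) (sorted_list_of_set Y ! b))"
  have "h (det ?A) = det (map_mat h ?A)" by simp
  also have "map_mat h ?A = mat (card X) (card Y)
      (\<lambda>(a, b). h (M (sorted_list_of_set X ! a) (sorted_list_of_set Y ! b)))"
    by (rule eq_matI) auto
  finally show ?thesis unfolding minor_def .
qed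

lemma minor_in:
  assumes A: "subring_set A" and c: "finite X" "finite Y" "card X = card Y"
    and M: "\<And>x y. x \<in> X \<Longrightarrow> y \<in> Y \<Longrightarrow> M x y \<in> A"
  shows "minor M X Y \<in> A"
proof -
  let ?A = "mat (card X) (card Y) (\<lambda>(a, b). M (sorted_list_of_set X ! a) (sorted_list_of_set Y ! b))"
  have xX: "sorted_list_of_set X ! a \<in> X" if "a < card X" for a
    using bij_betw_sorted_nth[OF c(1)] that by (auto simp: bij_betw_def)
  have yY: "sorted_list_of_set Y ! a \<in> Y" if "a < card Y" for a
    using bij_betw_sorted_nth[OF c(2)] that by (auto simp: bij_betw_def)
  have "det ?A = (\<Sum>p\<in>{p. p permutes {0..<card X}}. signof p * (\<Prod>i=0..<card X. ?A $$ (i, p i)))"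
    by (rule det_def') (simp add: c(3))
  also have "\<dots> \<in> A"
  proof (intro subring_set_sum A subring_setD(6)[OF A] subring_set_prod)
    fix p assume p: "p \<in> {p. p permutes {0..<card X}}"
    show "signof p \<in> A"
      using subring_setD(1,4)[OF A] by (simp add: sign_def)
    fix i assume i: "i \<in> {0..<card X}"
    then have "p i < card Y" using p c(3) permutes_in_image[of p "{0..<card X}" i] by auto
    then show "?A $$ (i, p i) \<in> A" using i xX yY M by simp
  qed
  finally show ?thesis unfolding minor_def .
qed

text \<open>Multilinearity writes the minor as a sum over the choices of a column of
  \<open>B\<close> for each column in \<open>Z\<close>. A choice with a repetition gives 0, any
  other one a coefficient in \<open>A\<close> times a maximal minor of \<open>B\<close> with
  permuted columns. For membership in the ideal no equal terms have to be collected, unlike in the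
  Cauchy-Binet formula.\<close>

lemma minor_column_combination:
  fixes B H :: "nat \<Rightarrow> nat \<Rightarrow> 'a::comm_ring_1"
  assumes S: "finite S" and A: "subring_set A" and H: "\<And>j z. H j z \<in> A"
    and X: "card X = card Z"
    and C: "\<And>C. C \<subseteq> S \<Longrightarrow> card C = card Z \<Longrightarrow> minor B X C \<in> gen_ideal A G"
  shows "minor (\<lambda>x z. \<Sum>j\<in>S. B x j * H j z) X Z \<in> gen_ideal A G"
proof -
  let ?p = "card Z"
  let ?xs = "(!) (sorted_list_of_set X)" and ?zs = "(!) (sorted_list_of_set Z)"
  define w where "w j = vec ?p (\<lambda>a. B (?xs a) j)" for j
  have w: "w j \<in> carrier_vec ?p" for j by (simp add: w_def)
  let ?R = "mat\<^sub>r ?p ?p (\<lambda>b. finsum_vec TYPE('a) ?p (\<lambda>j. H j (?zs b) \<cdot>\<^sub>v w j) S)"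
  have "minor (\<lambda>x z. \<Sum>j\<in>S. B x j * H j z) X Z =
      det (mat ?p ?p (\<lambda>(b, a). \<Sum>j\<in>S. B (?xs a) j * H j (?zs b)))"
    unfolding minor_transpose[OF X] by (simp add: minor_def X)
  also have "mat ?p ?p (\<lambda>(b, a). \<Sum>j\<in>S. B (?xs a) j * H j (?zs b)) = ?R"
  proof (rule eq_matI)
    fix b a assume "b < dim_row ?R" "a < dim_col ?R"
    then have ba: "b < ?p" "a < ?p" by simp_all
    have "finsum_vec TYPE('a) ?p (\<lambda>j. H j (?zs b) \<cdot>\<^sub>v w j) S $ a = (\<Sum>j\<in>S. (H j (?zs b) \<cdot>\<^sub>v w j) $ a)"
      using ba w by (intro index_finsum_vec[OF S]) auto
    then show "mat ?p ?p (\<lambda>(b, a). \<Sum>j\<in>S. B (?xs a) j * H j (?zs b)) $$ (b, a) = ?R $$ (b, a)"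
      using ba by (simp add: w_def mult.commute)
  qed simp_all
  also have "det \<dots> = (\<Sum>f\<in>{f. (\<forall>i\<in>{0..<?p}. f i \<in> S) \<and> (\<forall>i. i \<notin> {0..<?p} \<longrightarrow> f i = i)}.
      det (mat\<^sub>r ?p ?p (\<lambda>b. H (f b) (?zs b) \<cdot>\<^sub>v w (f b))))"
    using w by (intro det_linear_rows_sum[OF S]) auto
  also have "\<dots> \<in> gen_ideal A G"
  proof (rule gen_ideal_sum)
    fix f assume f: "f \<in> {f. (\<forall>i\<in>{0..<?p}. f i \<in> S) \<and> (\<forall>i. i \<notin> {0..<?p} \<longrightarrow> f i = i)}"
    let ?W = "mat\<^sub>r ?p ?p (\<lambda>b. w (f b))"
    have eq: "det (mat\<^sub>r ?p ?p (\<lambda>b. H (f b) (?zs b) \<cdot>\<^sub>v w (f b))) = (\<Prod>b=0..<?p. H (f b) (?zs b)) * det ?W"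
      using w by (intro det_rows_mul) auto
    have "det ?W \<in> gen_ideal A G"
    proof (cases "inj_on f {0..<?p}")
      case False
      then obtain i j where ij: "i < ?p" "j < ?p" "i \<noteq> j" "f i = f j"
        by (auto simp: inj_on_def)
      have "row ?W i = row ?W j" using ij w by (simp add: carrier_vecD[OF w])
      then have "det ?W = 0" using ij by (intro det_identical_rows[of _ ?p i j]) auto
      then show ?thesis by (simp add: gen_ideal.zero)
    next
      case True
      define D where "D = f ` {0..<?p}"
      have finD: "finite D" and D: "D \<subseteq> S" "card D = ?p"
        using f True by (auto simp: D_def card_image)
      \<comment> \<open>The permutation that sorts the chosen columns increasingly, as
        \<open>minor\<close> takes them.\<close>
      define \<pi> where "\<pi> b = (if b < ?p then card {y\<in>D. y < f b} else b)" for b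
      have \<pi>: "\<pi> b < ?p" "sorted_list_of_set D ! \<pi> b = f b" if "b < ?p" for b
        using that sorted_nth_card_less[OF finD, of "f b"] D(2) by (auto simp: \<pi>_def D_def)
      have "inj_on \<pi> {0..<?p}"
        using \<pi>(2) True by (auto simp: inj_on_def) (metis atLeastLessThan_iff le0)
      moreover have "\<pi> ` {0..<?p} \<subseteq> {0..<?p}" using \<pi>(1) by auto
      ultimately have "bij_betw \<pi> {0..<?p} {0..<?p}"
        by (simp add: bij_betw_def endo_inj_surj)
      then have perm: "\<pi> permutes {0..<?p}"
        by (rule bij_imp_permutes) (simp add: \<pi>_def)
      let ?D = "mat ?p ?p (\<lambda>(b, a). B (?xs a) (sorted_list_of_set D ! b))"
      have "?W = mat ?p ?p (\<lambda>(i, j). ?D $$ (\<pi> i, j))"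
        by (rule eq_matI) (auto simp: w_def \<pi>)
      then have "det ?W = signof \<pi> * det ?D"
        using det_permute_rows[of ?D ?p \<pi>] perm by simp
      also have "det ?D = minor (\<lambda>y x. B x y) D X"
        using D(2) X by (simp add: minor_def)
      also have "\<dots> = minor B X D"
        using D(2) X by (intro minor_transpose[of X D B, symmetric]) simp
      finally have "det ?W = signof \<pi> * minor B X D" .
      moreover have "(signof \<pi> :: 'a) \<in> A"
        using subring_setD(1,4)[OF A] by (simp add: sign_def)
      ultimately show ?thesis using gen_ideal_mult[OF A] C D by simp
    qed
    then show "det (mat\<^sub>r ?p ?p (\<lambda>b. H (f b) (?zs b) \<cdot>\<^sub>v w (f b))) \<in> gen_ideal A G"
      unfolding eq by (intro gen_ideal_mult[OF A] subring_set_prod[OF A] H)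
  qed
  finally show ?thesis .
qed

text \<open>
  Two factorisations into block triangular matrices of the bordered matrix with diagonal block \<open>x\<close>,
  column \<open>y\<close> and row \<open>-1\<close> are compared.
\<close>

lemma det_diag_plus_rank_one:
  fixes x y :: "nat \<Rightarrow> 'a::idom"
  assumes x: "\<And>a. a < p \<Longrightarrow> x a \<noteq> 0"
  shows "det (mat p p (\<lambda>(a, b). (if a = b then x a else 0) + y a)) =
    (\<Prod>a<p. x a) + (\<Sum>a<p. y a * (\<Prod>b\<in>{..<p} - {a}. x b))"
proof -
  let ?N = "mat p p (\<lambda>(a, b). (if a = b then x a else 0) + y a)"
  let ?D = "mat p p (\<lambda>(a, b). if a = b then x a else 0)"
  let ?O = "mat 1 p (\<lambda>_. - 1 :: 'a)" and ?Y = "mat p 1 (\<lambda>(a, _). y a)"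
  let ?x = "\<Prod>a<p. x a"
  \<comment> \<open>Chosen so that \<open>x\<^sub>a v\<^sub>a\<close> is \<open>y\<^sub>a\<close>
    times the product of all \<open>x\<^sub>b\<close>: adding \<open>- v\<close> then clears the
    lower left block without division.\<close>
  define v where "v a = y a * (\<Prod>b\<in>{..<p} - {a}. x b)" for a
  let ?V = "mat p 1 (\<lambda>(a, _). - v a)"
  let ?I = "1\<^sub>m p :: 'a mat" and ?J = "1\<^sub>m 1 :: 'a mat"
  let ?X = "mat 1 1 (\<lambda>_. ?x)"
  let ?Bd = "four_block_mat ?J ?O ?Y ?D"
  have D: "det ?D = ?x"
  proof -
    have "det ?D = prod_list (diag_mat ?D)"
      by (rule det_upper_triangular[of _ p]) (auto simp: upper_triangular_def)
    also have "diag_mat ?D = map x [0..<p]" by (auto simp: diag_mat_def)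
    also have "prod_list \<dots> = ?x" by (simp add: prod.distinct_set_conv_list[symmetric] atLeast0LessThan)
    finally show ?thesis .
  qed
  have xv: "x a * v a = y a * ?x" if "a < p" for a
    using that prod.remove[of "{..<p}" a x] by (simp add: v_def)
  have "four_block_mat ?J (0\<^sub>m 1 p) ?Y ?N * four_block_mat ?J ?O (0\<^sub>m p 1) ?I =
      four_block_mat (?J * ?J + 0\<^sub>m 1 p * 0\<^sub>m p 1) (?J * ?O + 0\<^sub>m 1 p * ?I)
        (?Y * ?J + ?N * 0\<^sub>m p 1) (?Y * ?O + ?N * ?I)"
    by (rule mult_four_block_mat) auto
  also have "?J * ?J + 0\<^sub>m 1 p * 0\<^sub>m p 1 = ?J" by simp
  also have "?J * ?O + 0\<^sub>m 1 p * ?I = ?O" by simp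
  also have "?Y * ?J + ?N * 0\<^sub>m p 1 = ?Y" by simp
  also have "?Y * ?O + ?N * ?I = ?D"
    by (rule eq_matI) (auto simp: scalar_prod_def)
  finally have 1: "?Bd = four_block_mat ?J (0\<^sub>m 1 p) ?Y ?N * four_block_mat ?J ?O (0\<^sub>m p 1) ?I" ..
  have "det ?Bd = det (four_block_mat ?J (0\<^sub>m 1 p) ?Y ?N) * det (four_block_mat ?J ?O (0\<^sub>m p 1) ?I)"
    unfolding 1 by (rule det_mult[of _ "1 + p"]) auto
  also have "det (four_block_mat ?J (0\<^sub>m 1 p) ?Y ?N) = det ?J * det ?N"
    by (rule det_four_block_mat_upper_right_zero) auto
  also have "det (four_block_mat ?J ?O (0\<^sub>m p 1) ?I) = det ?J * det ?I"
    by (rule det_four_block_mat_lower_left_zero) auto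
  finally have N: "det ?Bd = det ?N" by simp
  let ?Z = "mat 1 1 (\<lambda>_. ?x + (\<Sum>a<p. v a))"
  have "?Bd * four_block_mat ?X (0\<^sub>m 1 p) ?V ?I =
      four_block_mat (?J * ?X + ?O * ?V) (?J * 0\<^sub>m 1 p + ?O * ?I)
        (?Y * ?X + ?D * ?V) (?Y * 0\<^sub>m 1 p + ?D * ?I)"
    by (rule mult_four_block_mat) auto
  also have "?J * ?X + ?O * ?V = ?Z"
    by (rule eq_matI) (auto simp: scalar_prod_def atLeast0LessThan)
  also have "?J * 0\<^sub>m 1 p + ?O * ?I = ?O" by simp
  also have "?Y * 0\<^sub>m 1 p + ?D * ?I = ?D" by simp
  also have "?Y * ?X + ?D * ?V = 0\<^sub>m p 1"
  proof (rule eq_matI)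
    fix a b assume "a < dim_row (0\<^sub>m p 1 :: 'a mat)" "b < dim_col (0\<^sub>m p 1 :: 'a mat)"
    then have ab: "a < p" "b = 0" by simp_all
    have "(?D * ?V) $$ (a, b) = (\<Sum>c<p. (if a = c then x a else 0) * (- v c))"
      using ab by (simp add: scalar_prod_def atLeast0LessThan)
    also have "\<dots> = (\<Sum>c<p. if a = c then - (x a * v a) else 0)"
      by (rule sum.cong) auto
    also have "\<dots> = - (y a * ?x)" using ab xv by simp
    finally show "(?Y * ?X + ?D * ?V) $$ (a, b) = 0\<^sub>m p 1 $$ (a, b)"
      using ab by (simp add: scalar_prod_def)
  qed simp_all
  finally have 2: "?Bd * four_block_mat ?X (0\<^sub>m 1 p) ?V ?I = four_block_mat ?Z ?O (0\<^sub>m p 1) ?D" .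
  have "det ?Bd * det (four_block_mat ?X (0\<^sub>m 1 p) ?V ?I) = det (?Bd * four_block_mat ?X (0\<^sub>m 1 p) ?V ?I)"
    by (rule det_mult[of _ "1 + p", symmetric]) auto
  also have "\<dots> = det ?Z * det ?D"
    unfolding 2 by (rule det_four_block_mat_lower_left_zero) auto
  also have "det (four_block_mat ?X (0\<^sub>m 1 p) ?V ?I) = det ?X * det ?I"
    by (rule det_four_block_mat_upper_right_zero) auto
  finally have "det ?N * ?x = (?x + (\<Sum>a<p. v a)) * ?x"
    unfolding N D by (simp add: det_single)
  moreover have "?x \<noteq> 0" using x by simp
  ultimately show ?thesis unfolding v_def by simp
qed

lemma minor_diag_plus_rank_one:
  fixes x y :: "nat \<Rightarrow> 'a::idom"
  assumes Z: "finite Z" and x: "\<And>z. z \<in> Z \<Longrightarrow> x z \<noteq> 0"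
  shows "minor (\<lambda>a b. (if a = b then x a else 0) + y a) Z Z =
    (\<Prod>z\<in>Z. x z) + (\<Sum>z\<in>Z. y z * (\<Prod>b\<in>Z - {z}. x b))"
proof -
  let ?p = "card Z" and ?zs = "(!) (sorted_list_of_set Z)"
  have bij: "bij_betw ?zs {..<?p} Z" by (rule bij_betw_sorted_nth[OF Z])
  then have inj: "?zs a = ?zs b \<longleftrightarrow> a = b" if "a < ?p" "b < ?p" for a b
    using that by (auto simp: bij_betw_def inj_on_def)
  have zs: "?zs a \<in> Z" if "a < ?p" for a using bij that by (auto simp: bij_betw_def)
  have "minor (\<lambda>a b. (if a = b then x a else 0) + y a) Z Z =
      det (mat ?p ?p (\<lambda>(a, b). (if a = b then x (?zs a) else 0) + y (?zs a)))"
    unfolding minor_def by (intro arg_cong[where f = det] eq_matI) (auto simp: inj)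
  also have "\<dots> = (\<Prod>a<?p. x (?zs a)) + (\<Sum>a<?p. y (?zs a) * (\<Prod>b\<in>{..<?p} - {a}. x (?zs b)))"
    by (rule det_diag_plus_rank_one) (simp add: x zs)
  also have "(\<Prod>a<?p. x (?zs a)) = (\<Prod>z\<in>Z. x z)" by (rule prod.reindex_bij_betw[OF bij])
  also have "(\<Sum>a<?p. y (?zs a) * (\<Prod>b\<in>{..<?p} - {a}. x (?zs b))) =
      (\<Sum>a<?p. y (?zs a) * (\<Prod>b\<in>Z - {?zs a}. x b))"
  proof (intro sum.cong refl arg_cong[where f = "(*) _"])
    fix a assume "a \<in> {..<?p}"
    then have "bij_betw ?zs ({..<?p} - {a}) (Z - {?zs a})"
      using bij by (intro bij_betw_DiffI) (auto simp: bij_betw_def)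
    then show "(\<Prod>b\<in>{..<?p} - {a}. x (?zs b)) = (\<Prod>b\<in>Z - {?zs a}. x b)"
      by (rule prod.reindex_bij_betw)
  qed
  also have "\<dots> = (\<Sum>z\<in>Z. y z * (\<Prod>b\<in>Z - {z}. x b))"
    by (rule sum.reindex_bij_betw[OF bij])
  finally show ?thesis .
qed

section \<open>The maximal minors of the Jacobian dual\<close>

lemma mpoly_eval_restrict_vars:
  "lookup (mpoly_eval mconst (\<lambda>k. if k \<in> X then mvar k else 0) (p :: 'a::comm_ring_1 mpoly)) e =
    (if keys e \<subseteq> X then lookup p e else 0)"
proof -
  let ?v = "\<lambda>k. if k \<in> X then mvar k else 0 :: 'a mpoly"
  have "mconst c * mon_eval ?v e = (if keys e \<subseteq> X then Poly_Mapping.single e c else 0)" for c e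
  proof (cases "keys e \<subseteq> X")
    case True
    then have "mon_eval ?v e = mon_eval mvar e"
      unfolding mon_eval_def by (intro prod.cong) auto
    then show ?thesis using True by (simp add: single_eq_mconst_mon_eval)
  next
    case False
    then obtain k where k: "k \<in> keys e" "k \<notin> X" by blast
    then have "?v k ^ lookup e k = 0" by (simp add: in_keys_iff power_0_left)
    then have "mon_eval ?v e = 0"
      unfolding mon_eval_def using k(1) by (intro prod_zero[OF _ bexI[of _ k]]) auto
    then show ?thesis using False by simp
  qed
  then have "mpoly_eval mconst ?v p = (\<Sum>e\<in>keys p. if keys e \<subseteq> X then Poly_Mapping.single e (lookup p e) else 0)"
    by (simp add: mpoly_eval_def)
  then have "lookup (mpoly_eval mconst ?v p) e =
      (\<Sum>e'\<in>keys p. lookup (if keys e' \<subseteq> X then Poly_Mapping.single e' (lookup p e') else 0) e)"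
    by (simp add: lookup_sum)
  also have "\<dots> = (\<Sum>e'\<in>keys p. if e' = e then (if keys e \<subseteq> X then lookup p e else 0) else 0)"
    by (rule sum.cong) (auto simp: lookup_single when_def)
  also have "\<dots> = (if keys e \<subseteq> X then lookup p e else 0)"
    by (simp add: in_keys_iff)
  finally show ?thesis .
qed

text \<open>The column that the row \<open>[x\<^sub>1, \<dots>, x\<^sub>n]\<close> multiplies to
  \<open>F\<^sub>m T\<^sub>m\<close>.\<close>

definition jac_col :: "nat \<Rightarrow> (nat \<Rightarrow> nat \<Rightarrow> 'k::field) \<Rightarrow> nat \<Rightarrow> nat \<Rightarrow> 'k mpoly" where
  "jac_col n u k m = mconst (form_coeff n u m k) * mvar m"

text \<open>
  The columns of the Jacobian dual are differences of columns \<open>F\<^sub>m T\<^sub>m\<close> along the edges of a tree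
  on \<open>{1, \<dots>, t}\<close>: a path on \<open>{1, \<dots>, n}\<close> and a star with centre \<open>n\<close>.
\<close>

lemma jacobian_dual_eq:
  assumes "k \<in> {1..n}" "j \<ge> 1"
  shows "jacobian_dual n u k j = (if j < n then jac_col n u k j - jac_col n u k (j + 1)
    else jac_col n u k (j + 1) - jac_col n u k n)"
proof (cases "j < n")
  case True
  then show ?thesis by (auto simp: jacobian_dual_def jac_col_def form_coeff_def)
next
  case False
  then have "n + (j - (n - 1)) = j + 1" "j + 1 - n = j - (n - 1)" using assms by auto
  then show ?thesis using False assms
    by (auto simp: jacobian_dual_def jac_col_def form_coeff_def Let_def)
qed

text \<open>The indicator of the tree edges on the path from \<open>m\<close> to the centre
  \<open>n\<close>: for \<open>m \<le> n\<close> the edges \<open>m, \<dots>, n - 1\<close>, whose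
  differences telescope, and for \<open>m > n\<close> the single edge \<open>m - 1\<close>.\<close>

definition path_coeff :: "nat \<Rightarrow> nat \<Rightarrow> nat \<Rightarrow> 'a::comm_ring_1" where
  "path_coeff n j m = (if m \<le> j \<and> j < n then 1 else if n < m \<and> j = m - 1 then 1 else 0)"

lemma jac_col_diff:
  assumes k: "k \<in> {1..n}" and m: "m \<in> {1..n + r}"
  shows "(\<Sum>j=1..n + r - 1. jacobian_dual n u k j * path_coeff n j m) = jac_col n u k m - jac_col n u k n"
proof (cases "m \<le> n")
  case True
  have "(\<Sum>j=1..n + r - 1. jacobian_dual n u k j * path_coeff n j m) =
      (\<Sum>j=m..<n. jac_col n u k j - jac_col n u k (Suc j))"
    by (rule sum.mono_neutral_cong_right)
       (use True k m in \<open>auto simp: path_coeff_def jacobian_dual_eq\<close>)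
  also have "\<dots> = jac_col n u k m - jac_col n u k n"
    using sum_Suc_diff'[OF True, of "\<lambda>j. - jac_col n u k j"] by simp
  finally show ?thesis .
next
  case False
  then have "path_coeff n j m = (if j = m - 1 then 1 else 0 :: 'a mpoly)" for j
    by (auto simp: path_coeff_def)
  then have "(\<Sum>j=1..n + r - 1. jacobian_dual n u k j * path_coeff n j m) =
      (\<Sum>j=1..n + r - 1. if j = m - 1 then jacobian_dual n u k (m - 1) else 0)"
    by (intro sum.cong) auto
  also have "\<dots> = jacobian_dual n u k (m - 1)" using False m k by auto
  also have "\<dots> = jac_col n u k m - jac_col n u k n"
    using False m k by (subst jacobian_dual_eq) auto
  finally show ?thesis .
qed

text \<open>The columns of \<open>B\<close> are differences of the columns
  \<open>F\<^sub>m T\<^sub>m\<close>, so a vector with the same product \<open>w\<close> with all of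
  these is a left kernel vector of the image of \<open>B\<close>.\<close>

lemma jacobian_minor_eq_0:
  fixes h :: "'k::field mpoly \<Rightarrow> 'b::idom"
  assumes h: "comm_ring_hom h" and C: "C \<subseteq> {1..n + r - 1}" "card C = n" and n: "n \<ge> 1"
    and v: "k0 \<in> {1..n}" "v k0 \<noteq> 0"
    and w: "\<And>m. m \<in> {1..n + r} \<Longrightarrow> (\<Sum>k=1..n. h (jac_col n u k m) * v k) = w"
  shows "h (minor (jacobian_dual n u) {1..n} C) = 0"
proof -
  interpret h: comm_ring_hom h by fact
  have fC: "finite C" using C(1) finite_subset by blast
  have "h (minor (jacobian_dual n u) {1..n} C) = minor (\<lambda>k j. h (jacobian_dual n u k j)) {1..n} C"
    using C by (intro minor_hom h) simp
  also have "\<dots> = minor (\<lambda>j k. h (jacobian_dual n u k j)) C {1..n}"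
    using C by (intro minor_transpose) simp
  also have "\<dots> = 0"
  proof (subst minor_eq_0_iff)
    have "(\<Sum>k=1..n. h (jacobian_dual n u k j) * v k) = 0" if j: "j \<in> C" for j
    proof -
      have "1 \<le> j" "j \<le> n + r - 1" using j C(1) by auto
      then have j': "1 \<le> j" "j \<in> {1..n + r}" "j + 1 \<in> {1..n + r}" "n \<in> {1..n + r}" using n by auto
      have "(\<Sum>k=1..n. h (jacobian_dual n u k j) * v k) =
          (if j < n then (\<Sum>k=1..n. h (jac_col n u k j) * v k) - (\<Sum>k=1..n. h (jac_col n u k (j + 1)) * v k)
           else (\<Sum>k=1..n. h (jac_col n u k (j + 1)) * v k) - (\<Sum>k=1..n. h (jac_col n u k n) * v k))"
        using jacobian_dual_eq[OF _ j'(1), of _ n u]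
        by (simp add: h.hom_minus left_diff_distrib sum_subtractf)
      also have "\<dots> = 0" using w[OF j'(2)] w[OF j'(3)] w[OF j'(4)] by simp
      finally show ?thesis .
    qed
    then show "\<exists>v. (\<exists>k\<in>{1..n}. v k \<noteq> 0) \<and> (\<forall>j\<in>C. (\<Sum>k=1..n. h (jacobian_dual n u k j) * v k) = 0)"
      using v by blast
  qed (use C fC in auto)
  finally show ?thesis .
qed

lemma mvar_prod_dvd_mon_eval:
  assumes W: "W \<subseteq> keys e" and e: "keys e \<subseteq> V"
  obtains w where "w \<in> mpolys UNIV V" "mon_eval mvar e = w * (\<Prod>k\<in>W. mvar k :: 'a::comm_ring_1 mpoly)"
proof -
  let ?w = "(\<Prod>k\<in>W. mvar k ^ (lookup e k - 1)) * (\<Prod>k\<in>keys e - W. mvar k ^ lookup e k) :: 'a mpoly"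
  have "mon_eval mvar e = (\<Prod>k\<in>keys e - W. mvar k ^ lookup e k) * (\<Prod>k\<in>W. mvar k ^ lookup e k :: 'a mpoly)"
    unfolding mon_eval_def by (rule prod.subset_diff[OF W]) simp
  also have "(\<Prod>k\<in>W. mvar k ^ lookup e k) = (\<Prod>k\<in>W. mvar k ^ (lookup e k - 1) * mvar k :: 'a mpoly)"
  proof (rule prod.cong)
    fix k assume "k \<in> W"
    then have "lookup e k = Suc (lookup e k - 1)" using W by (auto simp: in_keys_iff)
    then show "mvar k ^ lookup e k = mvar k ^ (lookup e k - 1) * (mvar k :: 'a mpoly)"
      by (metis power_Suc2)
  qed simp
  finally have "mon_eval mvar e = ?w * (\<Prod>k\<in>W. mvar k)"
    by (simp add: prod.distrib mult_ac)
  moreover have "?w \<in> mpolys UNIV V"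
    using W e by (intro mpolys_mult subring_set_prod subring_set_power subring_set_mpolys mvar_in_mpolys) auto
  ultimately show ?thesis using that by blast
qed

text \<open>If every \<open>q\<close> had an element outside \<open>p\<close>, the product of such
  elements would lie in every \<open>q\<close> but, by primality, not in \<open>p\<close>.\<close>

lemma finite_Inter_in_prime:
  fixes A :: "'a::comm_ring_1 set"
  assumes fin: "finite \<Q>" and A: "subring_set A" and one: "1 \<notin> p"
    and p: "\<And>x y. x \<in> A \<Longrightarrow> y \<in> A \<Longrightarrow> x * y \<in> p \<Longrightarrow> x \<in> p \<or> y \<in> p"
    and \<Q>: "\<And>q. q \<in> \<Q> \<Longrightarrow> q \<subseteq> A" "\<And>q x c. q \<in> \<Q> \<Longrightarrow> x \<in> q \<Longrightarrow> c \<in> A \<Longrightarrow> c * x \<in> q"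
    and Int: "\<And>x. x \<in> A \<Longrightarrow> (\<And>q. q \<in> \<Q> \<Longrightarrow> x \<in> q) \<Longrightarrow> x \<in> p"
  shows "\<exists>q\<in>\<Q>. q \<subseteq> p"
proof (rule ccontr)
  assume no: "\<not> (\<exists>q\<in>\<Q>. q \<subseteq> p)"
  have "\<exists>x\<in>A - p. \<forall>q\<in>\<Q>. x \<in> q"
    using fin no \<Q>
  proof (induction \<Q>)
    case empty
    then show ?case using one subring_setD(1)[OF A] by blast
  next
    case (insert q \<Q>)
    have "\<exists>x\<in>A - p. \<forall>q\<in>\<Q>. x \<in> q"
    proof (rule insert.IH)
      show "\<not> (\<exists>q\<in>\<Q>. q \<subseteq> p)" using insert.prems(1) by blast
      show "q' \<subseteq> A" if "q' \<in> \<Q>" for q' using that by (intro insert.prems(2)) simp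
      show "c * x \<in> q'" if "q' \<in> \<Q>" "x \<in> q'" "c \<in> A" for q' x c
        using that by (intro insert.prems(3)) simp_all
    qed
    then obtain x where x: "x \<in> A" "x \<notin> p" "\<And>q. q \<in> \<Q> \<Longrightarrow> x \<in> q" by blast
    obtain y where y: "y \<in> q" "y \<notin> p" using insert.prems(1) by blast
    have yA: "y \<in> A" using y insert.prems(2)[of q] by blast
    have "x * y \<in> A - p" using p[OF x(1) yA] x y subring_setD(6)[OF A x(1) yA] by blast
    moreover have "x * y \<in> q" by (rule insert.prems(3)) (use y x in simp_all)
    moreover have "y * x \<in> q'" if "q' \<in> \<Q>" for q'
      by (rule insert.prems(3)) (use that yA x in simp_all)
    ultimately show ?case by (auto simp: mult.commute)
  qed
  then show False using Int by blast
qed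

lemma comm_ring_hom_pCons_sum: "[:\<Sum>k\<in>A. f k:] = (\<Sum>k\<in>A. [:f k :: 'a::comm_ring_1:])"
  by (induction A rule: infinite_finite_induct) (simp_all, metis add_pCons add_0)

context star
begin

lemma n_pos: "n \<ge> 1"
proof (rule ccontr)
  assume "\<not> n \<ge> 1"
  then have "F n u 1 = 0" by (simp add: F_def)
  then show False using F_nonzero[of 1] r by simp
qed

abbreviation E :: "nat set \<Rightarrow> nat set" where "E \<Theta> \<equiv> {1..t} - \<Theta>"
abbreviation I where "I \<equiv> jacobian_minors_ideal n r u"

definition I_gens where
  "I_gens = {minor (jacobian_dual n u) {1..n} C | C. C \<subseteq> {1..n + r - 1} \<and> card C = n}"

lemma jacobian_dual_in_KT:
  assumes "k \<in> {1..n}" "j \<in> {1..t - 1}" shows "jacobian_dual n u k j \<in> KT"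
proof -
  have col: "jac_col n u k m \<in> KT" if "m \<in> {1..t}" for m
    unfolding jac_col_def using that by (intro mpolys_mult mconst_in_mpolys mvar_in_mpolys) auto
  have "j \<in> {1..t}" "j + 1 \<in> {1..t}" "n \<in> {1..t}" using assms n_pos by auto
  then show ?thesis
    using assms by (subst jacobian_dual_eq) (auto intro!: mpolys_minus col simp del: One_nat_def)
qed

lemma I_gens_in_KT: "I_gens \<subseteq> KT"
proof
  fix s assume "s \<in> I_gens"
  then obtain C where C: "C \<subseteq> {1..t - 1}" "card C = n" "s = minor (jacobian_dual n u) {1..n} C"
    unfolding I_gens_def by blast
  have "finite C" using C(1) finite_subset by blast
  then show "s \<in> KT"
    unfolding C(3) using C(1,2) jacobian_dual_in_KT by (intro minor_in subring_KT) auto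
qed

lemma I_eq: "I = gen_ideal KT I_gens"
  unfolding jacobian_minors_ideal_def I_gens_def[symmetric] ring_KT_def
  by (rule genideal_mpoly_ring[OF subring_set_UNIV I_gens_in_KT])

lemma I_subset_KT: "I \<subseteq> KT"
  unfolding I_eq by (rule gen_ideal_in[OF subring_KT I_gens_in_KT])

text \<open>Here the left kernel vector is \<open>[x\<^sub>1, \<dots>, x\<^sub>n]\<close>: it takes
  each column to \<open>F\<^sub>m T\<^sub>m\<close>, and all of these have the same image under the
  Rees map.\<close>

lemma I_subset_P: "I \<subseteq> P"
proof
  fix p assume p: "p \<in> I"
  let ?h = "\<lambda>p. ext_rees_map (F n u) t (KT_to_S p)"
  have h: "comm_ring_hom ?h" by (rule comm_ring_hom_comp[OF ext_rees_map_hom KT_to_S_hom])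
  interpret K: comm_ring_hom KT_to_S by (rule KT_to_S_hom)
  interpret e: comm_ring_hom "ext_rees_map (F n u) t" by (rule ext_rees_map_hom)
  have "?h p = 0"
  proof (rule gen_ideal_kernel[OF h p[unfolded I_eq]])
    fix s assume "s \<in> I_gens"
    then obtain C where C: "C \<subseteq> {1..n + r - 1}" "card C = n" "s = minor (jacobian_dual n u) {1..n} C"
      unfolding I_gens_def by blast
    show "?h s = 0"
      unfolding C(3)
    proof (rule jacobian_minor_eq_0[OF h C(1,2) n_pos, of 1 "\<lambda>k. [:mvar k:]"])
      fix m assume m: "m \<in> {1..t}"
      have "(\<Sum>k=1..n. ?h (jac_col n u k m) * [:mvar k:]) =
          (\<Sum>k=1..n. [:mconst (form_coeff n u m k) * mvar k:]) * ext_rees_map (F n u) t (mvar m)"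
        unfolding sum_distrib_right jac_col_def K.hom_mult e.hom_mult KT_to_S_mconst KT_to_S_mvar
          ext_rees_map_mconst
        by (rule sum.cong) (simp_all add: mult_ac)
      also have "(\<Sum>k=1..n. [:mconst (form_coeff n u m k) * mvar k:]) = [:F n u m:]"
        unfolding F_eq_form_coeff[OF m] comm_ring_hom_pCons_sum ..
      also have "[:F n u m:] * ext_rees_map (F n u) t (mvar m) = Polynomial.monom (\<Prod>j\<in>{1..t}. F n u j) 1"
        by (rule form_times_ext_rees_map_mvar[OF m])
      finally show "(\<Sum>k=1..n. ?h (jac_col n u k m) * [:mvar k:]) = Polynomial.monom (\<Prod>j\<in>{1..t}. F n u j) 1" .
    qed (use n_pos in auto)
  qed
  then show "p \<in> P" using p I_subset_KT by (auto simp: P_eq_kernel)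
qed

text \<open>\<open>U\<^sub>\<chi>\<close> vanishes iff the forms outside \<open>\<chi>\<close> are linearly dependent.\<close>

definition dependent_sets :: "nat set set" where
  "dependent_sets = {X. X \<subseteq> {1..t} \<and> card X = n \<and> U_minor n r u ({1..t} - X) = 0}"

text \<open>\<open>Q X\<close> is the prime generated by the \<open>T\<^sub>k\<close> with \<open>k \<notin> X\<close>.\<close>

definition Q :: "nat set \<Rightarrow> 'k mpoly set" where
  "Q X = {p \<in> KT. \<forall>e\<in>keys p. \<not> keys e \<subseteq> X}"

text \<open>As the kernel of a map into a domain, \<open>Q X\<close> satisfies the prime
  condition.\<close>

lemma Q_eq_kernel: "Q X = {p \<in> KT. mpoly_eval mconst (\<lambda>k. if k \<in> X then mvar k else 0) p = 0}"
proof -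
  have "(\<forall>e\<in>keys p. \<not> keys e \<subseteq> X) \<longleftrightarrow> mpoly_eval mconst (\<lambda>k. if k \<in> X then mvar k else 0) p = 0"
    for p :: "'k mpoly"
    by (auto simp: poly_mapping_eq_iff fun_eq_iff mpoly_eval_restrict_vars in_keys_iff)
  then show ?thesis by (simp add: Q_def)
qed

lemma Q_mult: "x \<in> Q X \<Longrightarrow> c \<in> KT \<Longrightarrow> c * x \<in> Q X"
  by (auto simp: Q_eq_kernel mconst.mpoly_eval_mult intro: mpolys_mult)

lemma Q_prime: "x \<in> KT \<Longrightarrow> y \<in> KT \<Longrightarrow> x * y \<in> Q X \<Longrightarrow> x \<in> Q X \<or> y \<in> Q X"
  by (auto simp: Q_eq_kernel mconst.mpoly_eval_mult)

lemma card_compl: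
  assumes "X \<subseteq> {1..t}" "card X = n" shows "card ({1..t} - X) = r"
  using card_Diff_subset[OF finite_subset[OF assms(1)] assms(1)] assms(2) by simp

text \<open>The \<open>n\<close> dependent forms indexed by \<open>X\<close> have a nonzero common
  zero in \<open>K\<^sup>n\<close>. It annihilates the columns with index in \<open>X\<close>, and
  the other columns vanish because their variables are sent to 0.\<close>

lemma I_subset_Q:
  assumes X: "X \<in> dependent_sets" shows "I \<subseteq> Q X"
proof
  fix p assume p: "p \<in> I"
  let ?h = "mpoly_eval mconst (\<lambda>k. if k \<in> X then mvar k else 0 :: 'k mpoly)"
  have h: "comm_ring_hom ?h" by (rule mconst.mpoly_eval_hom)
  let ?\<chi> = "{1..t} - X"
  have X': "X \<subseteq> {1..t}" "card X = n" "U_minor n r u ?\<chi> = 0" using X by (auto simp: dependent_sets_def)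
  have c: "card (?\<chi> \<inter> {1..n}) = card {i\<in>{1..r}. n + i \<notin> ?\<chi>}"
    by (rule card_U_minor_sets) (use card_compl[OF X'(1,2)] in auto)
  have "minor (\<lambda>i k. u i k) {i\<in>{1..r}. n + i \<notin> ?\<chi>} (?\<chi> \<inter> {1..n}) = 0"
    using X'(3) minor_transpose[OF c, of "\<lambda>k i. u i k"] by (simp only: U_minor_def)
  then have "\<exists>v. (\<exists>k\<in>?\<chi> \<inter> {1..n}. v k \<noteq> 0) \<and>
      (\<forall>i\<in>{i\<in>{1..r}. n + i \<notin> ?\<chi>}. (\<Sum>k\<in>?\<chi> \<inter> {1..n}. u i k * v k) = 0)"
    by (subst (asm) minor_eq_0_iff[OF _ _ c[symmetric]]) simp_all
  then obtain v k0 where v: "k0 \<in> ?\<chi> \<inter> {1..n}" "v k0 \<noteq> 0"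
    "\<And>i. i \<in> {i\<in>{1..r}. n + i \<notin> ?\<chi>} \<Longrightarrow> (\<Sum>k\<in>?\<chi> \<inter> {1..n}. u i k * v k) = 0"
    by blast
  \<comment> \<open>At a common zero the coordinates \<open>x\<^sub>k\<close> with
    \<open>k \<in> X\<close> are 0; the remaining ones come from the kernel of the transposed
    submatrix of \<open>U\<close>.\<close>
  define v' where "v' k = (if k \<in> ?\<chi> then v k else 0)" for k
  have v'0: "(\<Sum>k=1..n. form_coeff n u m k * v' k) = 0" if m: "m \<in> X" for m
  proof (cases "m \<le> n")
    case True
    then show ?thesis using m by (intro sum.neutral) (auto simp: form_coeff_def v'_def)
  next
    case False
    have "(\<Sum>k=1..n. form_coeff n u m k * v' k) = (\<Sum>k\<in>?\<chi> \<inter> {1..n}. u (m - n) k * v k)"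
      by (rule sum.mono_neutral_cong_right) (use False in \<open>auto simp: v'_def form_coeff_def\<close>)
    also have "\<dots> = 0" using False m X'(1) by (intro v(3)) auto
    finally show ?thesis .
  qed
  have "?h p = 0"
  proof (rule gen_ideal_kernel[OF h p[unfolded I_eq]])
    fix s assume "s \<in> I_gens"
    then obtain C where C: "C \<subseteq> {1..n + r - 1}" "card C = n" "s = minor (jacobian_dual n u) {1..n} C"
      unfolding I_gens_def by blast
    show "?h s = 0"
      unfolding C(3)
    proof (rule jacobian_minor_eq_0[OF h C(1,2) n_pos, of k0 "\<lambda>k. mconst (v' k)"])
      fix m assume m: "m \<in> {1..t}"
      have "(\<Sum>k=1..n. ?h (jac_col n u k m) * mconst (v' k)) =
          mconst (\<Sum>k=1..n. form_coeff n u m k * v' k) * ?h (mvar m)"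
        unfolding jac_col_def mconst.mpoly_eval_mult mconst.mpoly_eval_mconst mconst.hom_sum sum_distrib_right
          mconst.hom_mult
        by (rule sum.cong) (simp_all only: mult_ac)
      also have "\<dots> = 0"
      proof (cases "m \<in> X")
        case True
        then show ?thesis by (simp only: v'0 mconst.hom_zero mult_zero_left)
      qed simp
      finally show "(\<Sum>k=1..n. ?h (jac_col n u k m) * mconst (v' k)) = 0" .
    qed (use v in \<open>auto simp: v'_def\<close>)
  qed
  then show "p \<in> Q X" using p I_subset_KT by (auto simp: Q_eq_kernel)
qed

lemma Q_monomial:
  assumes X: "X \<subseteq> {1..t}" shows "monomial_ideal t (Q X)"
proof -
  let ?M = "mvar ` ({1..t} - X) :: 'k mpoly set"
  have M: "?M \<subseteq> KT" by (auto intro!: mvar_in_mpolys)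
  have "Q X = gen_ideal KT ?M"
  proof (intro equalityI subsetI)
    fix p assume p: "p \<in> Q X"
    have "Poly_Mapping.single e (lookup p e) \<in> gen_ideal KT ?M" if e: "e \<in> keys p" for e
    proof -
      obtain k where k: "k \<in> keys e" "k \<notin> X" using p e by (auto simp: Q_def)
      have eV: "keys e \<subseteq> {1..t}" using p e by (auto simp: Q_def mpolys_def)
      obtain w where w: "w \<in> KT" "mon_eval mvar e = w * (\<Prod>k\<in>{k}. mvar k :: 'k mpoly)"
        using mvar_prod_dvd_mon_eval[of "{k}" e "{1..t}"] k(1) eV by blast
      have "Poly_Mapping.single e (lookup p e) = (mconst (lookup p e) * w) * mvar k"
        using w(2) by (simp add: single_eq_mconst_mon_eval mult.assoc)
      also have "\<dots> \<in> gen_ideal KT ?M"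
        using w(1) k eV by (intro gen_ideal_mult_gen subring_setD(6)[OF subring_KT] mconst_in_mpolys) auto
      finally show ?thesis .
    qed
    then have "(\<Sum>e\<in>keys p. Poly_Mapping.single e (lookup p e)) \<in> gen_ideal KT ?M"
      by (rule gen_ideal_sum)
    then show "p \<in> gen_ideal KT ?M" using single_eq_sum_keys[of p] by simp
  next
    fix p assume p: "p \<in> gen_ideal KT ?M"
    then have "p \<in> KT" using gen_ideal_in[OF subring_KT M] by blast
    moreover have "mpoly_eval mconst (\<lambda>k. if k \<in> X then mvar k else 0) p = 0"
      by (rule gen_ideal_kernel[OF mconst.mpoly_eval_hom p]) auto
    ultimately show "p \<in> Q X" by (simp add: Q_eq_kernel)
  qed
  also have "\<dots> = Idl\<^bsub>ring_KT t\<^esub> ?M"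
    unfolding ring_KT_def by (rule genideal_mpoly_ring[OF subring_set_UNIV M, symmetric])
  finally show ?thesis
    unfolding monomial_ideal_def
    by (intro exI[of _ ?M]) (auto simp: mvar_def intro!: exI[of _ "Poly_Mapping.single _ _"])
qed

text \<open>
  Up to a unit, \<open>m\<^sub>\<Theta>\<close> is the determinant of the columns \<open>F\<^sub>z T\<^sub>z - F\<^sub>c T\<^sub>c\<close>, \<open>z \<in> Z\<close>, where \<open>Z \<union> {c}\<close>
  is the complement of \<open>\<Theta>\<close> and the forms in \<open>Z\<close> are a basis: in this basis the matrix is diagonal
  plus a matrix of rank one.
\<close>

lemma m_poly_in_I:
  assumes \<Theta>: "\<Theta> \<subseteq> {1..t}" "card \<Theta> = r - 1" and m0: "m_poly n r u \<Theta> \<noteq> 0"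
  shows "m_poly n r u \<Theta> \<in> I"
proof -
  let ?\<delta> = "cramer n r u \<Theta>"
  have "cramer_support n r u \<Theta> \<noteq> {}"
    using m0 m_poly_eq[OF \<Theta> r, of u] by (auto simp: circuit_rel_def)
  then obtain c where c: "c \<in> cramer_support n r u \<Theta>" by blast
  have c': "c \<in> {1..t}" "c \<notin> \<Theta>" "U_minor n r u (\<Theta> \<union> {c}) \<noteq> 0"
    using c unfolding cramer_support_iff by auto
  have \<delta>c: "?\<delta> c \<noteq> 0" using c by (simp add: cramer_support_def)
  define Z where "Z = E \<Theta> - {c}"
  have f\<Theta>: "finite \<Theta>" using \<Theta>(1) finite_subset by blast
  have EZ: "E \<Theta> = insert c Z" "c \<notin> Z" "finite Z" "Z \<subseteq> {1..t}" using c' by (auto simp: Z_def)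
  have "card (E \<Theta>) = n + 1" using card_Diff_subset[OF f\<Theta> \<Theta>(1)] \<Theta>(2) r by simp
  then have cZ: "card Z = n" using EZ by simp
  define d where "d z = ?\<delta> z / ?\<delta> c" for z
  have dep: "dependency n r u ?\<delta>" by (rule dependency_cramer[OF \<Theta> r])
  have fc: "form_coeff n u c k = - (\<Sum>z\<in>Z. form_coeff n u z k * d z)" if k: "k \<in> {1..n}" for k
  proof -
    have "0 = (\<Sum>m=1..t. ?\<delta> m * form_coeff n u m k)"
      using dep k unfolding sum_form_coeff[OF k] dependency_def by simp
    also have "\<dots> = (\<Sum>m\<in>insert c Z. ?\<delta> m * form_coeff n u m k)"
      by (rule sum.mono_neutral_right) (auto simp: EZ(1)[symmetric] cramer_def)
    also have "\<dots> = ?\<delta> c * form_coeff n u c k + (\<Sum>z\<in>Z. ?\<delta> z * form_coeff n u z k)"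
      using EZ by simp
    finally have "?\<delta> c * form_coeff n u c k = - (\<Sum>z\<in>Z. ?\<delta> z * form_coeff n u z k)"
      by (simp add: eq_neg_iff_add_eq_0)
    then have "form_coeff n u c k = - (\<Sum>z\<in>Z. ?\<delta> z * form_coeff n u z k) / ?\<delta> c"
      using \<delta>c by (simp add: field_simps)
    also have "\<dots> = - (\<Sum>z\<in>Z. form_coeff n u z k * d z)"
      by (simp add: d_def sum_divide_distrib mult_ac)
    finally show ?thesis .
  qed
  let ?G = "\<lambda>k z. mconst (form_coeff n u z k) :: 'k mpoly"
  \<comment> \<open>Column \<open>z\<close> holds the coordinates of
    \<open>F\<^sub>z T\<^sub>z - F\<^sub>c T\<^sub>c\<close> with respect to the forms in
    \<open>Z\<close>, where \<open>F\<^sub>c = - \<Sum> d\<^sub>z F\<^sub>z\<close>. The summand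
    from \<open>F\<^sub>c T\<^sub>c\<close> is the same in all columns, hence the rank one.\<close>
  let ?N = "\<lambda>z' z. (if z' = z then mvar z' else 0) + mvar c * mconst (d z') :: 'k mpoly"
  let ?m = "minor ?N Z Z"
  \<comment> \<open>The difference of the tree paths from \<open>z\<close> and from \<open>c\<close>
    to the centre writes \<open>F\<^sub>z T\<^sub>z - F\<^sub>c T\<^sub>c\<close> as a combination
    of columns of \<open>B\<close>.\<close>
  have "minor (\<lambda>k z. \<Sum>j\<in>{1..t - 1}. jacobian_dual n u k j * (path_coeff n j z - path_coeff n j c)) {1..n} Z \<in> I"
    unfolding I_eq
  proof (rule minor_column_combination[OF _ subring_KT])
    show "path_coeff n j z - path_coeff n j c \<in> KT" for j z
      using subring_setD(1-3)[OF subring_KT] by (simp add: path_coeff_def)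
    show "minor (jacobian_dual n u) {1..n} C \<in> gen_ideal KT I_gens" if "C \<subseteq> {1..t - 1}" "card C = card Z" for C
      using that cZ by (intro gen_ideal_gen[OF subring_KT]) (auto simp: I_gens_def)
  qed (simp_all add: cZ)
  also have "minor (\<lambda>k z. \<Sum>j\<in>{1..t - 1}. jacobian_dual n u k j * (path_coeff n j z - path_coeff n j c)) {1..n} Z =
      minor (\<lambda>k z. \<Sum>z'\<in>Z. ?G k z' * ?N z' z) {1..n} Z"
  proof (rule minor_cong)
    fix k z assume k: "k \<in> {1..n}" and z: "z \<in> Z"
    have zt: "z \<in> {1..t}" using z EZ by blast
    have "(\<Sum>j\<in>{1..t - 1}. jacobian_dual n u k j * (path_coeff n j z - path_coeff n j c)) =
        jac_col n u k z - jac_col n u k c"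
      unfolding right_diff_distrib sum_subtractf jac_col_diff[OF k zt] jac_col_diff[OF k c'(1)] by simp
    also have "jac_col n u k c = - (\<Sum>z'\<in>Z. ?G k z' * (mvar c * mconst (d z')))"
      unfolding jac_col_def fc[OF k]
      by (simp add: mconst.hom_uminus mconst.hom_sum mconst.hom_mult sum_distrib_left mult_ac)
    also have "jac_col n u k z = (\<Sum>z'\<in>Z. if z' = z then ?G k z * mvar z else 0)"
      using z EZ(3) by (simp add: jac_col_def)
    also have "\<dots> = (\<Sum>z'\<in>Z. ?G k z' * (if z' = z then mvar z' else 0))"
      by (rule sum.cong) auto
    finally show "(\<Sum>j\<in>{1..t - 1}. jacobian_dual n u k j * (path_coeff n j z - path_coeff n j c)) =
        (\<Sum>z'\<in>Z. ?G k z' * ?N z' z)"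
      by (simp only: diff_minus_eq_add sum.distrib[symmetric] distrib_left)
  qed (simp_all add: EZ)
  also have "\<dots> = minor ?G {1..n} Z * ?m"
    by (rule minor_mult) (simp_all add: EZ cZ)
  also have "minor ?G {1..n} Z = mconst (minor (\<lambda>k z. form_coeff n u z k) {1..n} Z)"
    by (rule minor_hom[OF comm_ring_hom_mconst, symmetric]) (simp add: cZ)
  finally have I1: "mconst (minor (\<lambda>k z. form_coeff n u z k) {1..n} Z) * ?m \<in> I" .
  have "minor (\<lambda>k z. form_coeff n u z k) {1..n} Z \<noteq> 0"
  proof
    assume "minor (\<lambda>k z. form_coeff n u z k) {1..n} Z = 0"
    then obtain v z where v: "z \<in> Z" "v z \<noteq> 0"
      "\<And>k. k \<in> {1..n} \<Longrightarrow> (\<Sum>z\<in>Z. form_coeff n u z k * v z) = 0"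
      using EZ(3) cZ by (subst (asm) minor_eq_0_iff) auto
    define b where "b m = (if m \<in> Z then v m else 0)" for m
    have "dependency n r u b"
      unfolding dependency_def
    proof
      fix k assume k: "k \<in> {1..n}"
      have "(\<Sum>m=1..t. b m * form_coeff n u m k) = (\<Sum>z\<in>Z. form_coeff n u z k * v z)"
        by (rule sum.mono_neutral_cong_right) (use EZ in \<open>auto simp: b_def mult.commute\<close>)
      then show "b k + (\<Sum>i=1..r. b (n + i) * u i k) = 0"
        using v(3)[OF k] sum_form_coeff[OF k, where b = b and r = r and u = u] by simp
    qed
    moreover have "b k = 0" if "k \<in> \<Theta> \<union> {c}" for k using that by (auto simp: b_def Z_def)
    moreover have "\<Theta> \<union> {c} \<subseteq> {1..t}" "card (\<Theta> \<union> {c}) = r" using \<Theta> c' f\<Theta> r by auto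
    ultimately have "b z = 0"
      using U_minor_neq_0_dependency[OF _ _ c'(3)] v(1) EZ(4) by blast
    then show False using v by (simp add: b_def)
  qed
  then obtain e where e: "e * minor (\<lambda>k z. form_coeff n u z k) {1..n} Z = 1"
    by (metis left_inverse)
  have "mconst (?\<delta> c * e) * (mconst (minor (\<lambda>k z. form_coeff n u z k) {1..n} Z) * ?m) \<in> I"
    unfolding I_eq
    by (rule gen_ideal_mult[OF subring_KT mconst_in_mpolys I1[unfolded I_eq]]) simp_all
  also have "mconst (?\<delta> c * e) * (mconst (minor (\<lambda>k z. form_coeff n u z k) {1..n} Z) * ?m) = mconst (?\<delta> c) * ?m"
    by (simp only: mult.assoc[symmetric] mconst.hom_mult[symmetric]) (simp only: mult.assoc e mult_1_right)
  also have "?m = (\<Prod>z\<in>Z. mvar z) + (\<Sum>z\<in>Z. mvar c * mconst (d z) * (\<Prod>b\<in>Z - {z}. mvar b))"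
    by (rule minor_diag_plus_rank_one[OF EZ(3)]) simp
  also have "mconst (?\<delta> c) * \<dots> = m_poly n r u \<Theta>"
  proof -
    have "mconst (?\<delta> c) * (\<Sum>z\<in>Z. mvar c * mconst (d z) * (\<Prod>b\<in>Z - {z}. mvar b)) =
        (\<Sum>z\<in>Z. mvar c * (mconst (?\<delta> z) * (\<Prod>b\<in>Z - {z}. mvar b)))"
      unfolding sum_distrib_left
    proof (rule sum.cong)
      fix z
      have "mconst (?\<delta> z) = mconst (?\<delta> c) * mconst (d z)"
        using \<delta>c by (simp add: d_def mconst.hom_mult[symmetric])
      then show "mconst (?\<delta> c) * (mvar c * mconst (d z) * (\<Prod>b\<in>Z - {z}. mvar b)) =
        mvar c * (mconst (?\<delta> z) * (\<Prod>b\<in>Z - {z}. mvar b))"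
        by (simp add: mult_ac)
    qed simp
    also have "\<dots> = mvar c * circuit_rel ?\<delta> Z"
      by (simp add: circuit_rel_def sum_distrib_left)
    finally show ?thesis
      unfolding m_poly_eq_circuit_rel[OF \<Theta> r] EZ(1) circuit_rel_insert[OF EZ(3,2)]
      by (simp add: distrib_left add.commute)
  qed
  finally show ?thesis .
qed

end

section \<open>Primality of \<open>P\<close>\<close>

context star
begin

lemma P_prime: "x \<in> KT \<Longrightarrow> y \<in> KT \<Longrightarrow> x * y \<in> P \<Longrightarrow> x \<in> P \<or> y \<in> P"
proof -
  interpret h: comm_ring_hom "\<lambda>p. ext_rees_map (F n u) t (KT_to_S p)"
    by (rule comm_ring_hom_comp[OF ext_rees_map_hom KT_to_S_hom])
  show "x \<in> KT \<Longrightarrow> y \<in> KT \<Longrightarrow> x * y \<in> P \<Longrightarrow> x \<in> P \<or> y \<in> P"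
    by (auto simp: P_eq_kernel h.hom_mult)
qed

lemma P_mult: "x \<in> P \<Longrightarrow> c \<in> KT \<Longrightarrow> c * x \<in> P"
  unfolding P_eq by (rule gen_ideal_mult[OF subring_KT])

lemma monomial_notin_P:
  assumes "keys e \<subseteq> {1..t}" shows "mon_eval mvar e \<notin> P"
proof -
  interpret h: comm_ring_hom "\<lambda>p. ext_rees_map (F n u) t (KT_to_S p)"
    by (rule comm_ring_hom_comp[OF ext_rees_map_hom KT_to_S_hom])
  have "ext_rees_map (F n u) t (KT_to_S (mon_eval mvar e)) =
      (\<Prod>k\<in>keys e. Polynomial.monom (\<Prod>j\<in>{1..t} - {k}. F n u j) 1 ^ lookup e k)"
    unfolding mon_eval_def h.hom_prod h.hom_power by simp
  also have "\<dots> \<noteq> 0" using F_nonzero by auto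
  finally show ?thesis by (auto simp: P_eq_kernel)
qed

lemma one_notin_P: "1 \<notin> P"
  using monomial_notin_P[of 0] by simp

lemma primeideal_P: "primeideal P (ring_KT t)"
proof -
  interpret cring "ring_KT t :: 'k mpoly ring"
    unfolding ring_KT_def by (rule cring_mpoly_ring) simp
  have c: "carrier (ring_KT t :: 'k mpoly ring) = KT" by (simp add: ring_KT_def)
  show ?thesis
  proof (rule primeidealI)
    show "ideal P (ring_KT t)"
      unfolding P_ideal_def h_polys_def[symmetric]
      by (rule genideal_ideal) (use h_polys_in_KT c in blast)
    show "carrier (ring_KT t) \<noteq> P"
      unfolding c using one_notin_P subring_setD(1)[OF subring_KT] by blast
    fix a b assume "a \<in> carrier (ring_KT t)" "b \<in> carrier (ring_KT t)" "a \<otimes>\<^bsub>ring_KT t\<^esub> b \<in> P"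
    then show "a \<in> P \<or> b \<in> P" unfolding c by (intro P_prime) (simp_all add: ring_KT_def)
  qed (rule cring_axioms)
qed

end

section \<open>Decomposition and associated primes of the ideal of maximal minors\<close>

locale general_star = star n r u for n r :: nat and u :: "nat \<Rightarrow> nat \<Rightarrow> 'k::field" +
  assumes m_nonzero: "\<And>\<Theta>. \<Theta> \<subseteq> {1..t} \<Longrightarrow> card \<Theta> = r - 1 \<Longrightarrow> m_poly n r u \<Theta> \<noteq> 0"
begin

text \<open>A nonzero \<open>m\<^sub>\<Theta>\<close> has a nonzero coefficient
  \<open>U\<^sub>\<chi>\<close> with \<open>\<chi> = \<Theta> \<union> {k}\<close>. So
  \<open>n\<close> of the forms outside \<Theta> are independent, and
  \<open>dependency_unique\<close> applies to \<Theta>.\<close>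

lemma cramer_support_nonempty:
  assumes "\<Theta> \<subseteq> {1..t}" "card \<Theta> = r - 1"
  obtains k where "k \<in> cramer_support n r u \<Theta>"
proof -
  have "cramer_support n r u \<Theta> \<noteq> {}"
    using m_nonzero[OF assms] m_poly_eq[OF assms r, of u] by (auto simp: circuit_rel_def)
  then show ?thesis using that by blast
qed

text \<open>
  The circuit of \<open>\<Theta>\<close> is, up to a scalar, also that of the complement of any \<open>n + 1\<close> indices containing
  its support, so \<open>m\<^sub>\<Theta>\<^sub>'\<close> for such a complement \<open>\<Theta>'\<close> divides the given product up to a scalar.
\<close>

lemma monomial_times_h_poly_in_I:
  assumes \<Theta>: "\<Theta> \<subseteq> {1..t}" "card \<Theta> = r - 1" and e: "keys e \<subseteq> {1..t}"
    and large: "card (cramer_support n r u \<Theta> \<union> keys e) \<ge> n + 1"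
  shows "mon_eval mvar e * h_poly n r u \<Theta> \<in> I"
proof -
  let ?C = "cramer_support n r u \<Theta>"
  have f\<Theta>: "finite \<Theta>" using \<Theta>(1) finite_subset by blast
  have CE: "?C \<subseteq> E \<Theta>" by (auto simp: cramer_support_def cramer_def)
  have "card (E \<Theta>) = n + 1" using card_Diff_subset[OF f\<Theta> \<Theta>(1)] \<Theta>(2) r by simp
  then have cC: "card ?C \<le> n + 1" using card_mono[OF _ CE] by simp
  have finC: "finite ?C" using CE finite_subset by blast
  \<comment> \<open>The support is enlarged to exactly \<open>n + 1\<close> indices using variables
    of the monomial alone, so that the factor between \<open>h\<close> and \<open>m\<close> divides
    the monomial.\<close>
  obtain W where W: "?C \<subseteq> W" "W \<subseteq> ?C \<union> keys e" "card W = n + 1"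
    using exists_subset_between[OF cC large] finC by auto
  have Wt: "W \<subseteq> {1..t}" using W(2) CE e by blast
  have finW: "finite W" using Wt finite_subset by blast
  define \<Theta>' where "\<Theta>' = {1..t} - W"
  have \<Theta>': "\<Theta>' \<subseteq> {1..t}" "card \<Theta>' = r - 1"
    using card_Diff_subset[OF finW Wt] W(3) r by (auto simp: \<Theta>'_def)
  have EW: "E \<Theta>' = W" using Wt by (auto simp: \<Theta>'_def)
  let ?C' = "cramer_support n r u \<Theta>'"
  obtain k where k: "k \<in> ?C'" by (rule cramer_support_nonempty[OF \<Theta>'])
  obtain k0 where k0: "k0 \<in> ?C" by (rule cramer_support_nonempty[OF \<Theta>])
  define b where "b = cramer n r u \<Theta> k / cramer n r u \<Theta>' k"
  have zero: "cramer n r u \<Theta> j = 0" if "j \<in> \<Theta>'" for j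
    using that W(1) by (auto simp: \<Theta>'_def cramer_support_def)
  \<comment> \<open>Both Cramer dependencies vanish outside \<open>W\<close>, where up to scalars
    there is only one.\<close>
  have eq: "cramer n r u \<Theta> j = b * cramer n r u \<Theta>' j" if "j \<in> {1..t}" for j
    unfolding b_def by (rule dependency_unique[OF \<Theta>' r k dependency_cramer[OF \<Theta> r] zero that])
  have b0: "b \<noteq> 0" using eq[of k0] k0 by (auto simp: cramer_support_def)
  have CC': "?C' = ?C" using eq b0 by (auto simp: cramer_support_def)
  have "circuit_rel (cramer n r u \<Theta>) ?C = mconst b * circuit_rel (cramer n r u \<Theta>') ?C"
    unfolding circuit_rel_def sum_distrib_left
  proof (rule sum.cong)
    fix i assume "i \<in> ?C"
    then have "i \<in> {1..t}" by (simp add: cramer_support_def)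
    from eq[OF this] show "mconst (cramer n r u \<Theta> i) * (\<Prod>j\<in>?C - {i}. mvar j) =
        mconst b * (mconst (cramer n r u \<Theta>' i) * (\<Prod>j\<in>?C - {i}. mvar j))"
      by (simp only: mconst.hom_mult mult.assoc)
  qed simp
  then have h: "h_poly n r u \<Theta> = mconst b * circuit_rel (cramer n r u \<Theta>') ?C'"
    unfolding h_poly_eq[OF \<Theta> r] CC' .
  have "W - ?C' \<subseteq> keys e" using W(2) CC' by blast
  then obtain w where w: "w \<in> KT" "mon_eval mvar e = w * (\<Prod>k\<in>W - ?C'. mvar k :: 'k mpoly)"
    using mvar_prod_dvd_mon_eval e by blast
  have "mon_eval mvar e * h_poly n r u \<Theta> = (mconst b * w) * m_poly n r u \<Theta>'"
    unfolding h w(2) m_poly_eq[OF \<Theta>' r] EW by (simp add: mult_ac)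
  also have "\<dots> \<in> I"
    unfolding I_eq
    by (rule gen_ideal_mult[OF subring_KT _ m_poly_in_I[OF \<Theta>' m_nonzero[OF \<Theta>'], unfolded I_eq]])
       (simp add: mpolys_mult mconst_in_mpolys w(1)[unfolded One_nat_def])
  finally show ?thesis .
qed

text \<open>Any \<open>n\<close>-set containing the support of the Cramer dependency will do: a
  nonzero minor of its complement would force that dependency to be 0.\<close>

lemma small_support_dependent:
  assumes \<Theta>: "\<Theta> \<subseteq> {1..t}" "card \<Theta> = r - 1" and e: "keys e \<subseteq> {1..t}"
    and small: "card (cramer_support n r u \<Theta> \<union> keys e) \<le> n"
  obtains X where "X \<in> dependent_sets" "cramer_support n r u \<Theta> \<union> keys e \<subseteq> X"
proof -
  let ?C = "cramer_support n r u \<Theta>"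
  have Ct: "?C \<union> keys e \<subseteq> {1..t}" using e by (auto simp: cramer_support_def)
  obtain X where X: "?C \<union> keys e \<subseteq> X" "X \<subseteq> {1..t}" "card X = n"
    using exists_subset_between[OF small _ Ct] by auto
  obtain k where k: "k \<in> ?C" by (rule cramer_support_nonempty[OF \<Theta>])
  have "U_minor n r u ({1..t} - X) = 0"
  proof (rule ccontr)
    assume "U_minor n r u ({1..t} - X) \<noteq> 0"
    moreover have "cramer n r u \<Theta> j = 0" if "j \<in> {1..t} - X" for j
      using that X(1) by (auto simp: cramer_support_def)
    moreover have "k \<in> {1..t}" using k by (simp add: cramer_support_def)
    ultimately have "cramer n r u \<Theta> k = 0"
      using U_minor_neq_0_dependency[OF Diff_subset card_compl[OF X(2,3)] _ dependency_cramer[OF \<Theta> r]]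
      by blast
    then show False using k by (simp add: cramer_support_def)
  qed
  then show ?thesis using X that by (auto simp: dependent_sets_def)
qed

lemma P_decompose:
  assumes "p \<in> P"
  shows "\<exists>a\<in>I. \<exists>b. p = a + b \<and> (\<forall>e\<in>keys b. \<exists>X\<in>dependent_sets. keys e \<subseteq> X)"
proof -
  let ?B = "{b :: 'k mpoly. \<forall>e\<in>keys b. \<exists>X\<in>dependent_sets. keys e \<subseteq> X}"
  let ?T = "{p. \<exists>a\<in>I. \<exists>b\<in>?B. p = a + b}"
  have I0: "0 \<in> I" by (simp add: I_eq gen_ideal.zero)
  have B0: "0 \<in> ?B" by simp
  have T0: "0 \<in> ?T" using I0 B0 by force
  have Tadd: "x + y \<in> ?T" if x: "x \<in> ?T" and y: "y \<in> ?T" for x y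
  proof -
    obtain a b where ab: "a \<in> I" "b \<in> ?B" "x = a + b" using x by blast
    obtain a' b' where ab': "a' \<in> I" "b' \<in> ?B" "y = a' + b'" using y by blast
    have "a + a' \<in> I" using ab ab' by (simp add: I_eq gen_ideal_add)
    moreover have "b + b' \<in> ?B" using ab(2) ab'(2) keys_add[of b b'] by blast
    moreover have "x + y = (a + a') + (b + b')" by (simp add: ab ab')
    ultimately show ?thesis by blast
  qed
  have "gen_ideal KT (h_polys n r u) \<subseteq> ?T"
  proof (rule gen_ideal_subset[OF T0 Tadd])
    fix c s assume c: "c \<in> KT" and "s \<in> h_polys n r u"
    then obtain \<Theta> where \<Theta>: "\<Theta> \<subseteq> {1..t}" "card \<Theta> = r - 1" and s: "s = h_poly n r u \<Theta>"
      unfolding h_polys_def by blast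
    let ?C = "cramer_support n r u \<Theta>"
    have sC: "s \<in> mpolys UNIV ?C"
      unfolding s h_poly_eq[OF \<Theta> r] by (rule circuit_rel_in_mpolys) auto
    have trm: "mconst (lookup c e) * (mon_eval mvar e * s) \<in> ?T" if e: "e \<in> keys c" for e
    proof -
      have et: "keys e \<subseteq> {1..t}" using c e by (auto simp: mpolys_def)
      show ?thesis
      proof (cases "card (?C \<union> keys e) \<ge> n + 1")
        case True
        have "mconst (lookup c e) * (mon_eval mvar e * s) \<in> I"
          using gen_ideal_mult[OF subring_KT mconst_in_mpolys
              monomial_times_h_poly_in_I[OF \<Theta> et True, unfolded I_eq]]
          unfolding I_eq s by simp
        then show ?thesis using B0 by force
      next
        case False
        then obtain X where X: "X \<in> dependent_sets" "?C \<union> keys e \<subseteq> X"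
          using small_support_dependent[OF \<Theta> et] by auto
        have "s \<in> mpolys UNIV X" using sC mpolys_mono[of UNIV UNIV ?C X] X(2) by blast
        moreover have "mon_eval mvar e \<in> mpolys UNIV X"
          using X(2) by (intro mon_eval_in subring_set_mpolys mvar_in_mpolys) auto
        ultimately have "mconst (lookup c e) * (mon_eval mvar e * s) \<in> mpolys UNIV X"
          by (intro mpolys_mult mconst_in_mpolys) auto
        then have "mconst (lookup c e) * (mon_eval mvar e * s) \<in> ?B"
          using X(1) by (auto simp: mpolys_def)
        then show ?thesis using I0 by force
      qed
    qed
    have "(\<Sum>e\<in>A. mconst (lookup c e) * (mon_eval mvar e * s)) \<in> ?T" if "finite A" "A \<subseteq> keys c" for A
      using that
    proof (induction A)
      case empty
      show ?case unfolding sum.empty by (rule T0)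
    next
      case (insert e A)
      then show ?case
        unfolding sum.insert[OF insert.hyps] by (intro Tadd trm insert.IH) auto
    qed
    from this[of "keys c"] have "(\<Sum>e\<in>keys c. mconst (lookup c e) * (mon_eval mvar e * s)) \<in> ?T"
      by simp
    moreover have "(\<Sum>e\<in>keys c. mconst (lookup c e) * (mon_eval mvar e * s)) = c * s"
    proof -
      have "c * s = (\<Sum>e\<in>keys c. mconst (lookup c e) * mon_eval mvar e) * s"
        using single_eq_sum_keys[of c] by (simp add: single_eq_mconst_mon_eval)
      then show ?thesis by (simp add: sum_distrib_right mult.assoc)
    qed
    ultimately show "c * s \<in> ?T" by (simp only:)
  qed
  then show ?thesis using assms unfolding P_eq by blast
qed

lemma I_eq_Int: "I = {p \<in> P. \<forall>X\<in>dependent_sets. p \<in> Q X}"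
proof (intro equalityI subsetI)
  fix p assume "p \<in> {p \<in> P. \<forall>X\<in>dependent_sets. p \<in> Q X}"
  then have p: "p \<in> P" "\<And>X. X \<in> dependent_sets \<Longrightarrow> p \<in> Q X" by auto
  obtain a b where ab: "a \<in> I" "p = a + b" "\<And>e. e \<in> keys b \<Longrightarrow> \<exists>X\<in>dependent_sets. keys e \<subseteq> X"
    using P_decompose[OF p(1)] by blast
  \<comment> \<open>A monomial of \<open>b\<close> supported in \<open>X\<close> would have to occur
    in \<open>p\<close> or in \<open>a\<close>, but both belong to \<open>Q X\<close>.\<close>
  have "keys b = {}"
  proof (rule ccontr)
    assume "keys b \<noteq> {}"
    then obtain e X where e: "e \<in> keys b" "X \<in> dependent_sets" "keys e \<subseteq> X" using ab(3) by blast
    have "e \<in> keys (p - a)" using e(1) ab(2) by simp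
    then have "e \<in> keys p \<or> e \<in> keys a" using keys_diff[of p a] by blast
    moreover have "a \<in> Q X" using ab(1) I_subset_Q[OF e(2)] by blast
    ultimately show False using p(2)[OF e(2)] e(3) by (auto simp: Q_def)
  qed
  then show "p \<in> I" using ab by simp
qed (use I_subset_P I_subset_Q in blast)

text \<open>\<open>P\<close> is the annihilator of \<open>s = T\<^sub>1 \<cdots> T\<^sub>t\<close>
  modulo \<open>I\<close>: since every \<open>X\<close> has \<open>n < t\<close> elements,
  \<open>s\<close> lies in all \<open>Q X\<close>, while no monomial lies in the prime
  \<open>P\<close>.\<close>

lemma associated_prime_P: "associated_prime (ring_KT t) I P"
proof -
  define e where "e = (\<Sum>k=1..t. Poly_Mapping.single k (1::nat))"
  have le: "lookup e k = (if k \<in> {1..t} then 1 else 0)" for k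
    by (simp add: e_def lookup_sum lookup_single when_def)
  have ke: "keys e = {1..t}" by (auto simp: in_keys_iff le split: if_splits)
  define s where "s = (mon_eval mvar e :: 'k mpoly)"
  have s: "s \<in> KT" "s \<notin> P"
    unfolding s_def using monomial_notin_P[of e] ke
    by (auto intro!: mon_eval_in subring_set_mpolys mvar_in_mpolys)
  have sQ: "s \<in> Q X" if X: "X \<in> dependent_sets" for X
  proof -
    have "\<not> {1..t} \<subseteq> X"
    proof
      assume "{1..t} \<subseteq> X"
      then have "X = {1..t}" using X by (auto simp: dependent_sets_def)
      then show False using X r by (auto simp: dependent_sets_def)
    qed
    moreover have "s = Poly_Mapping.single e 1" by (simp add: s_def single_eq_mconst_mon_eval)
    ultimately show ?thesis using s(1) ke by (auto simp: Q_def)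
  qed
  have "P = {b \<in> KT. b * s \<in> I}"
  proof (intro equalityI subsetI)
    fix b assume b: "b \<in> P"
    then have bK: "b \<in> KT" using P_subset_KT by blast
    have "b * s \<in> P" using P_mult[OF b s(1)] by (simp add: mult.commute)
    then show "b \<in> {b \<in> KT. b * s \<in> I}" using bK Q_mult[OF sQ bK] by (simp add: I_eq_Int)
  next
    fix b assume "b \<in> {b \<in> KT. b * s \<in> I}"
    then show "b \<in> P" using P_prime[of b s] s I_subset_P by blast
  qed
  then have "P = {b \<in> carrier (ring_KT t). b \<otimes>\<^bsub>ring_KT t\<^esub> s \<in> I}"
    by (simp add: ring_KT_def)
  moreover have "s \<in> carrier (ring_KT t)" using s(1) by (simp add: ring_KT_def)
  ultimately show ?thesis unfolding associated_prime_def using primeideal_P by blast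
qed

text \<open>\<open>P\<close> contains no monomial, so monomial generators would make it zero,
  against \<open>h\<^sub>\<Theta> \<noteq> 0\<close>.\<close>

lemma not_monomial_P: "\<not> monomial_ideal t P"
proof
  assume "monomial_ideal t P"
  then obtain M where M: "M \<subseteq> {Poly_Mapping.single e 1 | e. keys e \<subseteq> {1..t}}" "P = Idl\<^bsub>ring_KT t\<^esub> M"
    unfolding monomial_ideal_def by blast
  have MK: "M \<subseteq> KT" using M(1) by (auto intro!: single_in_mpolys)
  have P: "P = gen_ideal KT M"
    unfolding M(2) ring_KT_def by (rule genideal_mpoly_ring[OF subring_set_UNIV MK])
  have "M = {}"
  proof (rule ccontr)
    assume "M \<noteq> {}"
    then obtain e where e: "Poly_Mapping.single e 1 \<in> M" "keys e \<subseteq> {1..t}" using M(1) by blast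
    have "Poly_Mapping.single e 1 \<in> P" unfolding P by (rule gen_ideal_gen[OF subring_KT e(1)])
    then show False using monomial_notin_P[OF e(2)] by (simp add: single_eq_mconst_mon_eval)
  qed
  then have P0: "P \<subseteq> {0}" unfolding P by (intro gen_ideal_subset) auto
  \<comment> \<open>Any \<Theta> of the right size serves here.\<close>
  have \<Theta>: "{1..r - 1} \<subseteq> {1..t}" "card {1..r - 1} = r - 1" by auto
  have "h_poly n r u {1..r - 1} \<in> P"
    unfolding P_eq by (rule gen_ideal_gen[OF subring_KT]) (use \<Theta> in \<open>auto simp: h_polys_def\<close>)
  then have "h_poly n r u {1..r - 1} = 0" using P0 by blast
  then show False using m_nonzero[OF \<Theta>] unfolding m_poly_eq[OF \<Theta> r] h_poly_eq[OF \<Theta> r] by simp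
qed

text \<open>Since \<open>I\<close> is an intersection of finitely many primes, its quotient by
  \<open>a\<close> is the intersection of those primes \<open>q\<close> with
  \<open>a \<notin> q\<close>. A prime equal to this intersection contains one such
  \<open>q\<close>, and is contained in it.\<close>

lemma associated_prime_cases:
  assumes "associated_prime (ring_KT t) I p"
  shows "p = P \<or> (\<exists>X\<in>dependent_sets. p = Q X)"
proof -
  obtain a where a: "a \<in> KT" "p = {b \<in> KT. b * a \<in> I}" and prime: "primeideal p (ring_KT t)"
    using assms by (auto simp: associated_prime_def ring_KT_def)
  have c: "carrier (ring_KT t :: 'k mpoly ring) = KT" by (simp add: ring_KT_def)
  interpret primeideal p "ring_KT t" by (rule prime)
  have pr: "x \<in> p \<or> y \<in> p" if "x \<in> KT" "y \<in> KT" "x * y \<in> p" for x y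
    using I_prime[of x y] that by (simp add: ring_KT_def)
  let ?\<A> = "insert P (Q ` dependent_sets)"
  let ?\<Q> = "{q \<in> ?\<A>. a \<notin> q}"
  have fin: "finite ?\<Q>"
    by (auto simp: dependent_sets_def intro: finite_subset[of _ "Pow {1..t}"])
  have qK: "q \<subseteq> KT" if "q \<in> ?\<A>" for q using that P_subset_KT by (auto simp: Q_def)
  have qmult: "c * x \<in> q" if "q \<in> ?\<A>" "x \<in> q" "c \<in> KT" for q x c
    using that P_mult Q_mult by auto
  have qprime: "x \<in> q \<or> y \<in> q" if "q \<in> ?\<A>" "x \<in> KT" "y \<in> KT" "x * y \<in> q" for q x y
    using that(1,4) P_prime[OF that(2,3)] Q_prime[OF that(2,3)] by blast
  have I: "x \<in> I \<longleftrightarrow> (\<forall>q\<in>?\<A>. x \<in> q)" for x by (auto simp: I_eq_Int)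
  have one: "1 \<notin> p"
  proof
    assume "1 \<in> p"
    then have aI: "a \<in> I" using a(2) by simp
    have "x \<in> p" if x: "x \<in> KT" for x
      using gen_ideal_mult[OF subring_KT x aI[unfolded I_eq]] x unfolding a(2) I_eq by simp
    then have "p = carrier (ring_KT t)" using a(2) c by blast
    then show False using I_notcarr by simp
  qed
  have "\<exists>q\<in>?\<Q>. q \<subseteq> p"
  proof (rule finite_Inter_in_prime[OF fin subring_KT one pr])
    fix x assume x: "x \<in> KT" "\<And>q. q \<in> ?\<Q> \<Longrightarrow> x \<in> q"
    have "x * a \<in> q" if q: "q \<in> ?\<A>" for q
    proof (cases "a \<in> q")
      case True
      then show ?thesis by (rule qmult[OF q _ x(1)])
    next
      case False
      then have "x \<in> q" using x(2) q by blast
      then show ?thesis unfolding mult.commute[of x a] by (rule qmult[OF q _ a(1)])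
    qed
    then show "x \<in> p" unfolding a(2) I using x(1) by blast
  next
    show "q \<subseteq> KT" if "q \<in> ?\<Q>" for q by (rule qK) (use that in blast)
    show "c * x \<in> q" if "q \<in> ?\<Q>" "x \<in> q" "c \<in> KT" for q x c
      using that(1) by (intro qmult[OF _ that(2,3)]) blast
  qed
  then obtain q where q: "q \<in> ?\<A>" "a \<notin> q" "q \<subseteq> p" by blast
  have "x \<in> q" if "x \<in> p" for x
    using that qprime[OF q(1) _ a(1), of x] q(1,2) unfolding a(2) I by blast
  then have "p = q" using q(3) by blast
  then show ?thesis using q(1) by blast
qed

theorem nonmonomial_associated_primes:
  "{p. associated_prime (ring_KT t) I p \<and> \<not> monomial_ideal t p} = {P}"
proof (intro equalityI subsetI)
  fix p assume "p \<in> {p. associated_prime (ring_KT t) I p \<and> \<not> monomial_ideal t p}"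
  then have "associated_prime (ring_KT t) I p" "\<not> monomial_ideal t p" by auto
  then show "p \<in> {P}"
    using associated_prime_cases[of p] Q_monomial by (auto simp: dependent_sets_def)
qed (use associated_prime_P not_monomial_P in auto)

end

section \<open>Consequences of regularity\<close>

text \<open>If \<open>F\<^sub>i = 0\<close> came first in a regular triple, then
  \<open>1 F\<^sub>i \<in> (0)\<close> would force \<open>1 = 0\<close>. If
  \<open>F\<^sub>i = F\<^sub>j\<close> for the first two entries, then
  \<open>1 F\<^sub>j \<in> (F\<^sub>i)\<close> would put 1 into \<open>(F\<^sub>i)\<close>, against
  properness. A third index exists as \<open>t \<ge> 3\<close>.\<close>

lemma star_of_regular_triples:
  fixes u :: "nat \<Rightarrow> nat \<Rightarrow> 'k::field"
  assumes r: "r \<ge> 1" and t3: "n + r \<ge> 3"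
    and reg: "\<And>i j k. \<lbrakk>i \<in> {1..n + r}; j \<in> {1..n + r}; k \<in> {1..n + r}; i \<noteq> j; i \<noteq> k; j \<noteq> k\<rbrakk>
      \<Longrightarrow> regular_sequence (ring_R n) [F n u i, F n u j, F n u k]"
  shows "star n r u"
proof
  let ?R = "ring_R n :: 'k mpoly ring"
  interpret R: cring ?R unfolding ring_R_def by (rule cring_mpoly_ring) simp
  have c: "carrier ?R = mpolys UNIV {1..n}" by (simp add: ring_R_def)
  have one: "1 \<in> carrier ?R" unfolding c by (rule subring_setD(1)[OF subring_set_mpolys]) simp
  have choose: "\<exists>k\<in>{1..n + r}. k \<notin> {i, j}" for i j
  proof -
    have "card {i, j} < card {1..n + r}" using t3 by (simp add: card_insert_if)
    then show ?thesis by (metis card_mono finite.emptyI finite.insertI not_less subsetI)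
  qed
  show "F n u i \<noteq> 0" if i: "i \<in> {1..n + r}" for i
  proof
    assume 0: "F n u i = 0"
    obtain j where j: "j \<in> {1..n + r}" "j \<noteq> i" using choose[of i i] by auto
    obtain k where k: "k \<in> {1..n + r}" "k \<noteq> i" "k \<noteq> j" using choose[of i j] by auto
    have reg': "\<forall>l<3. \<forall>a\<in>carrier ?R. a \<otimes>\<^bsub>?R\<^esub> [F n u i, F n u j, F n u k] ! l \<in> Idl\<^bsub>?R\<^esub> set (take l [F n u i, F n u j, F n u k]) \<longrightarrow>
        a \<in> Idl\<^bsub>?R\<^esub> set (take l [F n u i, F n u j, F n u k])"
      using reg[of i j k] i j k unfolding regular_sequence_def by simp
    have I0: "Idl\<^bsub>?R\<^esub> {} = {0}"
    proof -
      have "Idl\<^bsub>?R\<^esub> {} = gen_ideal (mpolys UNIV {1..n}) {}"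
        unfolding ring_R_def by (rule genideal_mpoly_ring) auto
      also have "\<dots> = {0}" by (auto elim: gen_ideal.cases intro: gen_ideal.zero)
      finally show ?thesis .
    qed
    have "1 \<otimes>\<^bsub>?R\<^esub> F n u i \<in> {0}" by (simp add: 0 ring_R_def)
    then have "1 \<in> ({0} :: 'k mpoly set)"
      using reg'[rule_format, of 0 1] one by (simp add: I0)
    then show False by simp
  qed
  show "inj_on (F n u) {1..n + r}"
  proof (rule inj_onI, rule ccontr)
    fix i j assume ij: "i \<in> {1..n + r}" "j \<in> {1..n + r}" "F n u i = F n u j" "i \<noteq> j"
    obtain k where k: "k \<in> {1..n + r}" "k \<noteq> i" "k \<noteq> j" using choose[of i j] by auto
    let ?fs = "[F n u i, F n u j, F n u k]"
    have rg: "regular_sequence ?R ?fs" using reg[of i j k] ij k by blast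
    then have sub: "set ?fs \<subseteq> carrier ?R" and proper: "Idl\<^bsub>?R\<^esub> (set ?fs) \<noteq> carrier ?R"
      and nzd: "\<forall>l<3. \<forall>a\<in>carrier ?R. a \<otimes>\<^bsub>?R\<^esub> ?fs ! l \<in> Idl\<^bsub>?R\<^esub> set (take l ?fs) \<longrightarrow> a \<in> Idl\<^bsub>?R\<^esub> set (take l ?fs)"
      unfolding regular_sequence_def by simp_all
    have Fi: "{F n u i} \<subseteq> carrier ?R" using sub by simp
    have "1 \<otimes>\<^bsub>?R\<^esub> F n u j \<in> Idl\<^bsub>?R\<^esub> {F n u i}"
      using R.genideal_self'[of "F n u i"] Fi by (simp add: ij(3) ring_R_def)
    then have 1: "1 \<in> Idl\<^bsub>?R\<^esub> {F n u i}"
      using nzd[rule_format, of 1 1] one by simp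
    have "Idl\<^bsub>?R\<^esub> {F n u i} \<subseteq> Idl\<^bsub>?R\<^esub> (set ?fs)"
      by (rule R.subset_Idl_subset[OF sub]) simp
    then have "\<one>\<^bsub>?R\<^esub> \<in> Idl\<^bsub>?R\<^esub> (set ?fs)" using 1 by (auto simp: ring_R_def)
    then have "Idl\<^bsub>?R\<^esub> (set ?fs) = carrier ?R"
      by (rule ideal.one_imp_carrier[OF R.genideal_ideal[OF sub]])
    then show False using proper by simp
  qed
qed (rule r)

theorem theorem1p3:
  fixes u :: "nat \<Rightarrow> nat \<Rightarrow> 'k::field" and n r :: nat
  assumes "infinite (UNIV :: 'k set)"
    and "r \<ge> 1"
    and "n + r \<ge> 3"
    and "\<And>i j k. \<lbrakk>i \<in> {1..n + r}; j \<in> {1..n + r}; k \<in> {1..n + r}; i \<noteq> j; i \<noteq> k; j \<noteq> k\<rbrakk>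
      \<Longrightarrow> regular_sequence (ring_R n) [F n u i, F n u j, F n u k]"
  shows "rees_defining_ideal n r u =
        linear_ideal n r u <+>\<^bsub>ring_S n (n + r)\<^esub>
        Idl\<^bsub>ring_S n (n + r)\<^esub> (KT_to_S ` P_ideal n r u) \<and>
      ((\<forall>\<Theta>. \<Theta> \<subseteq> {1..n + r} \<and> card \<Theta> = r - 1 \<longrightarrow> m_poly n r u \<Theta> \<noteq> 0) \<longrightarrow>
        {Q. associated_prime (ring_KT (n + r)) (jacobian_minors_ideal n r u) Q \<and>
            \<not> monomial_ideal (n + r) Q} = {P_ideal n r u})"
proof (intro conjI impI)
  interpret star n r u by (rule star_of_regular_triples[OF assms(2-4)])
  show "rees_defining_ideal n r u =
        linear_ideal n r u <+>\<^bsub>ring_S n (n + r)\<^esub>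
        Idl\<^bsub>ring_S n (n + r)\<^esub> (KT_to_S ` P_ideal n r u)"
    by (rule rees_defining_ideal_eq_sum)
  assume m: "\<forall>\<Theta>. \<Theta> \<subseteq> {1..n + r} \<and> card \<Theta> = r - 1 \<longrightarrow> m_poly n r u \<Theta> \<noteq> 0"
  interpret general_star n r u by unfold_locales (use m in blast)
  show "{Q. associated_prime (ring_KT (n + r)) (jacobian_minors_ideal n r u) Q \<and>
            \<not> monomial_ideal (n + r) Q} = {P_ideal n r u}"
    by (rule nonmonomial_associated_primes)
qed

end
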